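(* Let $n\ge 1$, let $1<p<r<\infty$, and let $q$ be defined by $\frac1p+\frac1q=1+\frac1r$. If $k\in L_{q,\infty,0}$ (a space of measurable functions on $\mathbb{R}^n$), then the operator $K_k: L_p(\mathbb{R}^n)\to L_r(\mathbb{R}^n)$ has a maximizer.
   Context: Write $\|f\|_p$ for $\|f\|_{L_p(\mathbb{R}^n)}$. For a measurable function $f$ on $\mathbb{R}^n$, its distribution function is $d_f(\lambda)=|\{x : |f(x)|>\lambda\}|$ (Lebesgue measure), and its decreasing rearrangement is $f^*(t)=\inf\{\lambda>0 : d_f(\lambda)\le t\}$, defined for $t\in[0,\infty)$. The weak $L_q$ space $L_{q,\infty}$ consists of the measurable functions $f$ with $\|f\|_{q,\infty}=\sup_{t>0}t^{1/q}f^*(t)<\infty$. The space $L_{q,\infty,0}$ is the subspace of $L_{q,\infty}$ consisting of the functions $f$ such that $\lim_{t\to0^+}t^{1/q}f^*(t)=\lim_{t\to\infty}t^{1/q}f^*(t)=0$. Let $\mathcal{S}(\mathbb{R}^n)$ be the Schwartz space. A tempered distribution $k$ on $\mathbb{R}^n$ belongs to $\mathrm{Cnv}(p,r)$ if there is a constant $C$ with $\|k*f\|_r\le C\|f\|_p$ for all $f\in\mathcal{S}(\mathbb{R}^n)$; then $K_k: L_p(\mathbb{R}^n)\to L_r(\mathbb{R}^n)$ denotes the unique continuous extension of $f\mapsto k*f$, with operator norm $\|K_k\|$. For $p,q,r$ as in the claim, every $k\in L_{q,\infty}$ belongs to $\mathrm{Cnv}(p,r)$ by the Hardy-Littlewood-Sobolev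 theorem (weak Young inequality), so $K_k$ is well defined. A maximizer for $K_k$ is a function $f\in L_p(\mathbb{R}^n)$ with $\|f\|_p=1$ and $\|K_kf\|_r=\|K_k\|$. *)

theory Defs
  imports "HOL-Analysis.Analysis"
begin

text \<open>All function spaces consist of complex-valued functions, represented by functions rather than
  by classes modulo almost-everywhere equality. Measurability is Lebesgue measurability.\<close>

section \<open>Lebesgue spaces\<close>

definition Lp :: "real \<Rightarrow> ('a::euclidean_space \<Rightarrow> complex) set" where
  "Lp p = {f \<in> borel_measurable lebesgue. integrable lebesgue (\<lambda>x. norm (f x) powr p)}"

definition Lp_norm :: "real \<Rightarrow> ('a::euclidean_space \<Rightarrow> complex) \<Rightarrow> real" where
  "Lp_norm p f = (\<integral>x. norm (f x) powr p \<partial>lebesgue) powr (1 / p)"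

section \<open>Weak Lebesgue spaces\<close>

definition distr_fun :: "('a::euclidean_space \<Rightarrow> complex) \<Rightarrow> real \<Rightarrow> ennreal" where
  "distr_fun f s = emeasure lebesgue {x. norm (f x) > s}"

text \<open>The value is \<open>\<infinity>\<close> if the set of admissible \<open>s\<close> is empty.\<close>

definition decr_rearr :: "('a::euclidean_space \<Rightarrow> complex) \<Rightarrow> real \<Rightarrow> ennreal" where
  "decr_rearr f t = Inf {ennreal s | s. s > 0 \<and> distr_fun f s \<le> ennreal t}"

definition weak_norm :: "real \<Rightarrow> ('a::euclidean_space \<Rightarrow> complex) \<Rightarrow> ennreal" where
  "weak_norm q f = (SUP t\<in>{0<..}. ennreal (t powr (1 / q)) * decr_rearr f t)"

definition weak_L :: "real \<Rightarrow> ('a::euclidean_space \<Rightarrow> complex) set" where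
  "weak_L q = {f \<in> borel_measurable lebesgue. weak_norm q f < \<infinity>}"

definition weak_L0 :: "real \<Rightarrow> ('a::euclidean_space \<Rightarrow> complex) set" where
  "weak_L0 q = {f \<in> weak_L q.
     ((\<lambda>t. ennreal (t powr (1 / q)) * decr_rearr f t) \<longlongrightarrow> 0) (at_right 0) \<and>
     ((\<lambda>t. ennreal (t powr (1 / q)) * decr_rearr f t) \<longlongrightarrow> 0) at_top}"

section \<open>Schwartz functions and tempered distributions\<close>

text \<open>Mixed partial derivatives are indexed by lists of basis vectors.\<close>

primrec partial_deriv :: "'a list \<Rightarrow> ('a::euclidean_space \<Rightarrow> complex) \<Rightarrow> 'a \<Rightarrow> complex" where
  "partial_deriv [] f = f"
| "partial_deriv (b # bs) f = (\<lambda>x. frechet_derivative (partial_deriv bs f) (at x) b)"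

definition schwartz :: "('a::euclidean_space \<Rightarrow> complex) set" where
  "schwartz = {f. \<forall>bs. set bs \<subseteq> Basis \<longrightarrow>
     (\<forall>x. partial_deriv bs f differentiable (at x)) \<and>
     (\<forall>N::nat. bdd_above (range (\<lambda>x. (1 + norm x) ^ N * norm (partial_deriv bs f x))))}"

definition schwartz_seminorm :: "nat \<Rightarrow> ('a::euclidean_space \<Rightarrow> complex) \<Rightarrow> real" where
  "schwartz_seminorm N f =
     (\<Sum>bs\<in>{bs. set bs \<subseteq> Basis \<and> length bs \<le> N}.
        SUP x. (1 + norm x) ^ N * norm (partial_deriv bs f x))"

text \<open>Distributions are functionals on all functions, of which only the values on Schwartz functions
  matter.\<close>

definition tempered :: "(('a::euclidean_space \<Rightarrow> complex) \<Rightarrow> complex) \<Rightarrow> bool" where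
  "tempered T \<longleftrightarrow>
     (\<forall>f\<in>schwartz. \<forall>g\<in>schwartz. T (\<lambda>x. f x + g x) = T f + T g) \<and>
     (\<forall>c. \<forall>f\<in>schwartz. T (\<lambda>x. c * f x) = c * T f) \<and>
     (\<exists>C N. \<forall>f\<in>schwartz. norm (T f) \<le> C * schwartz_seminorm N f)"

definition regular_distr :: "('a::euclidean_space \<Rightarrow> complex) \<Rightarrow> ('a \<Rightarrow> complex) \<Rightarrow> complex" where
  "regular_distr k f = (\<integral>x. k x * f x \<partial>lebesgue)"

definition conv :: "(('a::euclidean_space \<Rightarrow> complex) \<Rightarrow> complex) \<Rightarrow> ('a \<Rightarrow> complex) \<Rightarrow> 'a \<Rightarrow> complex" where
  "conv T f x = T (\<lambda>y. f (x - y))"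

section \<open>Convolution operators\<close>

definition Cnv :: "real \<Rightarrow> real \<Rightarrow> (('a::euclidean_space \<Rightarrow> complex) \<Rightarrow> complex) set" where
  "Cnv p r = {T. tempered T \<and>
     (\<exists>C. \<forall>f\<in>schwartz. conv T f \<in> Lp r \<and> Lp_norm r (conv T f) \<le> C * Lp_norm p f)}"

definition Lp_continuous ::
    "real \<Rightarrow> real \<Rightarrow> (('a::euclidean_space \<Rightarrow> complex) \<Rightarrow> ('a \<Rightarrow> complex)) \<Rightarrow> bool" where
  "Lp_continuous p r K \<longleftrightarrow>
     (\<forall>f\<in>Lp p. K f \<in> Lp r) \<and>
     (\<forall>f\<in>Lp p. \<forall>F. (\<forall>m::nat. F m \<in> Lp p) \<and> (\<lambda>m. Lp_norm p (\<lambda>x. F m x - f x)) \<longlonglongrightarrow> 0 \<longrightarrow>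
        (\<lambda>m. Lp_norm r (\<lambda>x. K (F m) x - K f x)) \<longlonglongrightarrow> 0)"

text \<open>For \<open>T \<in> Cnv p r\<close> with \<open>1 \<le> p, r < \<infinity>\<close> the continuous extension exists, and it is unique up to
  equality almost everywhere of its values, since Schwartz functions are dense in \<open>Lp p\<close>;
  the choice operator only selects representatives.\<close>

definition conv_op ::
    "real \<Rightarrow> real \<Rightarrow> (('a::euclidean_space \<Rightarrow> complex) \<Rightarrow> complex) \<Rightarrow> ('a \<Rightarrow> complex) \<Rightarrow> ('a \<Rightarrow> complex)" where
  "conv_op p r T = (SOME K. Lp_continuous p r K \<and>
     (\<forall>f\<in>schwartz. AE x in lebesgue. K f x = conv T f x))"

definition op_norm ::
    "real \<Rightarrow> real \<Rightarrow> (('a::euclidean_space \<Rightarrow> complex) \<Rightarrow> ('a \<Rightarrow> complex)) \<Rightarrow> real" where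
  "op_norm p r K = (SUP f\<in>{f \<in> Lp p. Lp_norm p f \<le> 1}. Lp_norm r (K f))"

definition is_maximizer ::
    "real \<Rightarrow> real \<Rightarrow> (('a::euclidean_space \<Rightarrow> complex) \<Rightarrow> ('a \<Rightarrow> complex)) \<Rightarrow> ('a \<Rightarrow> complex) \<Rightarrow> bool" where
  "is_maximizer p r K f \<longleftrightarrow> f \<in> Lp p \<and> Lp_norm p f = 1 \<and> Lp_norm r (K f) = op_norm p r K"

end

theory Submission
  imports Defs "HOL-Complex_Analysis.Great_Picard"
begin

text \<open>
  Why a maximizer exists. Write \<open>S\<close> for the supremum of \<open>\<integral>|k * f|\<^sup>r\<close> over \<open>\<integral>|f|\<^sup>p = 1\<close>, and let
  \<open>s = r / (r - 1)\<close>, \<open>p' = p / (p - 1)\<close>. If \<open>S = 0\<close>, every unit vector is a maximizer, so let \<open>S > 0\<close>. A kernel of \<open>weak_L0 q\<close> is a limit, in the weak norm, of its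
  truncations to \<open>{m < |k| \<le> M}\<close> (\<open>weak_L0_approximable\<close>), and by the weak Young inequality
  (\<open>weak_Young\<close>) convolution with \<open>k\<close> is therefore a limit, in operator norm, of convolutions with bounded
  kernels that vanish off a set of finite measure (\<open>approximable_operator\<close>). This fixes the length
  scale: a maximizing sequence cannot concentrate or spread out, and translations are the only way
  left to lose compactness.

  A maximizing sequence \<open>h\<^sub>j\<close> is first improved. Pairing \<open>k * h\<^sub>j\<close> with its dual function \<open>g\<^sub>j \<in> L\<^sub>s\<close>, and then
  replacing \<open>h\<^sub>j\<close> by the dual function \<open>F\<^sub>j\<close> of the adjoint convolution of \<open>g\<^sub>j\<close>, does not decrease the norm
  of the image, by Hoelder's inequality (\<open>improvement\<close>). What is gained is that \<open>F\<^sub>j\<close> is a continuous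
  function of a convolution of \<open>k\<close> with a bounded sequence, and such convolutions have subsequences
  that converge almost everywhere (\<open>convolve_AE_compact\<close>): weak sequential compactness gives pointwise convergence
  for each truncated kernel, and the truncations are uniformly close to \<open>k\<close>. Pointwise limits are wanted because
  for \<open>p \<noteq> 2\<close> a weak limit does not split the norm.

  Because \<open>p < r\<close>, the sequence does not vanish: a truncated kernel also maps into \<open>L\<^sub>t\<close> for an
  exponent \<open>t < r\<close>, so that an image which is large in \<open>L\<^sub>r\<close> must be large at some point
  (\<open>nonvanishing\<close>). Translating that point to the origin makes the limit \<open>G\<close> of \<open>F\<^sub>j\<close> nonzero.

  Finally the mass is counted. With \<open>\<alpha> = \<integral>|G|\<^sup>p \<in> (0, 1]\<close>, the lemma \<open>Brezis_Lieb\<close>, applied to \<open>F\<^sub>j\<close> in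
  \<open>L\<^sub>p\<close> and to \<open>k * F\<^sub>j\<close> in \<open>L\<^sub>r\<close>, gives \<open>S \<le> \<integral>|k * G|\<^sup>r + S (1 - \<alpha>)\<^bsup>r/p\<^esup>\<close>, whereas
  \<open>\<integral>|k * G|\<^sup>r \<le> S \<alpha>\<^bsup>r/p\<^esup>\<close>. Hence \<open>\<alpha>\<^bsup>r/p\<^esup> + (1 - \<alpha>)\<^bsup>r/p\<^esup> \<ge> 1\<close>, which for \<open>r > p\<close> forces \<open>\<alpha> = 1\<close>, and \<open>G\<close> is a
  maximizer (\<open>convolve_has_maximizer\<close>).

  The analysis is carried out with Borel functions and the Borel-Lebesgue measure, where Fubini's theorem is
  available. The operator \<open>conv_op\<close> is an arbitrary continuous extension from Schwartz functions; it
  agrees almost everywhere with the convolution integral because Schwartz functions are dense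
  (\<open>schwartz_dense\<close>), the functions \<open>exp (- (\<Sum>\<^sub>i y\<^sub>i\<^bsup>2m\<^esup>))\<close> being Schwartz functions that tend to the indicator of a box.
\<close>

section \<open>Lebesgue spaces over a measure\<close>

text \<open>The measure is a parameter because the same facts are needed for \<open>lborel\<close>, where convolutions
  live, and for \<open>lebesgue\<close>, over which \<open>Lp\<close> is defined.\<close>

definition lpspace :: "'a measure \<Rightarrow> real \<Rightarrow> ('a \<Rightarrow> complex) set" where
  "lpspace M p = {f \<in> borel_measurable M. integrable M (\<lambda>x. norm (f x) powr p)}"

text \<open>The \<open>p\<close>-th power of the norm, which splits under the Brezis-Lieb lemma without taking roots and satisfies
  the triangle inequality up to the factor \<open>2 powr p\<close>.\<close>

definition lpint :: "'a measure \<Rightarrow> real \<Rightarrow> ('a \<Rightarrow> complex) \<Rightarrow> real" where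
  "lpint M p f = (\<integral>x. norm (f x) powr p \<partial>M)"

lemma lpspaceD:
  assumes "f \<in> lpspace M p"
  shows "f \<in> borel_measurable M" "integrable M (\<lambda>x. norm (f x) powr p)"
  using assms by (auto simp: lpspace_def)

lemma lpint_nonneg [simp]: "0 \<le> lpint M p f"
  by (simp add: lpint_def)

lemma lpspace_dominated:
  assumes "f \<in> borel_measurable M" "g \<in> lpspace M p" "0 \<le> p"
    and "AE x in M. norm (f x) \<le> norm (g x)"
  shows "f \<in> lpspace M p" "lpint M p f \<le> lpint M p g"
proof -
  have *: "AE x in M. norm (f x) powr p \<le> norm (g x) powr p"
    using assms(4) by eventually_elim (use assms(3) in \<open>auto intro: powr_mono2\<close>)
  have [measurable]: "f \<in> borel_measurable M" by fact
  show f: "f \<in> lpspace M p"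
    unfolding lpspace_def using assms(1) lpspaceD[OF assms(2)] *
    by (auto intro!: Bochner_Integration.integrable_bound[where f = "\<lambda>x. norm (g x) powr p"])
  show "lpint M p f \<le> lpint M p g"
    unfolding lpint_def using f lpspaceD[OF assms(2)] * by (intro integral_mono_AE lpspaceD(2)[OF f]) auto
qed

lemma lpint_cong_AE:
  assumes "f \<in> borel_measurable M" "g \<in> borel_measurable M" "AE x in M. f x = g x"
  shows "lpint M p f = lpint M p g"
  unfolding lpint_def by (rule integral_cong_AE) (use assms in auto)

lemma norm_add_powr_le:
  fixes a b :: complex
  assumes "0 \<le> p"
  shows "norm (a + b) powr p \<le> 2 powr p * (norm a powr p + norm b powr p)"
proof -
  have "norm (a + b) \<le> 2 * max (norm a) (norm b)"
    using norm_triangle_ineq[of a b] by (simp add: max_def)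
  then have "norm (a + b) powr p \<le> (2 * max (norm a) (norm b)) powr p"
    using assms by (intro powr_mono2) auto
  also have "\<dots> = 2 powr p * max (norm a) (norm b) powr p"
    by (simp add: powr_mult)
  also have "max (norm a) (norm b) powr p \<le> norm a powr p + norm b powr p"
    by (auto simp: max_def)
  finally show ?thesis by (simp add: mult_left_mono)
qed

lemma lpspace_add:
  assumes f: "f \<in> lpspace M p" and g: "g \<in> lpspace M p" and "0 \<le> p"
  shows "(\<lambda>x. f x + g x) \<in> lpspace M p"
    "lpint M p (\<lambda>x. f x + g x) \<le> 2 powr p * (lpint M p f + lpint M p g)"
proof -
  note [measurable] = lpspaceD(1)[OF f] lpspaceD(1)[OF g]
  note [simp] = lpspaceD(2)[OF f] lpspaceD(2)[OF g]
  have int: "integrable M (\<lambda>x. 2 powr p * (norm (f x) powr p + norm (g x) powr p))"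
    by simp
  have "integrable M (\<lambda>x. norm (f x + g x) powr p)"
    by (rule Bochner_Integration.integrable_bound[OF int])
       (use norm_add_powr_le[OF \<open>0 \<le> p\<close>] in auto)
  then show 1: "(\<lambda>x. f x + g x) \<in> lpspace M p"
    by (simp add: lpspace_def)
  have "lpint M p (\<lambda>x. f x + g x) \<le> (\<integral>x. 2 powr p * (norm (f x) powr p + norm (g x) powr p) \<partial>M)"
    unfolding lpint_def
    by (intro integral_mono lpspaceD(2)[OF 1] int norm_add_powr_le \<open>0 \<le> p\<close>)
  then show "lpint M p (\<lambda>x. f x + g x) \<le> 2 powr p * (lpint M p f + lpint M p g)"
    by (simp add: lpint_def)
qed

lemma lpspace_scale:
  assumes "f \<in> lpspace M p"
  shows "(\<lambda>x. c * f x) \<in> lpspace M p"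
    "lpint M p (\<lambda>x. c * f x) = norm c powr p * lpint M p f"
  using lpspaceD[OF assms] by (auto simp: lpspace_def lpint_def norm_mult powr_mult)

lemma lpspace_diff:
  assumes "f \<in> lpspace M p" "g \<in> lpspace M p" "0 \<le> p"
  shows "(\<lambda>x. f x - g x) \<in> lpspace M p"
    "lpint M p (\<lambda>x. f x - g x) \<le> 2 powr p * (lpint M p f + lpint M p g)"
  using lpspace_add[OF assms(1) lpspace_scale(1)[OF assms(2), of "-1"] assms(3)]
    lpspace_scale(2)[OF assms(2), of "-1"] by auto

lemma lpspace_zero: "0 < p \<Longrightarrow> (\<lambda>x. 0) \<in> lpspace M p" "0 < p \<Longrightarrow> lpint M p (\<lambda>x. 0) = 0"
  by (auto simp: lpspace_def lpint_def)

lemma lpspace_indicator: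
  assumes "A \<in> sets M" "emeasure M A < \<infinity>" "0 < p"
  shows "(\<lambda>x. indicator A x :: complex) \<in> lpspace M p"
    "lpint M p (\<lambda>x. indicator A x) = measure M A"
proof -
  have *: "norm (indicator A x :: complex) powr p = indicator A x" for x
    using assms(3) by (auto simp: indicator_def)
  show "(\<lambda>x. indicator A x :: complex) \<in> lpspace M p"
    using assms unfolding lpspace_def by (auto simp: *)
  show "lpint M p (\<lambda>x. indicator A x) = measure M A"
    using assms unfolding lpint_def * by auto
qed

lemma lpint_eq_0_iff:
  assumes "f \<in> lpspace M p"
  shows "lpint M p f = 0 \<longleftrightarrow> (AE x in M. f x = 0)"
  unfolding lpint_def
  by (subst integral_nonneg_eq_0_iff_AE) (use lpspaceD[OF assms] in auto)

lemma lpint_tendsto_0_dominated: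
  assumes F: "\<And>i. F i \<in> borel_measurable M" and f: "f \<in> borel_measurable M"
    and h: "integrable M (\<lambda>x. norm (h x) powr p)" and "0 < p"
    and lim: "AE x in M. (\<lambda>i. F i x) \<longlonglongrightarrow> f x"
    and bound: "\<And>i. AE x in M. norm (F i x - f x) \<le> (h x :: real)"
  shows "(\<lambda>i. lpint M p (\<lambda>x. F i x - f x)) \<longlonglongrightarrow> 0"
proof -
  have "(\<lambda>i. \<integral>x. norm (F i x - f x) powr p \<partial>M) \<longlonglongrightarrow> (\<integral>x. 0 \<partial>M)"
  proof (rule integral_dominated_convergence)
    show "AE x in M. (\<lambda>i. norm (F i x - f x) powr p) \<longlonglongrightarrow> 0"
      using lim
    proof eventually_elim
      case (elim x)
      then have "(\<lambda>i. norm (F i x - f x)) \<longlonglongrightarrow> 0"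
        using LIM_zero tendsto_norm_zero by blast
      then show ?case using \<open>0 < p\<close>
        by (intro tendsto_zero_powrI[where b = p]) auto
    qed
    show "AE x in M. norm (norm (F i x - f x) powr p) \<le> norm (h x) powr p" for i
      using bound[of i] by eventually_elim (use \<open>0 < p\<close> in \<open>auto intro!: powr_mono2\<close>)
  qed (use F f h in auto)
  then show ?thesis by (simp add: lpint_def)
qed

lemma Young_powr:
  fixes a b :: real
  assumes "1 < p" "1 / p + 1 / q = 1" "0 \<le> a" "0 \<le> b"
  shows "a * b \<le> a powr p / p + b powr q / q"
proof -
  have "1 < q" using assms(1,2) by (smt (verit) divide_less_eq_1_pos divide_nonpos_pos zero_less_divide_iff divide_le_eq_1)
  then show ?thesis using Youngs_inequality[of p q a b] assms by auto
qed

lemma conj_exponent_gt_1: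
  fixes p q :: real
  assumes "1 < p" "1 / p + 1 / q = 1"
  shows "1 < q"
  using assms by (smt (verit) divide_less_eq_1_pos divide_nonpos_pos zero_less_divide_iff divide_le_eq_1)

lemma Holder_ineq:
  assumes f: "f \<in> lpspace M p" and g: "g \<in> lpspace M q" and pq: "1 < p" "1 / p + 1 / q = 1"
  shows "integrable M (\<lambda>x. f x * g x)"
    "(\<integral>x. norm (f x * g x) \<partial>M) \<le> lpint M p f powr (1 / p) * lpint M q g powr (1 / q)"
    "norm (\<integral>x. f x * g x \<partial>M) \<le> lpint M p f powr (1 / p) * lpint M q g powr (1 / q)"
proof -
  have "1 < q" by (rule conj_exponent_gt_1[OF pq])
  note [measurable] = lpspaceD(1)[OF f] lpspaceD(1)[OF g]
  note [simp] = lpspaceD(2)[OF f] lpspaceD(2)[OF g]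
  have young: "norm (a * b) \<le> norm a powr p / p + norm b powr q / q" for a b :: complex
    using Young_powr[OF pq, of "norm a" "norm b"] by (simp add: norm_mult)
  have I: "integrable M (\<lambda>x. norm (f x) powr p / p + norm (g x) powr q / q)"
    by simp
  show int: "integrable M (\<lambda>x. f x * g x)"
    by (rule Bochner_Integration.integrable_bound[OF I])
       (auto intro!: AE_I2 order_trans[OF young])
  show main: "(\<integral>x. norm (f x * g x) \<partial>M) \<le> lpint M p f powr (1 / p) * lpint M q g powr (1 / q)"
  proof (cases "lpint M p f = 0 \<or> lpint M q g = 0")
    case True
    then have "AE x in M. f x * g x = 0"
      using lpint_eq_0_iff[OF f] lpint_eq_0_iff[OF g] by auto
    then have "(\<integral>x. norm (f x * g x) \<partial>M) = (\<integral>x. 0 \<partial>M)"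
      by (intro integral_cong_AE) auto
    then show ?thesis by simp
  next
    case False
    define a where "a = lpint M p f powr (1 / p)"
    define b where "b = lpint M q g powr (1 / q)"
    have pos: "0 < lpint M p f" "0 < lpint M q g"
      using False by (auto simp: order_less_le)
    then have ab: "0 < a" "0 < b" by (auto simp: a_def b_def)
    have ap: "a powr p = lpint M p f" "b powr q = lpint M q g"
      using pos pq(1) \<open>1 < q\<close> by (auto simp: a_def b_def powr_powr)
    have pt: "norm (f x * g x) \<le> a * b * (norm (f x) powr p / (p * a powr p) + norm (g x) powr q / (q * b powr q))" for x
    proof -
      have "norm (f x) / a * (norm (g x) / b) \<le> (norm (f x) / a) powr p / p + (norm (g x) / b) powr q / q"
        using ab by (intro Young_powr[OF pq]) auto
      then show ?thesis
        using ab by (simp add: powr_divide norm_mult field_simps)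
    qed
    have "(\<integral>x. norm (f x * g x) \<partial>M) \<le> (\<integral>x. a * b * (norm (f x) powr p / (p * a powr p) + norm (g x) powr q / (q * b powr q)) \<partial>M)"
      by (intro integral_mono pt integrable_norm int) auto
    also have "\<dots> = a * b * (lpint M p f / (p * a powr p) + lpint M q g / (q * b powr q))"
      by (simp add: lpint_def)
    also have "\<dots> = a * b * (1 / p + 1 / q)"
      unfolding ap using pos by simp
    finally show ?thesis using pq by (simp add: a_def b_def)
  qed
  show "norm (\<integral>x. f x * g x \<partial>M) \<le> lpint M p f powr (1 / p) * lpint M q g powr (1 / q)"
    using main integral_norm_bound[of M "\<lambda>x. f x * g x"] by linarith
qed

section \<open>Bounded sequences converging almost everywhere\<close>

text \<open>The common core of the Brezis-Lieb lemma and of weak convergence of bounded sequences. The part of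
  \<open>X\<^sub>j\<close> exceeding \<open>\<epsilon> Y\<^sub>j\<close> is dominated by a fixed integrable function and tends to 0, while the rest has
  integral at most \<open>\<epsilon> B\<close>.\<close>

lemma integral_tendsto_0_splitting:
  fixes X Y :: "nat \<Rightarrow> 'a \<Rightarrow> real" and Z :: "'a \<Rightarrow> real"
  assumes X: "\<And>j. integrable M (X j)" "\<And>j x. 0 \<le> X j x"
    and Y: "\<And>j. integrable M (Y j)" "\<And>j x. 0 \<le> Y j x" "\<And>j. (\<integral>x. Y j x \<partial>M) \<le> B"
    and Z: "integrable M Z"
    and bound: "\<And>\<epsilon>. 0 < \<epsilon> \<Longrightarrow> \<exists>C\<ge>0. \<forall>j x. X j x \<le> \<epsilon> * Y j x + C * Z x"
    and lim: "AE x in M. (\<lambda>j. X j x) \<longlonglongrightarrow> 0"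
  shows "(\<lambda>j. \<integral>x. X j x \<partial>M) \<longlonglongrightarrow> 0"
proof -
  have main: "\<forall>\<^sub>F j in sequentially. (\<integral>x. X j x \<partial>M) < e" if "0 < e" for e
  proof -
    define \<epsilon> where "\<epsilon> = e / (2 * (\<bar>B\<bar> + 1))"
    have "0 < \<epsilon>" using that by (simp add: \<epsilon>_def)
    have \<epsilon>B: "\<epsilon> * B \<le> e / 2"
    proof -
      have "\<epsilon> * B \<le> \<epsilon> * (\<bar>B\<bar> + 1)" using \<open>0 < \<epsilon>\<close> by (intro mult_left_mono) auto
      also have "\<dots> = e / 2" unfolding \<epsilon>_def by (simp add: field_simps)
      finally show ?thesis .
    qed
    obtain C where C: "0 \<le> C" "\<And>j x. X j x \<le> \<epsilon> * Y j x + C * Z x"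
      using bound[OF \<open>0 < \<epsilon>\<close>] by blast
    define W where "W j x = max 0 (X j x - \<epsilon> * Y j x)" for j x
    have [measurable]: "X j \<in> borel_measurable M" "Y j \<in> borel_measurable M" "Z \<in> borel_measurable M" for j
      using X(1) Y(1) Z by auto
    have "(\<lambda>j. \<integral>x. W j x \<partial>M) \<longlonglongrightarrow> (\<integral>x. 0 \<partial>M)"
    proof (rule integral_dominated_convergence)
      show "integrable M (\<lambda>x. \<bar>C * Z x\<bar>)" using Z by simp
      show "AE x in M. norm (W j x) \<le> \<bar>C * Z x\<bar>" for j
        using C(2) by (intro AE_I2) (auto simp: W_def max_def abs_if, (smt (verit))+)
      show "AE x in M. (\<lambda>j. W j x) \<longlonglongrightarrow> 0"
        using lim
      proof eventually_elim
        case (elim x)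
        show ?case
          by (rule tendsto_sandwich[OF _ _ tendsto_const elim])
             (use X(2) Y(2) \<open>0 < \<epsilon>\<close> in \<open>auto simp: W_def intro!: always_eventually\<close>)
      qed
    qed (auto simp: W_def[abs_def])
    then have "\<forall>\<^sub>F j in sequentially. (\<integral>x. W j x \<partial>M) < e / 2"
      using \<open>0 < e\<close> by (intro order_tendstoD(2)) auto
    then show ?thesis
    proof eventually_elim
      case (elim j)
      have W: "integrable M (W j)"
        unfolding W_def using X(1) Y(1) by (intro integrable_max) auto
      have "(\<integral>x. X j x \<partial>M) \<le> (\<integral>x. W j x + \<epsilon> * Y j x \<partial>M)"
        using X(1) Y(1) W by (intro integral_mono) (auto simp: W_def)
      also have "\<dots> = (\<integral>x. W j x \<partial>M) + \<epsilon> * (\<integral>x. Y j x \<partial>M)"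
        using X(1) Y(1) W by simp
      also have "\<epsilon> * (\<integral>x. Y j x \<partial>M) \<le> \<epsilon> * B"
        using Y(3) \<open>0 < \<epsilon>\<close> by (intro mult_left_mono) auto
      finally show ?case using elim \<epsilon>B by linarith
    qed
  qed
  show ?thesis
  proof (rule tendstoI)
    fix e :: real assume "0 < e"
    from main[OF this] show "\<forall>\<^sub>F j in sequentially. dist (\<integral>x. X j x \<partial>M) 0 < e"
      by eventually_elim (use X(2) in \<open>simp add: integral_nonneg_AE\<close>)
  qed
qed

text \<open>For \<open>p > 1\<close>, Young's inequality bounds \<open>|\<phi> (f\<^sub>j - F)|\<close> by \<open>\<epsilon> |f\<^sub>j - F|\<^sup>p\<close> plus a multiple of \<open>|\<phi>|\<^sup>q\<close>, which is
  the splitting required above.\<close>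

lemma weak_limit_of_AE_limit:
  assumes f: "\<And>j. f j \<in> lpspace M p" and F: "F \<in> lpspace M p"
    and bd: "\<And>j. lpint M p (f j) \<le> B" and \<phi>: "\<phi> \<in> lpspace M q"
    and pq: "1 < p" "1 / p + 1 / q = 1"
    and lim: "AE x in M. (\<lambda>j. f j x) \<longlonglongrightarrow> F x"
  shows "(\<lambda>j. \<integral>x. \<phi> x * f j x \<partial>M) \<longlonglongrightarrow> (\<integral>x. \<phi> x * F x \<partial>M)"
proof -
  have "1 < q" by (rule conj_exponent_gt_1[OF pq])
  have qp: "1 / q + 1 / p = 1" using pq by simp
  have d: "(\<lambda>x. f j x - F x) \<in> lpspace M p" for j
    using lpspace_diff[OF f F] pq by auto
  have "(\<lambda>j. \<integral>x. norm (\<phi> x * (f j x - F x)) \<partial>M) \<longlonglongrightarrow> 0"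
  proof (rule integral_tendsto_0_splitting[where Y = "\<lambda>j x. norm (f j x - F x) powr p"
        and Z = "\<lambda>x. norm (\<phi> x) powr q" and B = "2 powr p * (B + lpint M p F)"])
    show "integrable M (\<lambda>x. norm (\<phi> x * (f j x - F x)))" for j
      using Holder_ineq(1)[OF \<phi> d \<open>1 < q\<close> qp] by (rule integrable_norm)
    show "integrable M (\<lambda>x. norm (f j x - F x) powr p)" for j using lpspaceD(2)[OF d] .
    show "(\<integral>x. norm (f j x - F x) powr p \<partial>M) \<le> 2 powr p * (B + lpint M p F)" for j
    proof -
      have "lpint M p (\<lambda>x. f j x - F x) \<le> 2 powr p * (lpint M p (f j) + lpint M p F)"
        using lpspace_diff(2)[OF f F] pq by auto
      also have "\<dots> \<le> 2 powr p * (B + lpint M p F)" using bd by (intro mult_left_mono) auto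
      finally show ?thesis by (simp add: lpint_def)
    qed
    show "integrable M (\<lambda>x. norm (\<phi> x) powr q)" using lpspaceD(2)[OF \<phi>] .
    show "AE x in M. (\<lambda>j. norm (\<phi> x * (f j x - F x))) \<longlonglongrightarrow> 0"
      using lim
    proof eventually_elim
      case (elim x)
      then have "(\<lambda>j. f j x - F x) \<longlonglongrightarrow> 0" by (rule LIM_zero)
      then show ?case by (intro tendsto_norm_zero tendsto_mult_right_zero)
    qed
    fix \<epsilon> :: real assume "0 < \<epsilon>"
    define l where "l = (\<epsilon> * p) powr (1 / p)"
    have l: "0 < l" "l powr p = \<epsilon> * p" using \<open>0 < \<epsilon>\<close> pq by (auto simp: l_def powr_powr)
    have "norm (\<phi> x * (f j x - F x)) \<le> \<epsilon> * norm (f j x - F x) powr p + 1 / (q * l powr q) * norm (\<phi> x) powr q" for j x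
    proof -
      have "(l * norm (f j x - F x)) * (norm (\<phi> x) / l)
        \<le> (l * norm (f j x - F x)) powr p / p + (norm (\<phi> x) / l) powr q / q"
        using l by (intro Young_powr[OF pq]) auto
      also have "\<dots> = \<epsilon> * norm (f j x - F x) powr p + 1 / (q * l powr q) * norm (\<phi> x) powr q"
        using l pq by (simp add: powr_mult powr_divide)
      finally show ?thesis using l by (simp add: norm_mult mult.commute)
    qed
    moreover have "0 \<le> 1 / (q * l powr q)" using \<open>1 < q\<close> by simp
    ultimately show "\<exists>C\<ge>0. \<forall>j x. norm (\<phi> x * (f j x - F x)) \<le> \<epsilon> * norm (f j x - F x) powr p + C * norm (\<phi> x) powr q"
      by blast
  qed auto
  then have "(\<lambda>j. \<integral>x. \<phi> x * (f j x - F x) \<partial>M) \<longlonglongrightarrow> 0"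
    by (rule Lim_null_comparison[rotated]) (auto intro!: always_eventually integral_norm_bound)
  moreover have "(\<integral>x. \<phi> x * (f j x - F x) \<partial>M) = (\<integral>x. \<phi> x * f j x \<partial>M) - (\<integral>x. \<phi> x * F x \<partial>M)" for j
    using Holder_ineq(1)[OF \<phi> f \<open>1 < q\<close> qp] Holder_ineq(1)[OF \<phi> F \<open>1 < q\<close> qp]
    by (simp add: algebra_simps)
  ultimately show ?thesis by (simp add: LIM_zero_iff)
qed

text \<open>Convexity of the power, applied to \<open>s + t = (1 - l) (s / (1 - l)) + l (t / l)\<close>.\<close>

lemma powr_convex_split:
  fixes s t l p :: real
  assumes "0 \<le> s" "0 \<le> t" "0 < l" "l < 1" "1 \<le> p"
  shows "(s + t) powr p \<le> (1 - l) powr (1 - p) * s powr p + l powr (1 - p) * t powr p"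
proof (cases "s = 0 \<or> t = 0")
  case True
  have "1 \<le> l powr (1 - p)" "1 \<le> (1 - l) powr (1 - p)"
    using assms powr_mono'[of "1 - p" 0 l] powr_mono'[of "1 - p" 0 "1 - l"] by auto
  then show ?thesis
    using True mult_right_mono[of 1 "l powr (1 - p)" "t powr p"]
      mult_right_mono[of 1 "(1 - l) powr (1 - p)" "s powr p"] by auto
next
  case False
  have "((1 - l) *\<^sub>R (s / (1 - l)) + l *\<^sub>R (t / l)) powr p
      \<le> (1 - l) * (s / (1 - l)) powr p + l * (t / l) powr p"
    using assms False by (intro convex_onD[OF powr_convex]) auto
  moreover have "(1 - l) * (s / (1 - l)) powr p = (1 - l) powr (1 - p) * s powr p"
    using assms by (simp add: powr_divide powr_diff)
  moreover have "l * (t / l) powr p = l powr (1 - p) * t powr p"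
    using assms by (simp add: powr_divide powr_diff)
  ultimately show ?thesis using assms by simp
qed

text \<open>The factor \<open>(1 - l) powr (1 - p)\<close> of the previous lemma tends to 1 as \<open>l\<close> tends to 0; applying it to \<open>(a, b)\<close>
  and to \<open>(a + b, - b)\<close> bounds the increment from both sides.\<close>

lemma norm_powr_increment:
  fixes \<epsilon> p :: real
  assumes "1 \<le> p" "0 < \<epsilon>"
  shows "\<exists>C\<ge>0. \<forall>a b :: complex. \<bar>norm (a + b) powr p - norm a powr p\<bar> \<le> \<epsilon> * norm a powr p + C * norm b powr p"
proof -
  \<comment> \<open>The lower bound carries \<open>\<delta> |a + b|\<^sup>p\<close>, which costs another factor \<open>2 powr p\<close>.\<close>
  define \<delta> where "\<delta> = min 1 (\<epsilon> / (2 powr p))"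
  have \<delta>: "0 < \<delta>" "\<delta> \<le> 1" "\<delta> * 2 powr p \<le> \<epsilon>"
    using assms by (auto simp: \<delta>_def min_def field_simps)
  have "((\<lambda>l. (1 - l) powr (1 - p)) \<longlongrightarrow> (1 - 0) powr (1 - p)) (at_right (0::real))"
    by (intro tendsto_intros) auto
  then have "\<forall>\<^sub>F l in at_right (0::real). (1 - l) powr (1 - p) < 1 + \<delta>"
    using \<delta> by (intro order_tendstoD(2)) auto
  moreover have "\<forall>\<^sub>F l in at_right (0::real). 0 < l \<and> l < 1"
    using eventually_at_right_real[of 0 1] by (auto elim: eventually_mono)
  ultimately have "\<forall>\<^sub>F l in at_right (0::real). 0 < l \<and> l < 1 \<and> (1 - l) powr (1 - p) < 1 + \<delta>"
    by eventually_elim auto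
  then obtain l where l: "0 < l" "l < 1" "(1 - l) powr (1 - p) < 1 + \<delta>"
    using eventually_happens[of _ "at_right (0::real)"] by auto
  define D where "D = l powr (1 - p)"
  have "0 \<le> D" by (simp add: D_def)
  have one: "norm (a + b) powr p \<le> (1 + \<delta>) * norm a powr p + D * norm b powr p" for a b :: complex
  proof -
    have "norm (a + b) powr p \<le> (norm a + norm b) powr p"
      using assms by (intro powr_mono2 norm_triangle_ineq) auto
    also have "\<dots> \<le> (1 - l) powr (1 - p) * norm a powr p + l powr (1 - p) * norm b powr p"
      using l assms by (intro powr_convex_split) auto
    also have "\<dots> \<le> (1 + \<delta>) * norm a powr p + D * norm b powr p"
      unfolding D_def using l by (intro add_mono mult_right_mono) auto
    finally show ?thesis .
  qed
  have "\<bar>norm (a + b) powr p - norm a powr p\<bar> \<le> \<epsilon> * norm a powr p + (D + \<epsilon>) * norm b powr p" for a b :: complex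
  proof (rule abs_leI)
    have "\<delta> * 1 \<le> \<delta> * 2 powr p" using \<delta> assms by (intro mult_left_mono ge_one_powr_ge_zero) auto
    then have "\<delta> \<le> \<epsilon>" using \<delta> by linarith
    then have "\<delta> * norm a powr p \<le> \<epsilon> * norm a powr p" by (intro mult_right_mono) auto
    moreover have "0 \<le> \<epsilon> * norm b powr p" using assms by simp
    ultimately show "norm (a + b) powr p - norm a powr p \<le> \<epsilon> * norm a powr p + (D + \<epsilon>) * norm b powr p"
      using one[of a b] by (simp add: algebra_simps)
    have "norm a powr p \<le> (1 + \<delta>) * norm (a + b) powr p + D * norm b powr p"
      using one[of "a + b" "- b"] by simp
    moreover have "\<delta> * norm (a + b) powr p \<le> \<epsilon> * (norm a powr p + norm b powr p)"
    proof -
      have "\<delta> * norm (a + b) powr p \<le> \<delta> * (2 powr p * (norm a powr p + norm b powr p))"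
        using \<delta> assms by (intro mult_left_mono norm_add_powr_le) auto
      also have "\<dots> = (\<delta> * 2 powr p) * (norm a powr p + norm b powr p)" by simp
      also have "\<dots> \<le> \<epsilon> * (norm a powr p + norm b powr p)"
        using \<delta> by (intro mult_right_mono) auto
      finally show ?thesis .
    qed
    ultimately show "- (norm (a + b) powr p - norm a powr p) \<le> \<epsilon> * norm a powr p + (D + \<epsilon>) * norm b powr p"
      by (simp add: algebra_simps)
  qed
  then show ?thesis using \<open>0 \<le> D\<close> assms by (intro exI[of _ "D + \<epsilon>"]) auto
qed

text \<open>Almost everywhere convergence splits the norm exactly: the mass lost in the limit is the mass of the
  difference.\<close>

lemma Brezis_Lieb:
  assumes f: "\<And>j. f j \<in> lpspace M p" and F: "F \<in> lpspace M p"
    and bd: "\<And>j. lpint M p (f j) \<le> B" and p: "1 \<le> p"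
    and lim: "AE x in M. (\<lambda>j. f j x) \<longlonglongrightarrow> F x"
  shows "(\<lambda>j. lpint M p (f j) - lpint M p (\<lambda>x. f j x - F x)) \<longlonglongrightarrow> lpint M p F"
proof -
  have d: "(\<lambda>x. f j x - F x) \<in> lpspace M p" for j
    using lpspace_diff[OF f F] p by auto
  note i1 = lpspaceD(2)[OF f] and i2 = lpspaceD(2)[OF F] and i3 = lpspaceD(2)[OF d]
  let ?X = "\<lambda>j x. \<bar>norm (f j x) powr p - norm (f j x - F x) powr p - norm (F x) powr p\<bar>"
  have "(\<lambda>j. \<integral>x. ?X j x \<partial>M) \<longlonglongrightarrow> 0"
  proof (rule integral_tendsto_0_splitting[where Y = "\<lambda>j x. norm (f j x - F x) powr p"
        and Z = "\<lambda>x. norm (F x) powr p" and B = "2 powr p * (B + lpint M p F)"])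
    show "integrable M (?X j)" for j
      using i1 i2 i3 by auto
    show "integrable M (\<lambda>x. norm (f j x - F x) powr p)" for j by (rule i3)
    show "(\<integral>x. norm (f j x - F x) powr p \<partial>M) \<le> 2 powr p * (B + lpint M p F)" for j
    proof -
      have "lpint M p (\<lambda>x. f j x - F x) \<le> 2 powr p * (lpint M p (f j) + lpint M p F)"
        using lpspace_diff(2)[OF f F] p by auto
      also have "\<dots> \<le> 2 powr p * (B + lpint M p F)" using bd by (intro mult_left_mono) auto
      finally show ?thesis by (simp add: lpint_def)
    qed
    show "integrable M (\<lambda>x. norm (F x) powr p)" by (rule i2)
    show "AE x in M. (\<lambda>j. ?X j x) \<longlonglongrightarrow> 0"
      using lim
    proof eventually_elim
      case (elim x)
      have "(\<lambda>j. norm (f j x - F x)) \<longlonglongrightarrow> 0" using elim LIM_zero tendsto_norm_zero by blast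
      then have "(\<lambda>j. norm (f j x - F x) powr p) \<longlonglongrightarrow> 0"
        using p by (intro tendsto_zero_powrI[where b = p]) auto
      moreover have "(\<lambda>j. norm (f j x) powr p) \<longlonglongrightarrow> norm (F x) powr p"
        by (rule tendsto_powr'[OF tendsto_norm[OF elim] tendsto_const]) (use p in auto)
      ultimately have "(\<lambda>j. norm (f j x) powr p - norm (f j x - F x) powr p - norm (F x) powr p)
        \<longlonglongrightarrow> norm (F x) powr p - 0 - norm (F x) powr p"
        by (intro tendsto_diff tendsto_const)
      then show ?case by (simp add: tendsto_rabs_zero_iff)
    qed
    fix \<epsilon> :: real assume "0 < \<epsilon>"
    from norm_powr_increment[OF p this] obtain C where C: "0 \<le> C"
      "\<And>a b :: complex. \<bar>norm (a + b) powr p - norm a powr p\<bar> \<le> \<epsilon> * norm a powr p + C * norm b powr p" by blast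
    have "?X j x \<le> \<epsilon> * norm (f j x - F x) powr p + (C + 1) * norm (F x) powr p" for j x
    proof -
      have "\<bar>norm (f j x) powr p - norm (f j x - F x) powr p\<bar> \<le> \<epsilon> * norm (f j x - F x) powr p + C * norm (F x) powr p"
        using C(2)[of "f j x - F x" "F x"] by simp
      moreover have "0 \<le> norm (F x) powr p" by simp
      ultimately show ?thesis unfolding distrib_right mult_1 by linarith
    qed
    then show "\<exists>C\<ge>0. \<forall>j x. ?X j x \<le> \<epsilon> * norm (f j x - F x) powr p + C * norm (F x) powr p"
      using C(1) by (intro exI[of _ "C + 1"]) auto
  qed auto
  then have "(\<lambda>j. \<integral>x. norm (f j x) powr p - norm (f j x - F x) powr p - norm (F x) powr p \<partial>M) \<longlonglongrightarrow> 0"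
    by (rule Lim_null_comparison[rotated]) (auto intro!: always_eventually integral_abs_bound)
  then have "(\<lambda>j. lpint M p (f j) - lpint M p (\<lambda>x. f j x - F x) - lpint M p F) \<longlonglongrightarrow> 0"
    using i1 i2 i3 by (simp add: lpint_def)
  then show ?thesis by (simp add: LIM_zero_iff)
qed

text \<open>Fatou's lemma.\<close>

lemma lpspace_AE_limit:
  assumes f: "\<And>j. f j \<in> lpspace M p" "\<And>j. lpint M p (f j) \<le> B" and [measurable]: "F \<in> borel_measurable M"
    and lim: "AE x in M. (\<lambda>j::nat. f j x) \<longlonglongrightarrow> F x" and p: "0 < p"
  shows "F \<in> lpspace M p" "lpint M p F \<le> B"
proof -
  have [measurable]: "f j \<in> borel_measurable M" for j using lpspaceD(1)[OF f(1)] .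
  have B: "0 \<le> B" using f(2)[of 0] lpint_nonneg[of M p "f 0"] by linarith
  have "(\<integral>\<^sup>+x. ennreal (norm (F x) powr p) \<partial>M) = (\<integral>\<^sup>+x. liminf (\<lambda>j. ennreal (norm (f j x) powr p)) \<partial>M)"
  proof (rule nn_integral_cong_AE)
    show "AE x in M. ennreal (norm (F x) powr p) = liminf (\<lambda>j. ennreal (norm (f j x) powr p))"
      using lim
    proof eventually_elim
      case (elim x)
      have "(\<lambda>j. norm (f j x) powr p) \<longlonglongrightarrow> norm (F x) powr p"
        by (rule tendsto_powr'[OF tendsto_norm[OF elim] tendsto_const]) (use p in auto)
      then have "(\<lambda>j. ennreal (norm (f j x) powr p)) \<longlonglongrightarrow> ennreal (norm (F x) powr p)"
        by (rule tendsto_ennrealI)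
      then show ?case by (intro lim_imp_Liminf[symmetric]) auto
    qed
  qed
  also have "\<dots> \<le> liminf (\<lambda>j. \<integral>\<^sup>+x. ennreal (norm (f j x) powr p) \<partial>M)"
    by (rule nn_integral_liminf) measurable
  also have "\<dots> \<le> ennreal B"
  proof (rule Liminf_le)
    show "\<forall>\<^sub>F j in sequentially. (\<integral>\<^sup>+x. ennreal (norm (f j x) powr p) \<partial>M) \<le> ennreal B"
    proof (rule always_eventually, rule allI)
      fix j
      have "(\<integral>\<^sup>+x. ennreal (norm (f j x) powr p) \<partial>M) = ennreal (lpint M p (f j))"
        unfolding lpint_def using lpspaceD(2)[OF f(1)] by (intro nn_integral_eq_integral) auto
      also have "\<dots> \<le> ennreal B" by (intro ennreal_leI f(2))
      finally show "(\<integral>\<^sup>+x. ennreal (norm (f j x) powr p) \<partial>M) \<le> ennreal B" .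
    qed
  qed simp
  finally have le: "(\<integral>\<^sup>+x. ennreal (norm (F x) powr p) \<partial>M) \<le> ennreal B" .
  have I: "integrable M (\<lambda>x. norm (F x) powr p)"
  proof (rule integrableI_bounded)
    show "(\<integral>\<^sup>+x. ennreal (norm (norm (F x) powr p)) \<partial>M) < \<infinity>"
      using le_less_trans[OF le, of \<infinity>] by simp
  qed measurable
  then show "F \<in> lpspace M p" by (simp add: lpspace_def)
  have "ennreal (lpint M p F) \<le> ennreal B"
    unfolding lpint_def using le by (subst nn_integral_eq_integral[symmetric, OF I]) auto
  then show "lpint M p F \<le> B" using B by simp
qed

section \<open>Density of box indicators and weak compactness\<close>

lemma borel_eq_rational_boxes:
  "sets (borel :: 'a::euclidean_space measure) =
    sigma_sets UNIV {box a b | a b. (\<forall>i\<in>Basis. a \<bullet> i \<in> \<rat>) \<and> (\<forall>i\<in>Basis. b \<bullet> i \<in> \<rat>)}"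
  (is "_ = sigma_sets UNIV ?G")
proof -
  have "(borel :: 'a measure) = sigma UNIV ?G"
  proof (rule borel_eq_sigmaI1[OF borel_def, where F = "\<lambda>x. x" and A = ?G, unfolded image_ident])
    fix M :: "'a set" assume "M \<in> {S. open S}"
    then have "open M" by simp
    show "M \<in> sets (sigma UNIV ?G)"
    proof (subst open_UNION_box[OF \<open>open M\<close>], safe intro!: sets.countable_UN')
      show "countable {f \<in> Basis \<rightarrow>\<^sub>E \<rat> \<times> \<rat>. box (\<Sum>(i::'a)\<in>Basis. fst (f i) *\<^sub>R i) (\<Sum>(i::'a)\<in>Basis. snd (f i) *\<^sub>R i) \<subseteq> M}"
        by (intro countable_Collect countable_PiE) (auto intro: countable_rat)
    next
      fix f :: "'a \<Rightarrow> real \<times> real" assume "f \<in> Basis \<rightarrow>\<^sub>E \<rat> \<times> \<rat>"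
      then have "box (\<Sum>(i::'a)\<in>Basis. fst (f i) *\<^sub>R i) (\<Sum>(i::'a)\<in>Basis. snd (f i) *\<^sub>R i) \<in> ?G"
        by (intro CollectI exI conjI refl) (force simp: PiE_iff mem_Times_iff)+
      then show "box (\<Sum>(i::'a)\<in>Basis. fst (f i) *\<^sub>R i) (\<Sum>(i::'a)\<in>Basis. snd (f i) *\<^sub>R i) \<in> sets (sigma UNIV ?G)"
        by (intro in_measure_of) auto
    qed
  qed auto
  then have "sets (borel :: 'a measure) = sets (sigma UNIV ?G)" by (rule arg_cong)
  also have "\<dots> = sigma_sets UNIV ?G" by (rule sets_measure_of) simp
  finally show ?thesis .
qed

lemma Int_stable_rational_boxes:
  "Int_stable {box a b | a b :: 'a::euclidean_space. (\<forall>i\<in>Basis. a \<bullet> i \<in> \<rat>) \<and> (\<forall>i\<in>Basis. b \<bullet> i \<in> \<rat>)}"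
proof (rule Int_stableI, safe)
  fix a b c d :: 'a
  assume "\<forall>i\<in>Basis. a \<bullet> i \<in> \<rat>" "\<forall>i\<in>Basis. b \<bullet> i \<in> \<rat>" "\<forall>i\<in>Basis. c \<bullet> i \<in> \<rat>" "\<forall>i\<in>Basis. d \<bullet> i \<in> \<rat>"
  then show "\<exists>a' b'. box a b \<inter> box c d = box a' b' \<and> (\<forall>i\<in>Basis. a' \<bullet> i \<in> \<rat>) \<and> (\<forall>i\<in>Basis. b' \<bullet> i \<in> \<rat>)"
    unfolding box_Int_box
    by (intro exI[of _ "\<Sum>i\<in>Basis. max (a \<bullet> i) (c \<bullet> i) *\<^sub>R i"]
          exI[of _ "\<Sum>i\<in>Basis. min (b \<bullet> i) (d \<bullet> i) *\<^sub>R i"] conjI refl)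
       (auto simp: max_def min_def)
qed

text \<open>Boxes with rational vertices are countably many, closed under intersection and generate the Borel sets, so
  a closed subspace of \<open>L\<^sub>p\<close> containing their indicators is everything. The induction rule serves both the
  density of Schwartz functions and, thanks to countability, the diagonal argument for weak compactness.\<close>

lemma lpspace_induct [consumes 2, case_names box add scale lim]:
  fixes f :: "'a::euclidean_space \<Rightarrow> complex"
  assumes f: "f \<in> lpspace lborel p" and p: "0 < p"
    and box: "\<And>a b. (\<forall>i\<in>Basis. a \<bullet> i \<in> \<rat>) \<Longrightarrow> (\<forall>i\<in>Basis. b \<bullet> i \<in> \<rat>) \<Longrightarrow> P (\<lambda>x. indicator (box a b) x)"
    and add: "\<And>f g. f \<in> lpspace lborel p \<Longrightarrow> g \<in> lpspace lborel p \<Longrightarrow> P f \<Longrightarrow> P g \<Longrightarrow> P (\<lambda>x. f x + g x)"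
    and scale: "\<And>f c. f \<in> lpspace lborel p \<Longrightarrow> P f \<Longrightarrow> P (\<lambda>x. c * f x)"
    and lim: "\<And>F f. (\<And>i. F i \<in> lpspace lborel p) \<Longrightarrow> (\<And>i. P (F i)) \<Longrightarrow> f \<in> lpspace lborel p \<Longrightarrow>
       (\<lambda>i::nat. lpint lborel p (\<lambda>x. F i x - f x)) \<longlonglongrightarrow> 0 \<Longrightarrow> P f"
  shows "P f"
proof -
  let ?G = "{box a b | a b :: 'a. (\<forall>i\<in>Basis. a \<bullet> i \<in> \<rat>) \<and> (\<forall>i\<in>Basis. b \<bullet> i \<in> \<rat>)}"
  have fin_box: "emeasure lborel (box a b :: 'a set) < \<infinity>" for a b
    by (metis emeasure_lborel_box_finite)
  have ind: "(\<lambda>x. indicator A x :: complex) \<in> lpspace lborel p"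
    if "A \<in> sets borel" "emeasure lborel A < \<infinity>" for A :: "'a set"
    using that p by (intro lpspace_indicator) auto
  have ind_box: "(\<lambda>x. indicator (A \<inter> box a b) x :: complex) \<in> lpspace lborel p"
    if "A \<in> sets borel" for A :: "'a set" and a b
  proof (rule ind)
    have "emeasure lborel (A \<inter> box a b) \<le> emeasure lborel (box a b)"
      by (intro emeasure_mono) auto
    then show "emeasure lborel (A \<inter> box a b) < \<infinity>" using fin_box[of a b] by (rule le_less_trans)
  qed (use that in auto)
  have ind_lim: "P (\<lambda>x. indicator A x)"
    if A: "\<And>n. A' n \<in> sets borel" "\<And>n. emeasure lborel (A' n) < \<infinity>" "\<And>n. P (\<lambda>x. indicator (A' n) x)"
      "A \<in> sets borel" "emeasure lborel A < \<infinity>" "\<And>n. A' n \<subseteq> A"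
      "\<And>x. x \<in> A \<Longrightarrow> \<forall>\<^sub>F n in sequentially. x \<in> A' n" for A' :: "nat \<Rightarrow> 'a set" and A
  proof (rule lim)
    show "(\<lambda>n. lpint lborel p (\<lambda>x. indicator (A' n) x - indicator A x)) \<longlonglongrightarrow> 0"
    proof (rule lpint_tendsto_0_dominated)
      have "(\<lambda>x. norm (indicator A x :: real) powr p) = indicator A"
        using p by (auto simp: indicator_def)
      then show "integrable lborel (\<lambda>x. norm (indicator A x :: real) powr p)"
        using A by simp
      show "AE x in lborel. (\<lambda>i. indicator (A' i) x :: complex) \<longlonglongrightarrow> indicator A x"
      proof (rule AE_I2)
        fix x
        show "(\<lambda>i. indicator (A' i) x :: complex) \<longlonglongrightarrow> indicator A x"
        proof (cases "x \<in> A")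
          case True
          show ?thesis by (rule tendsto_eventually) (use A(7)[OF True] True in \<open>auto elim: eventually_mono\<close>)
        next
          case False
          then have "indicator (A' i) x = (0::complex)" for i using A(6)[of i] by (auto simp: indicator_def)
          then show ?thesis using False by simp
        qed
      qed
      show "AE x in lborel. norm (indicator (A' i) x - indicator A x :: complex) \<le> indicator A x" for i
        using A(6)[of i] by (auto simp: indicator_def)
    qed (use A p in auto)
  qed (use A ind in auto)
  have zero: "P (\<lambda>x. 0)"
    using scale[OF ind[of "{}"], of 0] box[of 0 0] by simp
  have step1: "P (\<lambda>x. indicator (A \<inter> box a b) x)"
    if "A \<in> sets borel" and ab: "(\<forall>i\<in>Basis. a \<bullet> i \<in> \<rat>)" "(\<forall>i\<in>Basis. b \<bullet> i \<in> \<rat>)" for A :: "'a set" and a b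
  proof -
    have "Int_stable ?G" "?G \<subseteq> Pow UNIV" "A \<in> sigma_sets UNIV ?G"
      using that(1) by (simp_all add: borel_eq_rational_boxes Int_stable_rational_boxes)
    then show ?thesis
    proof (induction rule: sigma_sets_induct_disjoint)
      case (basic A)
      then obtain c d where cd: "A = box c d" "(\<forall>i\<in>Basis. c \<bullet> i \<in> \<rat>)" "(\<forall>i\<in>Basis. d \<bullet> i \<in> \<rat>)" by auto
      show ?case unfolding cd box_Int_box
        using cd ab by (intro box) (auto simp: max_def min_def)
    next
      case empty
      then show ?case using zero by simp
    next
      case (compl A)
      then have A: "A \<in> sets borel" by (simp add: borel_eq_rational_boxes)
      have "P (\<lambda>x. indicator (box a b) x + - 1 * indicator (A \<inter> box a b) x)"
        using ab A compl by (intro add scale box ind ind_box lpspace_scale fin_box) auto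
      also have "(\<lambda>x. indicator (box a b) x + - 1 * indicator (A \<inter> box a b) x :: complex) = (\<lambda>x. indicator ((UNIV - A) \<inter> box a b) x)"
        by (auto simp: indicator_def)
      finally show ?case .
    next
      case (union A)
      then have A: "A i \<in> sets borel" for i by (auto simp: borel_eq_rational_boxes)
      have un: "P (\<lambda>x. indicator ((\<Union>i<n. A i) \<inter> box a b) x)" for n
      proof (induction n)
        case 0
        then show ?case using zero by simp
      next
        case (Suc n)
        have "P (\<lambda>x. indicator ((\<Union>i<n. A i) \<inter> box a b) x + indicator (A n \<inter> box a b) x)"
          using Suc union A by (intro add ind_box) auto
        also have "(\<lambda>x. indicator ((\<Union>i<n. A i) \<inter> box a b) x + indicator (A n \<inter> box a b) x :: complex) = (\<lambda>x. indicator ((\<Union>i<Suc n. A i) \<inter> box a b) x)"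
        proof
          fix x
          have "A n \<inter> (\<Union>i<n. A i) = {}"
          proof -
            have "A n \<inter> A i = {}" if "i < n" for i
              using disjoint_family_onD[OF union(1), of n i] that by simp
            then show ?thesis by blast
          qed
          then show "indicator ((\<Union>i<n. A i) \<inter> box a b) x + indicator (A n \<inter> box a b) x = (indicator ((\<Union>i<Suc n. A i) \<inter> box a b) x :: complex)"
            by (auto simp: indicator_def lessThan_Suc)
        qed
        finally show ?case .
      qed
      show ?case
      proof (rule ind_lim[where A' = "\<lambda>n. (\<Union>i<n. A i) \<inter> box a b"])
        have lt: "emeasure lborel (B \<inter> box a b) < \<infinity>" if "B \<in> sets borel" for B :: "'a set"
          using emeasure_mono[of "B \<inter> box a b" "box a b" lborel] fin_box[of a b] that by (auto intro: le_less_trans)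
        show "emeasure lborel ((\<Union>i<n. A i) \<inter> box a b) < \<infinity>" for n
          using A by (intro lt) auto
        show "emeasure lborel (\<Union> (range A) \<inter> box a b) < \<infinity>"
          using A by (intro lt) auto
        show "\<forall>\<^sub>F n in sequentially. x \<in> (\<Union>i<n. A i) \<inter> box a b" if "x \<in> \<Union> (range A) \<inter> box a b" for x
        proof -
          from that obtain k where "x \<in> A k" "x \<in> box a b" by auto
          then show ?thesis
            by (intro eventually_mono[OF eventually_gt_at_top[of k]]) auto
        qed
      qed (use A un in auto)
    qed
  qed
  have step2: "P (\<lambda>x. indicator A x)" if A: "A \<in> sets borel" "emeasure lborel A < \<infinity>" for A :: "'a set"
  proof (rule ind_lim[where A' = "\<lambda>n. A \<inter> box (- (real n *\<^sub>R One)) (real n *\<^sub>R One)"])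
    show "emeasure lborel (A \<inter> box (- (real n *\<^sub>R One)) (real n *\<^sub>R One)) < \<infinity>" for n
      using emeasure_mono[of "A \<inter> box (- (real n *\<^sub>R One)) (real n *\<^sub>R One)" A lborel] A by (auto intro: le_less_trans)
    show "P (\<lambda>x. indicator (A \<inter> box (- (real n *\<^sub>R One)) (real n *\<^sub>R One)) x)" for n
      using A by (intro step1) auto
    show "\<forall>\<^sub>F n in sequentially. x \<in> A \<inter> box (- (real n *\<^sub>R One)) (real n *\<^sub>R One)" if "x \<in> A" for x
    proof -
      have "\<forall>\<^sub>F n in sequentially. norm x < real n"
        using filterlim_real_sequentially by (simp add: filterlim_at_top_dense)
      then show ?thesis
      proof eventually_elim
        case (elim n)
        have "\<bar>x \<bullet> i\<bar> < real n" if "i \<in> Basis" for i using Basis_le_norm[OF that, of x] elim by simp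
        then show ?case using \<open>x \<in> A\<close> by (auto simp: mem_box abs_less_iff) (smt (verit))+
      qed
    qed
  qed (use A in auto)
  have step3: "P F" if F: "simple_function lborel F" "F \<in> lpspace lborel p" for F :: "'a \<Rightarrow> complex"
  proof -
    have [measurable]: "F \<in> borel_measurable borel" using lpspaceD(1)[OF F(2)] by simp
    have fin: "finite (range F)" using F(1) by (simp add: simple_function_def)
    have lev: "F -` {y} \<in> sets borel" for y
      by (rule measurable_sets_borel[of F borel]) auto
    have lev_fin: "emeasure lborel (F -` {y}) < \<infinity>" if "y \<noteq> 0" for y
    proof -
      have "(\<lambda>x. indicator (F -` {y}) x :: complex) \<in> lpspace lborel p"
        by (rule lpspace_dominated(1)[OF _ lpspace_scale(1)[OF F(2), of "1 / y"]])
           (use p that in \<open>auto simp: indicator_def lev intro!: AE_I2\<close>)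
      from lpspaceD(2)[OF this] have "integrable lborel (\<lambda>x. norm (indicator (F -` {y}) x :: complex) powr p)" .
      also have "(\<lambda>x. norm (indicator (F -` {y}) x :: complex) powr p) = indicator (F -` {y})"
        using p by (auto simp: indicator_def)
      finally show ?thesis unfolding integrable_indicator_iff by simp
    qed
    have Psum: "P (\<lambda>x. \<Sum>y\<in>Y. y * indicator (F -` {y}) x) \<and> (\<lambda>x. \<Sum>y\<in>Y. y * indicator (F -` {y}) x) \<in> lpspace lborel p"
      if "finite Y" "0 \<notin> Y" for Y
      using that
    proof (induction Y rule: finite_induct)
      case empty
      then show ?case using zero lpspace_zero(1)[OF p] by simp
    next
      case (insert y Y)
      then have "y \<noteq> 0" by auto
      note i = ind[OF lev lev_fin[OF this]]
      have Pi: "P (\<lambda>x. y * indicator (F -` {y}) x)"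
        by (intro scale i step2 lev lev_fin \<open>y \<noteq> 0\<close>)
      have "P (\<lambda>x. y * indicator (F -` {y}) x + (\<Sum>z\<in>Y. z * indicator (F -` {z}) x))"
        using insert p by (intro add lpspace_scale i Pi) auto
      moreover have "(\<lambda>x. y * indicator (F -` {y}) x + (\<Sum>z\<in>Y. z * indicator (F -` {z}) x)) \<in> lpspace lborel p"
        using insert p by (intro lpspace_add(1) lpspace_scale i) auto
      ultimately show ?case by (simp only: sum.insert[OF insert(1,2)])
    qed
    have "P (\<lambda>x. \<Sum>y\<in>range F - {0}. y * indicator (F -` {y}) x)"
      by (rule Psum[THEN conjunct1]) (use fin in auto)
    also have "(\<lambda>x. \<Sum>y\<in>range F - {0}. y * indicator (F -` {y}) x) = F"
    proof
      fix x
      have "(\<Sum>y\<in>range F - {0}. y * indicator (F -` {y}) x) = (\<Sum>y\<in>range F - {0}. if y = F x then y else 0)"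
        by (intro sum.cong) (auto simp: indicator_def)
      also have "\<dots> = F x" using fin by (auto simp: sum.delta)
      finally show "(\<Sum>y\<in>range F - {0}. y * indicator (F -` {y}) x) = F x" .
    qed
    finally show ?thesis .
  qed
  have [measurable]: "f \<in> borel_measurable borel" using lpspaceD(1)[OF f] by simp
  from borel_measurable_implies_sequence_metric[of f lborel 0] obtain F where
    F: "\<And>i. simple_function lborel (F i)" "\<And>x. (\<lambda>i. F i x) \<longlonglongrightarrow> f x" "\<And>i x. norm (F i x) \<le> 2 * norm (f x)"
    by auto
  have Fm: "F i \<in> borel_measurable lborel" for i using F(1) by (rule borel_measurable_simple_function)
  have Fp: "F i \<in> lpspace lborel p" for i
    by (rule lpspace_dominated(1)[OF Fm lpspace_scale(1)[OF f, of 2]]) (use p F(3) in \<open>auto simp: norm_mult\<close>)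
  show ?thesis
  proof (rule lim[OF Fp step3[OF F(1) Fp] f])
    show "(\<lambda>i. lpint lborel p (\<lambda>x. F i x - f x)) \<longlonglongrightarrow> 0"
    proof (rule lpint_tendsto_0_dominated)
      show "integrable lborel (\<lambda>x. norm (3 * norm (f x)) powr p)"
        using lpspaceD(2)[OF f] by (simp add: powr_mult)
      show "AE x in lborel. norm (F i x - f x) \<le> 3 * norm (f x)" for i
      proof (rule AE_I2)
        fix x show "norm (F i x - f x) \<le> 3 * norm (f x)"
          using norm_triangle_ineq4[of "F i x" "f x"] F(3)[of i x] by simp
      qed
    qed (use F Fm p in auto)
  qed
qed

lemma convergent_of_approx:
  fixes c :: "nat \<Rightarrow> 'a::banach"
  assumes "\<And>\<epsilon>. 0 < \<epsilon> \<Longrightarrow> \<exists>d. convergent d \<and> (\<forall>j. norm (c j - d j) \<le> \<epsilon>)"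
  shows "convergent c"
proof (rule Cauchy_convergent, rule CauchyI)
  fix e :: real assume "0 < e"
  then obtain d where d: "convergent d" "\<And>j. norm (c j - d j) \<le> e / 4"
    using assms[of "e / 4"] by auto
  have "Cauchy d" using d(1) by (rule convergent_Cauchy)
  then obtain N where N: "\<And>m n. N \<le> m \<Longrightarrow> N \<le> n \<Longrightarrow> norm (d m - d n) < e / 4"
    using CauchyD[of d "e / 4"] \<open>0 < e\<close> by auto
  have "norm (c m - c n) < e" if "N \<le> m" "N \<le> n" for m n
  proof -
    have "c m - c n = (c m - d m) + (d m - d n) - (c n - d n)" by simp
    also have "norm \<dots> \<le> norm (c m - d m) + norm (d m - d n) + norm (c n - d n)"
      by (intro order_trans[OF norm_triangle_ineq4] add_mono norm_triangle_ineq order_refl)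
    finally show ?thesis using d(2)[of m] d(2)[of n] N[OF that] \<open>0 < e\<close> by linarith
  qed
  then show "\<exists>N. \<forall>m\<ge>N. \<forall>n\<ge>N. norm (c m - c n) < e" by blast
qed

text \<open>A diagonal argument over the countably many rational boxes; the test functions against which the integrals
  converge form a closed subspace. The conclusion is
  convergence of the pairings, in the form in which it yields pointwise convergence of convolutions.\<close>

lemma weak_sequential_compactness:
  fixes g :: "nat \<Rightarrow> 'a::euclidean_space \<Rightarrow> complex"
  assumes g: "\<And>j. g j \<in> lpspace lborel s" and bd: "\<And>j. lpint lborel s (g j) \<le> B"
    and st: "1 < s" "1 / s + 1 / t = 1"
  obtains \<sigma> where "strict_mono \<sigma>"
    "\<forall>\<phi> \<in> lpspace lborel t. convergent (\<lambda>j. \<integral>x. \<phi> x * g (\<sigma> j) x \<partial>lborel)"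
proof -
  have t: "1 < t" "1 / t + 1 / s = 1" using conj_exponent_gt_1[OF st] st by auto
  define R where "R = {x :: 'a. \<forall>i\<in>Basis. x \<bullet> i \<in> \<rat>}"
  have "countable R"
  proof (rule countable_subset)
    show "R \<subseteq> (\<lambda>f. \<Sum>i\<in>Basis. f i *\<^sub>R i) ` (Basis \<rightarrow>\<^sub>E \<rat>)"
    proof
      fix x assume "x \<in> R"
      then show "x \<in> (\<lambda>f. \<Sum>i\<in>Basis. f i *\<^sub>R i) ` (Basis \<rightarrow>\<^sub>E \<rat>)"
        by (intro image_eqI[of _ _ "\<lambda>i\<in>Basis. x \<bullet> i"]) (auto simp: R_def euclidean_representation)
    qed
    show "countable ((\<lambda>f. \<Sum>i\<in>Basis. f i *\<^sub>R (i::'a)) ` (Basis \<rightarrow>\<^sub>E \<rat>))"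
      by (intro countable_image countable_PiE) (auto intro: countable_rat)
  qed
  have ind: "(\<lambda>x. indicator (box a b) x :: complex) \<in> lpspace lborel t" for a b :: 'a
    using t emeasure_lborel_box_finite[of a b] by (intro lpspace_indicator(1)) auto
  have pair_le: "norm (\<integral>x. \<phi> x * g j x \<partial>lborel) \<le> lpint lborel t \<phi> powr (1 / t) * B powr (1 / s)"
    if "\<phi> \<in> lpspace lborel t" for \<phi> j
  proof -
    have "norm (\<integral>x. \<phi> x * g j x \<partial>lborel) \<le> lpint lborel t \<phi> powr (1 / t) * lpint lborel s (g j) powr (1 / s)"
      using that g t by (intro Holder_ineq(3))
    also have "\<dots> \<le> lpint lborel t \<phi> powr (1 / t) * B powr (1 / s)"
      using bd st by (intro mult_left_mono powr_mono2) auto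
    finally show ?thesis .
  qed
  define I where "I j ab = (\<integral>x. indicator (box (fst ab) (snd ab)) x * g j x \<partial>lborel)" for j and ab :: "'a \<times> 'a"
  define C where "C ab = lpint lborel t (\<lambda>x. indicator (box (fst ab) (snd ab)) x) powr (1 / t) * B powr (1 / s) + 1"
    for ab :: "'a \<times> 'a"
  have C: "0 < C ab" for ab by (auto simp: C_def intro!: add_nonneg_pos)
  have IC: "norm (I j ab) \<le> C ab" for j ab
    using pair_le[OF ind[of "fst ab" "snd ab"], of j] by (simp add: I_def C_def)
  obtain \<sigma> :: "nat \<Rightarrow> nat" where \<sigma>: "strict_mono \<sigma>"
    "\<And>ab. ab \<in> R \<times> R \<Longrightarrow> \<exists>l. (\<lambda>j. I (\<sigma> j) ab / of_real (C ab)) \<longlonglongrightarrow> l"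
  proof (rule function_convergent_subsequence[where S = "R \<times> R" and f = "\<lambda>j ab. I j ab / of_real (C ab)" and M = 1])
    show "countable (R \<times> R)" using \<open>countable R\<close> by auto
    show "norm (I j ab / of_real (C ab)) \<le> 1" for j ab
      using IC[of j ab] C[of ab] by (simp add: norm_divide)
  qed blast
  have "convergent (\<lambda>j. \<integral>x. \<phi> x * g (\<sigma> j) x \<partial>lborel)" if "\<phi> \<in> lpspace lborel t" for \<phi>
  proof -
    have "0 < t" using t by simp
    from that this show ?thesis
    proof (induction rule: lpspace_induct)
      case (box a b)
      then obtain l where "(\<lambda>j. I (\<sigma> j) (a, b) / of_real (C (a, b))) \<longlonglongrightarrow> l"
        using \<sigma>(2)[of "(a, b)"] by (auto simp: R_def)
      then have "(\<lambda>j. of_real (C (a, b)) * (I (\<sigma> j) (a, b) / of_real (C (a, b)))) \<longlonglongrightarrow> of_real (C (a, b)) * l"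
        by (intro tendsto_mult tendsto_const)
      then show ?case using C[of "(a, b)"] by (auto simp: convergent_def I_def)
    next
      case (add f h)
      have "(\<integral>x. (f x + h x) * g (\<sigma> j) x \<partial>lborel) = (\<integral>x. f x * g (\<sigma> j) x \<partial>lborel) + (\<integral>x. h x * g (\<sigma> j) x \<partial>lborel)" for j
        using Holder_ineq(1)[OF add(1) g t] Holder_ineq(1)[OF add(2) g t] by (simp add: distrib_right)
      then show ?case using add by (simp add: convergent_add)
    next
      case (scale f c)
      then show ?case by (simp add: mult.assoc convergent_mult convergent_const)
    next
      case (lim F f)
      show ?case
      proof (rule convergent_of_approx)
        fix \<epsilon> :: real assume "0 < \<epsilon>"
        have "(\<lambda>i. lpint lborel t (\<lambda>x. F i x - f x) powr (1 / t) * B powr (1 / s)) \<longlonglongrightarrow> 0 * B powr (1 / s)"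
          using lim(3) t by (intro tendsto_mult tendsto_const tendsto_zero_powrI[where b = "1 / t"]) auto
        then have "\<forall>\<^sub>F i in sequentially. lpint lborel t (\<lambda>x. F i x - f x) powr (1 / t) * B powr (1 / s) < \<epsilon>"
          using \<open>0 < \<epsilon>\<close> by (intro order_tendstoD(2)) auto
        then obtain i where i: "lpint lborel t (\<lambda>x. F i x - f x) powr (1 / t) * B powr (1 / s) < \<epsilon>"
          by (auto simp: eventually_sequentially)
        have "norm ((\<integral>x. f x * g (\<sigma> j) x \<partial>lborel) - (\<integral>x. F i x * g (\<sigma> j) x \<partial>lborel)) \<le> \<epsilon>" for j
        proof -
          have d: "(\<lambda>x. F i x - f x) \<in> lpspace lborel t" using lim t by (intro lpspace_diff) auto
          have "(\<integral>x. f x * g (\<sigma> j) x \<partial>lborel) - (\<integral>x. F i x * g (\<sigma> j) x \<partial>lborel) = - (\<integral>x. (F i x - f x) * g (\<sigma> j) x \<partial>lborel)"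
            using Holder_ineq(1)[OF lim(1) g t] Holder_ineq(1)[OF lim(2) g t] by (simp add: left_diff_distrib)
          then show ?thesis using pair_le[OF d, of "\<sigma> j"] i by simp
        qed
        then show "\<exists>d. convergent d \<and> (\<forall>j. norm ((\<integral>x. f x * g (\<sigma> j) x \<partial>lborel) - d j) \<le> \<epsilon>)"
          using lim(4)[of i] by blast
      qed
    qed
  qed
  with \<sigma>(1) show ?thesis by (intro that[of \<sigma>]) auto
qed

section \<open>Extracting sequences that converge almost everywhere\<close>

lemma min_one_le_powr:
  fixes t \<eta> p :: real
  assumes "0 \<le> t" "0 < \<eta>" "0 < p"
  shows "min 1 t \<le> \<eta> + t powr p / \<eta> powr p"
proof (cases "t \<le> \<eta>")
  case True
  moreover have "0 \<le> t powr p / \<eta> powr p" by simp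
  ultimately show ?thesis by linarith
next
  case False
  then have "1 \<le> (t / \<eta>) powr p" using assms by (intro ge_one_powr_ge_zero) auto
  also have "\<dots> = t powr p / \<eta> powr p" using assms by (simp add: powr_divide)
  finally have "1 \<le> t powr p / \<eta> powr p" .
  then show ?thesis using assms(2) min.cobounded1[of 1 t] by linarith
qed

text \<open>The weighted integral of \<open>min 1 |e|\<close> metrizes convergence in measure on sets of finite measure. It is small for functions
  small in \<open>L\<^sub>p\<close> as well as, along a sequence, for pointwise null sequences, and so for a sequence that is
  uniformly \<open>L\<^sub>p\<close>-close to pointwise null sequences.\<close>

lemma truncated_integral_tendsto_0:
  fixes w :: "'a \<Rightarrow> real" and e :: "nat \<Rightarrow> 'a \<Rightarrow> complex"
  assumes w: "integrable M w" "\<And>x. 0 < w x" "\<And>x. w x \<le> 1" and p: "0 < p"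
    and e: "\<And>j. e j \<in> borel_measurable M"
    and approx: "\<And>\<epsilon>. 0 < \<epsilon> \<Longrightarrow> \<exists>a. (\<forall>j. a j \<in> borel_measurable M \<and> (\<lambda>x. e j x - a j x) \<in> lpspace M p
        \<and> lpint M p (\<lambda>x. e j x - a j x) \<le> \<epsilon>) \<and> (\<forall>x. (\<lambda>j. a j x) \<longlonglongrightarrow> 0)"
  shows "(\<lambda>j. \<integral>x. w x * min 1 (norm (e j x)) \<partial>M) \<longlonglongrightarrow> 0"
proof -
  have w0: "0 \<le> w x" for x using w(2)[of x] by simp
  have [measurable]: "w \<in> borel_measurable M" "e j \<in> borel_measurable M" for j using w(1) e by auto
  have wint: "integrable M (\<lambda>x. w x * min 1 (norm (f x)))" if [measurable]: "f \<in> borel_measurable M" for f :: "'a \<Rightarrow> complex"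
    by (rule Bochner_Integration.integrable_bound[OF w(1)])
       (use w0 in \<open>simp_all add: abs_mult mult_left_le\<close>)
  have sub: "min 1 s \<le> min 1 t + min 1 u" if "s \<le> t + u" "0 \<le> t" "0 \<le> u" for s t u :: real
    using that by (auto simp: min_def)
  have main: "\<forall>\<^sub>F j in sequentially. (\<integral>x. w x * min 1 (norm (e j x)) \<partial>M) < \<gamma>" if "0 < \<gamma>" for \<gamma>
  proof -
    define W where "W = (\<integral>x. w x \<partial>M)"
    have "0 \<le> W" unfolding W_def using w0 by (intro integral_nonneg_AE) simp
    define \<eta> where "\<eta> = \<gamma> / (4 * (W + 1))"
    have \<eta>: "0 < \<eta>" using \<open>0 \<le> W\<close> that by (simp add: \<eta>_def)
    have \<eta>W: "\<eta> * W \<le> \<gamma> / 4"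
    proof -
      have "\<eta> * W \<le> \<eta> * (W + 1)" using \<eta> by (intro mult_left_mono) auto
      also have "\<dots> = \<gamma> / 4" unfolding \<eta>_def using \<open>0 \<le> W\<close> by (simp add: field_simps)
      finally show ?thesis .
    qed
    have "0 < \<gamma> / 4 * \<eta> powr p" using that \<eta> by simp
    from approx[OF this] obtain a where a: "\<And>j. a j \<in> borel_measurable M"
      "\<And>j. (\<lambda>x. e j x - a j x) \<in> lpspace M p" "\<And>j. lpint M p (\<lambda>x. e j x - a j x) \<le> \<gamma> / 4 * \<eta> powr p"
      "\<And>x. (\<lambda>j. a j x) \<longlonglongrightarrow> 0" by blast
    note [measurable] = a(1)
    have "(\<lambda>j. \<integral>x. w x * min 1 (norm (a j x)) \<partial>M) \<longlonglongrightarrow> (\<integral>x. 0 \<partial>M)"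
    proof (rule integral_dominated_convergence[where w = w])
      show "AE x in M. (\<lambda>j. w x * min 1 (norm (a j x))) \<longlonglongrightarrow> 0"
      proof (rule AE_I2)
        fix x
        have "(\<lambda>j. w x * min 1 (norm (a j x))) \<longlonglongrightarrow> w x * min 1 (norm (0::complex))"
          by (intro tendsto_mult tendsto_min tendsto_const tendsto_norm a(4))
        then show "(\<lambda>j. w x * min 1 (norm (a j x))) \<longlonglongrightarrow> 0" by simp
      qed
      show "AE x in M. norm (w x * min 1 (norm (a j x))) \<le> w x" for j
        using w0 by (simp add: abs_mult mult_left_le)
    qed (use w in auto)
    then have "\<forall>\<^sub>F j in sequentially. (\<integral>x. w x * min 1 (norm (a j x)) \<partial>M) < \<gamma> / 4"
      using that by (intro order_tendstoD(2)) auto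
    then show ?thesis
    proof eventually_elim
      case (elim j)
      note d = lpspaceD(2)[OF a(2)[of j]]
      have pt: "w x * min 1 (norm (e j x)) \<le> w x * min 1 (norm (a j x)) + (\<eta> * w x + norm (e j x - a j x) powr p / \<eta> powr p)" for x
      proof -
        have "norm (e j x) \<le> norm (a j x) + norm (e j x - a j x)"
          using norm_triangle_ineq[of "a j x" "e j x - a j x"] by simp
        then have "min 1 (norm (e j x)) \<le> min 1 (norm (a j x)) + min 1 (norm (e j x - a j x))"
          by (intro sub) auto
        then have "w x * min 1 (norm (e j x)) \<le> w x * (min 1 (norm (a j x)) + min 1 (norm (e j x - a j x)))"
          using w(2)[of x] by (intro mult_left_mono) auto
        also have "w x * min 1 (norm (e j x - a j x)) \<le> w x * (\<eta> + norm (e j x - a j x) powr p / \<eta> powr p)"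
          using w(2)[of x] \<eta> p by (intro mult_left_mono min_one_le_powr) auto
        then have "w x * (min 1 (norm (a j x)) + min 1 (norm (e j x - a j x)))
          \<le> w x * min 1 (norm (a j x)) + (\<eta> * w x + w x * (norm (e j x - a j x) powr p / \<eta> powr p))"
          by (simp add: algebra_simps)
        also have "w x * (norm (e j x - a j x) powr p / \<eta> powr p) \<le> 1 * (norm (e j x - a j x) powr p / \<eta> powr p)"
          using w(3)[of x] by (intro mult_right_mono) auto
        finally show ?thesis by simp
      qed
      have "(\<integral>x. w x * min 1 (norm (e j x)) \<partial>M)
        \<le> (\<integral>x. w x * min 1 (norm (a j x)) + (\<eta> * w x + norm (e j x - a j x) powr p / \<eta> powr p) \<partial>M)"
        using w(1) d by (intro integral_mono pt Bochner_Integration.integrable_add wint integrable_mult_right) auto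
      also have "\<dots> = (\<integral>x. w x * min 1 (norm (a j x)) \<partial>M) + (\<eta> * W + lpint M p (\<lambda>x. e j x - a j x) / \<eta> powr p)"
        using w(1) d wint[OF a(1)] by (simp add: W_def lpint_def)
      also have "lpint M p (\<lambda>x. e j x - a j x) / \<eta> powr p \<le> \<gamma> / 4"
        using a(3)[of j] \<eta> by (simp add: divide_le_eq)
      finally show ?case using elim \<eta>W that by linarith
    qed
  qed
  show ?thesis
  proof (rule tendstoI)
    fix \<gamma> :: real assume "0 < \<gamma>"
    from main[OF this] show "\<forall>\<^sub>F j in sequentially. dist (\<integral>x. w x * min 1 (norm (e j x)) \<partial>M) 0 < \<gamma>"
    proof eventually_elim
      case (elim j)
      have "0 \<le> (\<integral>x. w x * min 1 (norm (e j x)) \<partial>M)"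
        using w0 by (intro integral_nonneg_AE) simp
      then show ?case using elim by simp
    qed
  qed
qed

lemma (in sigma_finite_measure) Ex_integrable_weight:
  "\<exists>w :: 'a \<Rightarrow> real. integrable M w \<and> (\<forall>x. 0 < w x) \<and> (\<forall>x. w x \<le> 1)"
proof -
  from Ex_finite_integrable_function obtain h where
    h: "h \<in> borel_measurable M" "integral\<^sup>N M h \<noteq> \<infinity>" "\<And>x. x \<in> space M \<Longrightarrow> 0 < h x \<and> h x < \<infinity>" by blast
  note [measurable] = h(1)
  define w where "w x = (if x \<in> space M then min 1 (enn2real (h x)) else 1)" for x
  have "integrable M w"
  proof (rule integrableI_bounded)
    have "w \<in> borel_measurable M \<longleftrightarrow> (\<lambda>x. min 1 (enn2real (h x))) \<in> borel_measurable M"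
      by (intro measurable_cong) (simp add: w_def)
    then show "w \<in> borel_measurable M" by simp
    have "(\<integral>\<^sup>+x. norm (w x) \<partial>M) \<le> (\<integral>\<^sup>+x. h x \<partial>M)"
    proof (rule nn_integral_mono)
      fix x assume x: "x \<in> space M"
      have "ennreal (norm (w x)) \<le> ennreal (enn2real (h x))"
        using x by (intro ennreal_leI) (auto simp: w_def)
      also have "\<dots> = h x" using h(3)[OF x] by (simp add: ennreal_enn2real_if less_top)
      finally show "ennreal (norm (w x)) \<le> h x" .
    qed
    then show "(\<integral>\<^sup>+x. norm (w x) \<partial>M) < \<infinity>" using h(2) by (simp add: less_top order_le_less_trans)
  qed
  moreover have "0 < w x" "w x \<le> 1" for x
    using h(3)[of x] by (auto simp: w_def enn2real_positive_iff)
  ultimately show ?thesis by blast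
qed

lemma (in sigma_finite_measure) AE_zero_subseq:
  fixes e :: "nat \<Rightarrow> 'a \<Rightarrow> complex"
  assumes p: "0 < p" and e: "\<And>j. e j \<in> borel_measurable M"
    and approx: "\<And>\<epsilon>. 0 < \<epsilon> \<Longrightarrow> \<exists>a. (\<forall>j. a j \<in> borel_measurable M \<and> (\<lambda>x. e j x - a j x) \<in> lpspace M p
        \<and> lpint M p (\<lambda>x. e j x - a j x) \<le> \<epsilon>) \<and> (\<forall>x. (\<lambda>j. a j x) \<longlonglongrightarrow> 0)"
  obtains \<sigma> where "strict_mono \<sigma>" "AE x in M. (\<lambda>j. e (\<sigma> j) x) \<longlonglongrightarrow> 0"
proof -
  obtain w :: "'a \<Rightarrow> real" where w: "integrable M w" "\<And>x. 0 < w x" "\<And>x. w x \<le> 1" using Ex_integrable_weight by blast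
  have w0: "0 \<le> w x" for x using w(2)[of x] by simp
  have [measurable]: "w \<in> borel_measurable M" "e j \<in> borel_measurable M" for j using w(1) e by auto
  have wint: "integrable M (\<lambda>x. w x * min 1 (norm (e j x)))" for j
    by (rule Bochner_Integration.integrable_bound[OF w(1)])
       (use w0 in \<open>simp_all add: abs_mult mult_left_le\<close>)
  have "(\<lambda>j. \<integral>x. norm (w x * min 1 (norm (e j x))) \<partial>M) \<longlonglongrightarrow> 0"
    using truncated_integral_tendsto_0[OF w p e approx] w0 by (simp add: abs_mult)
  from tendsto_L1_AE_subseq[OF wint this] obtain \<sigma> where \<sigma>: "strict_mono \<sigma>"
    "AE x in M. (\<lambda>j. w x * min 1 (norm (e (\<sigma> j) x))) \<longlonglongrightarrow> 0" by blast
  have "AE x in M. (\<lambda>j. e (\<sigma> j) x) \<longlonglongrightarrow> 0"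
    using \<sigma>(2)
  proof eventually_elim
    case (elim x)
    have "(\<lambda>j. (w x * min 1 (norm (e (\<sigma> j) x))) / w x) \<longlonglongrightarrow> 0 / w x"
      using w(2)[of x] by (intro tendsto_divide elim) auto
    then have m: "(\<lambda>j. min 1 (norm (e (\<sigma> j) x))) \<longlonglongrightarrow> 0" using w(2)[of x] by simp
    then have "\<forall>\<^sub>F j in sequentially. min 1 (norm (e (\<sigma> j) x)) < 1" by (intro order_tendstoD(2)) auto
    then have "\<forall>\<^sub>F j in sequentially. min 1 (norm (e (\<sigma> j) x)) = norm (e (\<sigma> j) x)"
      by eventually_elim auto
    with m have "(\<lambda>j. norm (e (\<sigma> j) x)) \<longlonglongrightarrow> 0" by (rule Lim_transform_eventually)
    then show ?case by (rule tendsto_norm_zero_cancel)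
  qed
  with \<sigma>(1) show ?thesis by (rule that)
qed

text \<open>No limit is known in advance, so the sequence is shown to be Cauchy for the metric of the previous lemmas
  and a subsequence with summable increments is taken.\<close>

lemma (in sigma_finite_measure) AE_convergent_subseq:
  fixes u :: "nat \<Rightarrow> 'a \<Rightarrow> complex"
  assumes p: "0 < p" and u: "\<And>j. u j \<in> borel_measurable M"
    and approx: "\<And>\<epsilon>. 0 < \<epsilon> \<Longrightarrow> \<exists>a. (\<forall>j. a j \<in> borel_measurable M \<and> (\<lambda>x. u j x - a j x) \<in> lpspace M p
        \<and> lpint M p (\<lambda>x. u j x - a j x) \<le> \<epsilon>) \<and> (\<forall>x. convergent (\<lambda>j. a j x))"
  obtains \<sigma> v where "strict_mono \<sigma>" "v \<in> borel_measurable M" "AE x in M. (\<lambda>j. u (\<sigma> j) x) \<longlonglongrightarrow> v x"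
proof -
  obtain w :: "'a \<Rightarrow> real" where w: "integrable M w" "\<And>x. 0 < w x" "\<And>x. w x \<le> 1" using Ex_integrable_weight by blast
  have w0: "0 \<le> w x" for x using w(2)[of x] by simp
  have [measurable]: "w \<in> borel_measurable M" "u j \<in> borel_measurable M" for j using w(1) u by auto
  define D where "D j l = (\<integral>x. w x * min 1 (norm (u j x - u l x)) \<partial>M)" for j l
  have wint: "integrable M (\<lambda>x. w x * min 1 (norm (u j x - u l x)))" for j l
    by (rule Bochner_Integration.integrable_bound[OF w(1)])
       (use w0 in \<open>simp_all add: abs_mult mult_left_le\<close>)
  have Cauchy: "\<exists>N. \<forall>j\<ge>N. \<forall>l\<ge>N. D j l < \<eta>" if "0 < \<eta>" for \<eta>
  proof (rule ccontr)
    assume "\<not> (\<exists>N. \<forall>j\<ge>N. \<forall>l\<ge>N. D j l < \<eta>)"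
    then have "\<forall>N. \<exists>j l. N \<le> j \<and> N \<le> l \<and> \<eta> \<le> D j l" by (auto simp: not_less)
    then obtain J L where JL: "\<And>N. N \<le> J N" "\<And>N. N \<le> L N" "\<And>N. \<eta> \<le> D (J N) (L N)" by metis
    have J: "filterlim J at_top sequentially" "filterlim L at_top sequentially"
      by (rule filterlim_at_top_mono[OF filterlim_ident]; use JL in \<open>simp add: always_eventually\<close>)+
    have "(\<lambda>N. \<integral>x. w x * min 1 (norm (u (J N) x - u (L N) x)) \<partial>M) \<longlonglongrightarrow> 0"
    proof (rule truncated_integral_tendsto_0[OF w p])
      fix \<epsilon> :: real assume "0 < \<epsilon>"
      then have "0 < \<epsilon> / (2 powr p * 2)" by simp
      from approx[OF this] obtain a where a: "\<And>j. a j \<in> borel_measurable M"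
        "\<And>j. (\<lambda>x. u j x - a j x) \<in> lpspace M p" "\<And>j. lpint M p (\<lambda>x. u j x - a j x) \<le> \<epsilon> / (2 powr p * 2)"
        "\<And>x. convergent (\<lambda>j. a j x)" by blast
      show "\<exists>a. (\<forall>j. a j \<in> borel_measurable M \<and> (\<lambda>x. u (J j) x - u (L j) x - a j x) \<in> lpspace M p
        \<and> lpint M p (\<lambda>x. u (J j) x - u (L j) x - a j x) \<le> \<epsilon>) \<and> (\<forall>x. (\<lambda>j. a j x) \<longlonglongrightarrow> 0)"
      proof (intro exI[of _ "\<lambda>j x. a (J j) x - a (L j) x"] conjI allI)
        fix j
        show "(\<lambda>x. a (J j) x - a (L j) x) \<in> borel_measurable M" using a(1) by simp
        have eq: "(\<lambda>x. u (J j) x - u (L j) x - (a (J j) x - a (L j) x))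
          = (\<lambda>x. (u (J j) x - a (J j) x) - (u (L j) x - a (L j) x))" by auto
        show "(\<lambda>x. u (J j) x - u (L j) x - (a (J j) x - a (L j) x)) \<in> lpspace M p"
          unfolding eq using p by (intro lpspace_diff a(2)) auto
        have "lpint M p (\<lambda>x. (u (J j) x - a (J j) x) - (u (L j) x - a (L j) x))
          \<le> 2 powr p * (lpint M p (\<lambda>x. u (J j) x - a (J j) x) + lpint M p (\<lambda>x. u (L j) x - a (L j) x))"
          using p by (intro lpspace_diff(2) a(2)) auto
        also have "\<dots> \<le> 2 powr p * (\<epsilon> / (2 powr p * 2) + \<epsilon> / (2 powr p * 2))"
          by (intro mult_left_mono add_mono a(3)) auto
        also have "\<dots> = \<epsilon>" by simp
        finally show "lpint M p (\<lambda>x. u (J j) x - u (L j) x - (a (J j) x - a (L j) x)) \<le> \<epsilon>" unfolding eq .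
      next
        fix x
        obtain l where l: "(\<lambda>j. a j x) \<longlonglongrightarrow> l" using a(4)[of x] by (auto simp: convergent_def)
        have "(\<lambda>j. a (J j) x - a (L j) x) \<longlonglongrightarrow> l - l"
          by (intro tendsto_diff filterlim_compose[OF l] J)
        then show "(\<lambda>j. a (J j) x - a (L j) x) \<longlonglongrightarrow> 0" by simp
      qed
    qed auto
    then have "\<forall>\<^sub>F N in sequentially. D (J N) (L N) < \<eta>"
      unfolding D_def using that by (intro order_tendstoD(2)) auto
    then obtain N where "D (J N) (L N) < \<eta>" by (auto simp: eventually_sequentially)
    then show False using JL(3)[of N] by simp
  qed
  have "\<forall>m::nat. \<exists>N. \<forall>j\<ge>N. \<forall>l\<ge>N. D j l < (1 / 2) ^ m"
    using Cauchy by simp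
  then obtain N where N: "\<And>m j l. N m \<le> j \<Longrightarrow> N m \<le> l \<Longrightarrow> D j l < (1 / 2) ^ m" by metis
  define \<sigma> where "\<sigma> m = m + (\<Sum>i\<le>m. N i)" for m :: nat
  have \<sigma>: "strict_mono \<sigma>" by (auto simp: strict_mono_Suc_iff \<sigma>_def)
  have N\<sigma>: "N m \<le> \<sigma> m" for m
    using member_le_sum[of m "{..m}" N] by (simp add: \<sigma>_def trans_le_add2)
  have D\<sigma>: "D (\<sigma> (Suc m)) (\<sigma> m) < (1 / 2) ^ m" for m
    using N[of m "\<sigma> (Suc m)" "\<sigma> m"] N\<sigma>[of m] strict_monoD[OF \<sigma>, of m "Suc m"] by simp
  define T where "T m x = w x * min 1 (norm (u (\<sigma> (Suc m)) x - u (\<sigma> m) x))" for m x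
  have [measurable]: "T m \<in> borel_measurable M" for m unfolding T_def[abs_def] by measurable
  have T0: "0 \<le> T m x" for m x using w0[of x] by (simp add: T_def)
  have "(\<integral>\<^sup>+x. (\<Sum>m. ennreal (T m x)) \<partial>M) = (\<Sum>m. \<integral>\<^sup>+x. ennreal (T m x) \<partial>M)"
    by (rule nn_integral_suminf) simp
  also have "\<dots> = (\<Sum>m. ennreal (D (\<sigma> (Suc m)) (\<sigma> m)))"
    using wint T0 unfolding T_def D_def by (subst nn_integral_eq_integral) auto
  also have "\<dots> \<le> (\<Sum>m. ennreal ((1 / 2) ^ m))"
    by (intro suminf_le ennreal_leI less_imp_le[OF D\<sigma>]) auto
  also have "\<dots> = ennreal (\<Sum>m. (1 / 2) ^ m)"
    by (rule suminf_ennreal2) (simp, rule summable_geometric, simp)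
  also have "\<dots> < \<infinity>" by (simp only: infinity_ennreal_def ennreal_less_top)
  finally have "(\<integral>\<^sup>+x. (\<Sum>m. ennreal (T m x)) \<partial>M) \<noteq> \<infinity>"
    by (simp only: less_top infinity_ennreal_def)
  then have "AE x in M. (\<Sum>m. ennreal (T m x)) \<noteq> \<infinity>"
    by (intro nn_integral_PInf_AE) auto
  then have conv: "AE x in M. convergent (\<lambda>j. u (\<sigma> j) x)"
  proof eventually_elim
    case (elim x)
    then have "summable (\<lambda>m. T m x)" using T0 by (intro summable_suminf_not_top) auto
    then have "summable (\<lambda>m. T m x / w x)" by (rule summable_divide)
    then have s: "summable (\<lambda>m. min 1 (norm (u (\<sigma> (Suc m)) x - u (\<sigma> m) x)))"
      using w(2)[of x] by (simp add: T_def)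
    then have "\<forall>\<^sub>F m in sequentially. min 1 (norm (u (\<sigma> (Suc m)) x - u (\<sigma> m) x)) < 1"
      by (intro order_tendstoD(2)[OF summable_LIMSEQ_zero]) auto
    then have "\<forall>\<^sub>F m in sequentially. norm (u (\<sigma> (Suc m)) x - u (\<sigma> m) x) = min 1 (norm (u (\<sigma> (Suc m)) x - u (\<sigma> m) x))"
      by eventually_elim auto
    from summable_cong[OF this] s have "summable (\<lambda>m. norm (u (\<sigma> (Suc m)) x - u (\<sigma> m) x))"
      by blast
    then have "summable (\<lambda>m. u (\<sigma> (Suc m)) x - u (\<sigma> m) x)" by (rule summable_norm_cancel)
    then have "convergent (\<lambda>n. \<Sum>m<n. u (\<sigma> (Suc m)) x - u (\<sigma> m) x)" by (simp add: summable_iff_convergent)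
    then have "convergent (\<lambda>n. u (\<sigma> n) x - u (\<sigma> 0) x)"
      by (simp only: sum_lessThan_telescope[of "\<lambda>m. u (\<sigma> m) x"])
    then have "convergent (\<lambda>n. (u (\<sigma> n) x - u (\<sigma> 0) x) + u (\<sigma> 0) x)"
      by (intro convergent_add convergent_const)
    then show ?case by simp
  qed
  show ?thesis
  proof (rule that[OF \<sigma>])
    show "(\<lambda>x. lim (\<lambda>j. u (\<sigma> j) x)) \<in> borel_measurable M" by measurable
    show "AE x in M. (\<lambda>j. u (\<sigma> j) x) \<longlonglongrightarrow> lim (\<lambda>j. u (\<sigma> j) x)"
      using conv by (simp add: convergent_LIMSEQ_iff)
  qed
qed

section \<open>The weak Young inequality\<close>

text \<open>The bound of a kernel in weak \<open>L\<^sub>q\<close> by means of its distribution function; \<open>A\<close> plays the part of the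
  \<open>q\<close>-th power of the norm.\<close>

definition weak_bound :: "real \<Rightarrow> real \<Rightarrow> ('a::euclidean_space \<Rightarrow> complex) \<Rightarrow> bool" where
  "weak_bound q A k \<longleftrightarrow> (\<forall>l>0. emeasure lborel {x. l < norm (k x)} \<le> ennreal (A * l powr (- q)))"

lemma distr_lborel_reflect: "distr lborel borel (\<lambda>y. x - y) = (lborel :: 'a::euclidean_space measure)"
proof -
  have T: "x + (\<Sum>j\<in>Basis. (- 1 * (y \<bullet> j)) *\<^sub>R j) = x - y" for y :: 'a
    by (simp add: sum_negf euclidean_representation)
  have "lborel = density (distr lborel borel (\<lambda>y :: 'a. x - y)) (\<lambda>_. (\<Prod>j\<in>Basis. \<bar>- 1 :: real\<bar>))"
    using lborel_affine_euclidean[where c = "\<lambda>_. - 1" and t = x] unfolding T by simp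
  then show ?thesis by (simp add: density_1)
qed

lemma nn_integral_reflect:
  fixes F :: "'a::euclidean_space \<Rightarrow> ennreal"
  assumes [measurable]: "F \<in> borel_measurable borel"
  shows "(\<integral>\<^sup>+y. F (x - y) \<partial>lborel) = (\<integral>\<^sup>+y. F y \<partial>lborel)"
  by (subst (2) distr_lborel_reflect[of x, symmetric]) (simp add: nn_integral_distr)

lemma integral_reflect:
  fixes F :: "'a::euclidean_space \<Rightarrow> complex"
  assumes [measurable]: "F \<in> borel_measurable borel"
  shows "(\<integral>y. F (x - y) \<partial>lborel) = (\<integral>y. F y \<partial>lborel)"
  by (subst (2) distr_lborel_reflect[of x, symmetric]) (simp add: integral_distr)

lemma integrable_reflect:
  fixes F :: "'a::euclidean_space \<Rightarrow> 'b::{banach, second_countable_topology}"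
  assumes [measurable]: "F \<in> borel_measurable borel"
  shows "integrable lborel (\<lambda>y. F (x - y)) \<longleftrightarrow> integrable lborel F"
  by (subst (2) distr_lborel_reflect[of x, symmetric]) (simp add: integrable_distr_eq)

lemma weak_bound_reflect:
  assumes [measurable]: "k \<in> borel_measurable borel" and "weak_bound q A k"
  shows "weak_bound q A (\<lambda>y. k (x - y))"
proof -
  have "emeasure lborel {y. l < norm (k (x - y))} = emeasure lborel {y. l < norm (k y)}" for l
    by (subst (2) distr_lborel_reflect[of x, symmetric]) (simp add: emeasure_distr vimage_def)
  then show ?thesis using assms(2) by (simp add: weak_bound_def)
qed

text \<open>The excess over a level \<open>c\<close> is the integral of the distribution function over \<open>{c..}\<close>.\<close>

lemma nn_integral_excess_le:
  fixes k :: "'a::euclidean_space \<Rightarrow> complex"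
  assumes [measurable]: "k \<in> borel_measurable borel" and k: "weak_bound q A k"
    and q: "1 < q" and A: "0 < A" and c: "0 < c"
  shows "(\<integral>\<^sup>+y. ennreal (norm (k y) - c) \<partial>lborel) \<le> ennreal (A * c powr (1 - q) / (q - 1))"
proof -
  have pt: "ennreal (norm (k y) - c) = (\<integral>\<^sup>+t. indicator {c<..<norm (k y)} t \<partial>lborel)" for y
    by (cases "c \<le> norm (k y)") (auto simp: ennreal_neg)
  have "(\<integral>\<^sup>+y. ennreal (norm (k y) - c) \<partial>lborel) = (\<integral>\<^sup>+y. (\<integral>\<^sup>+t. indicator {c<..<norm (k y)} t \<partial>lborel) \<partial>lborel)"
    by (intro nn_integral_cong pt)
  also have "\<dots> = (\<integral>\<^sup>+t. (\<integral>\<^sup>+y. indicator {c<..<norm (k y)} t \<partial>lborel) \<partial>lborel)"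
    by (rule lborel_pair.Fubini') (simp add: indicator_def, measurable)
  also have "\<dots> \<le> (\<integral>\<^sup>+t. ennreal (A * t powr (- q)) * indicator {c..} t \<partial>lborel)"
  proof (rule nn_integral_mono)
    fix t :: real
    show "(\<integral>\<^sup>+y. indicator {c<..<norm (k y)} t \<partial>lborel) \<le> ennreal (A * t powr (- q)) * indicator {c..} t"
    proof (cases "c < t")
      case True
      have "(\<integral>\<^sup>+y. indicator {c<..<norm (k y)} t \<partial>lborel) = (\<integral>\<^sup>+y. indicator {y. t < norm (k y)} y \<partial>lborel)"
        using True by (intro nn_integral_cong) (auto simp: indicator_def)
      also have "\<dots> = emeasure lborel {y. t < norm (k y)}" by simp
      also have "\<dots> \<le> ennreal (A * t powr (- q))" using k True c by (simp add: weak_bound_def)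
      finally show ?thesis using True by simp
    qed (auto simp: indicator_def)
  qed
  also have "\<dots> = ennreal (0 - - (A * c powr (1 - q) / (q - 1)))"
  proof (rule nn_integral_FTC_atLeast)
    show "((\<lambda>t. - (A * t powr (1 - q) / (q - 1))) has_real_derivative A * x powr (- q)) (at x)" if "c \<le> x" for x
    proof -
      have "((\<lambda>t. t powr (1 - q)) has_real_derivative (1 - q) * x powr (1 - q - 1)) (at x)"
        using that c by (intro has_real_derivative_powr) auto
      from DERIV_cmult[OF this, of "- A / (q - 1)"]
      have "((\<lambda>t. - (A * t powr (1 - q) / (q - 1))) has_real_derivative - A / (q - 1) * ((1 - q) * x powr (- q))) (at x)"
        by simp
      moreover have "- A / (q - 1) * ((1 - q) * x powr (- q)) = A * x powr (- q)"
        using q by (simp add: divide_simps) (simp add: algebra_simps)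
      ultimately show ?thesis by simp
    qed
    have "((\<lambda>t::real. t powr (1 - q)) \<longlongrightarrow> 0) at_top"
      using q by (intro tendsto_neg_powr filterlim_ident) auto
    then have "((\<lambda>t. - (A * t powr (1 - q) / (q - 1))) \<longlongrightarrow> - (A * 0 / (q - 1))) at_top"
      using q by (intro tendsto_intros) auto
    then show "((\<lambda>t. - (A * t powr (1 - q) / (q - 1))) \<longlongrightarrow> 0) at_top" by simp
  qed (use A in auto)
  finally show ?thesis by simp
qed

text \<open>The kernel is at most \<open>c\<close> plus its excess over \<open>c\<close>; the level chosen balances the two contributions.\<close>

lemma nn_integral_weak_le:
  fixes k :: "'a::euclidean_space \<Rightarrow> complex"
  assumes [measurable]: "k \<in> borel_measurable borel" "E \<in> sets borel" and k: "weak_bound q A k"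
    and q: "1 < q" and A: "0 < A" and m: "emeasure lborel E \<le> ennreal m" "0 < m"
  shows "(\<integral>\<^sup>+y. ennreal (norm (k y)) * indicator E y \<partial>lborel) \<le> ennreal (q / (q - 1) * A powr (1 / q) * m powr (1 - 1 / q))"
proof -
  \<comment> \<open>The level at which the distribution function bound \<open>A c powr (- q)\<close> equals \<open>m\<close>.\<close>
  define c where "c = (A / m) powr (1 / q)"
  have c: "0 < c" using A m by (simp add: c_def)
  have "(\<integral>\<^sup>+y. ennreal (norm (k y)) * indicator E y \<partial>lborel) \<le> (\<integral>\<^sup>+y. ennreal c * indicator E y + ennreal (norm (k y) - c) \<partial>lborel)"
  proof (rule nn_integral_mono)
    fix y
    have "ennreal (norm (k y)) \<le> ennreal c + ennreal (norm (k y) - c)"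
      using c by (cases "c \<le> norm (k y)") (auto simp: ennreal_neg ennreal_leI simp flip: ennreal_plus)
    then show "ennreal (norm (k y)) * indicator E y \<le> ennreal c * indicator E y + ennreal (norm (k y) - c)"
      by (auto simp: indicator_def)
  qed
  also have "\<dots> = ennreal c * emeasure lborel E + (\<integral>\<^sup>+y. ennreal (norm (k y) - c) \<partial>lborel)"
    by (subst nn_integral_add) (auto simp: nn_integral_cmult_indicator)
  also have "\<dots> \<le> ennreal c * ennreal m + ennreal (A * c powr (1 - q) / (q - 1))"
    using assms c by (intro add_mono mult_left_mono nn_integral_excess_le) auto
  also have "\<dots> = ennreal (c * m + A * c powr (1 - q) / (q - 1))"
    using c m A q by (simp add: ennreal_mult'[symmetric] ennreal_plus[symmetric] del: ennreal_plus)
  also have "c * m + A * c powr (1 - q) / (q - 1) = q / (q - 1) * A powr (1 / q) * m powr (1 - 1 / q)"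
  proof -
    have 1: "c * m = A powr (1 / q) * m powr (1 - 1 / q)"
      using A m by (simp add: c_def powr_divide powr_diff)
    have "c powr (1 - q) = (A / m) powr (1 / q - 1)"
      using q by (simp add: c_def powr_powr field_simps)
    also have "\<dots> = A powr (1 / q) / A * m powr (1 - 1 / q)"
      using A m by (simp add: powr_divide powr_diff)
    finally have 2: "A * c powr (1 - q) = A powr (1 / q) * m powr (1 - 1 / q)" using A by simp
    show ?thesis unfolding 1 2 using q by (simp add: field_simps)
  qed
  finally show ?thesis .
qed

text \<open>Layer cake in \<open>h\<close>: its superlevel sets \<open>{b < h}\<close> have measure at most \<open>b powr (- s)\<close> by Chebyshev, and only
  \<open>b < T\<close> contribute. The exponent condition makes the resulting power of \<open>b\<close> integrable at 0.\<close>

lemma nn_integral_weak_truncated_le: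
  fixes k :: "'a::euclidean_space \<Rightarrow> complex" and h :: "'a \<Rightarrow> real"
  assumes [measurable]: "k \<in> borel_measurable borel" "h \<in> borel_measurable borel"
    and k: "weak_bound q A k" and q: "1 < q" and A: "0 < A"
    and h0: "\<And>y. 0 \<le> h y" and hs: "(\<integral>\<^sup>+y. ennreal (h y powr s) \<partial>lborel) \<le> 1" and s: "0 < s"
    and sq: "s * (1 - 1 / q) < 1" and T: "0 \<le> T"
  shows "(\<integral>\<^sup>+y. ennreal (norm (k y) * h y) * indicator {y. h y \<le> T} y \<partial>lborel)
    \<le> ennreal (q / (q - 1) * A powr (1 / q) / (1 - s * (1 - 1 / q)) * T powr (1 - s * (1 - 1 / q)))"
proof -
  define K where "K = q / (q - 1) * A powr (1 / q)"
  have K: "0 \<le> K" using q A by (simp add: K_def)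
  have cheb: "emeasure lborel {y. b < h y} \<le> ennreal (b powr (- s))" if "0 < b" for b
  proof -
    have "ennreal (b powr s) * emeasure lborel {y. b < h y} = (\<integral>\<^sup>+y. ennreal (b powr s) * indicator {y. b < h y} y \<partial>lborel)"
      by (simp add: nn_integral_cmult_indicator)
    also have "\<dots> \<le> (\<integral>\<^sup>+y. ennreal (h y powr s) \<partial>lborel)"
      using s that by (intro nn_integral_mono) (auto simp: indicator_def intro!: ennreal_leI powr_mono2)
    also have "\<dots> \<le> 1" by fact
    finally have *: "ennreal (b powr s) * emeasure lborel {y. b < h y} \<le> 1" .
    have "emeasure lborel {y. b < h y} = ennreal (b powr - s) * (ennreal (b powr s) * emeasure lborel {y. b < h y})"
      using that by (simp add: mult.assoc[symmetric] ennreal_mult'[symmetric] powr_add[symmetric])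
    also have "\<dots> \<le> ennreal (b powr - s) * 1" by (intro mult_left_mono *) simp
    finally show ?thesis by simp
  qed
  have "(\<integral>\<^sup>+y. ennreal (norm (k y) * h y) * indicator {y. h y \<le> T} y \<partial>lborel)
    \<le> (\<integral>\<^sup>+y. (\<integral>\<^sup>+b. ennreal (norm (k y)) * (indicator {0<..<T} b * indicator {0<..<h y} b) \<partial>lborel) \<partial>lborel)"
  proof (rule nn_integral_mono)
    fix y
    show "ennreal (norm (k y) * h y) * indicator {y. h y \<le> T} y
      \<le> (\<integral>\<^sup>+b. ennreal (norm (k y)) * (indicator {0<..<T} b * indicator {0<..<h y} b) \<partial>lborel)"
    proof (cases "h y \<le> T")
      case True
      have "ennreal (norm (k y) * h y) = ennreal (norm (k y)) * (\<integral>\<^sup>+b. indicator {0<..<h y} b \<partial>lborel)"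
        using h0[of y] by (simp add: ennreal_mult)
      also have "(\<integral>\<^sup>+b. indicator {0<..<h y} b \<partial>lborel) = (\<integral>\<^sup>+b. indicator {0<..<T} b * indicator {0<..<h y} b \<partial>lborel)"
        using True by (intro nn_integral_cong) (auto simp: indicator_def)
      also have "ennreal (norm (k y)) * \<dots> = (\<integral>\<^sup>+b. ennreal (norm (k y)) * (indicator {0<..<T} b * indicator {0<..<h y} b) \<partial>lborel)"
        by (rule nn_integral_cmult[symmetric]) simp
      finally show ?thesis using True by simp
    qed simp
  qed
  also have "\<dots> = (\<integral>\<^sup>+b. (\<integral>\<^sup>+y. ennreal (norm (k y)) * (indicator {0<..<T} b * indicator {0<..<h y} b) \<partial>lborel) \<partial>lborel)"
    by (rule lborel_pair.Fubini') (simp add: indicator_def, measurable)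
  also have "\<dots> \<le> (\<integral>\<^sup>+b. ennreal (indicator {0..T} b * (K * b powr (- (s * (1 - 1 / q))))) \<partial>lborel)"
  proof (rule nn_integral_mono)
    fix b :: real
    show "(\<integral>\<^sup>+y. ennreal (norm (k y)) * (indicator {0<..<T} b * indicator {0<..<h y} b) \<partial>lborel)
      \<le> ennreal (indicator {0..T} b * (K * b powr (- (s * (1 - 1 / q)))))"
    proof (cases "0 < b \<and> b < T")
      case True
      have "(\<integral>\<^sup>+y. ennreal (norm (k y)) * (indicator {0<..<T} b * indicator {0<..<h y} b) \<partial>lborel)
        = (\<integral>\<^sup>+y. ennreal (norm (k y)) * indicator {y. b < h y} y \<partial>lborel)"
        using True by (intro nn_integral_cong) (auto simp: indicator_def)
      also have "\<dots> \<le> ennreal (q / (q - 1) * A powr (1 / q) * (b powr (- s)) powr (1 - 1 / q))"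
        using True by (intro nn_integral_weak_le k q A cheb) auto
      also have "\<dots> = ennreal (indicator {0..T} b * (K * b powr (- (s * (1 - 1 / q)))))"
        using True by (simp add: K_def powr_powr)
      finally show ?thesis .
    qed (auto simp: indicator_def)
  qed
  also have "\<dots> = ennreal (K * (T powr (1 - s * (1 - 1 / q)) / (1 - s * (1 - 1 / q))))"
  proof -
    have "((\<lambda>b. b powr (- (s * (1 - 1 / q)))) has_integral T powr (- (s * (1 - 1 / q)) + 1) / (- (s * (1 - 1 / q)) + 1)) {0..T}"
      using sq T by (intro has_integral_powr_from_0) auto
    then have "((\<lambda>b. K * b powr (- (s * (1 - 1 / q)))) has_integral K * (T powr (1 - s * (1 - 1 / q)) / (1 - s * (1 - 1 / q)))) {0..T}"
      by (intro has_integral_mult_right) (simp add: algebra_simps)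
    then show ?thesis
      using K by (intro nn_integral_has_integral_lebesgue) auto
  qed
  finally show ?thesis by (simp add: K_def)
qed

text \<open>For fixed \<open>x\<close> the truncated estimate with height \<open>g x powr (s / p)\<close> applies, and the relation
  between the exponents turns its bound into a multiple of \<open>g x powr s\<close>.\<close>

lemma weak_Young_half:
  fixes \<kappa> :: "'a::euclidean_space \<Rightarrow> 'a \<Rightarrow> complex" and f g :: "'a \<Rightarrow> real"
  assumes m [measurable]: "\<And>x. \<kappa> x \<in> borel_measurable borel" "f \<in> borel_measurable borel" "g \<in> borel_measurable borel"
    and \<kappa>: "\<And>x. weak_bound q A (\<kappa> x)" and A: "0 < A"
    and f0: "\<And>y. 0 \<le> f y" and g0: "\<And>y. 0 \<le> g y"
    and fp: "(\<integral>\<^sup>+y. ennreal (f y powr p) \<partial>lborel) \<le> 1" and gs: "(\<integral>\<^sup>+y. ennreal (g y powr s) \<partial>lborel) \<le> 1"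
    and p: "1 < p" and s: "1 < s" and q: "1 < q" and pqs: "1 / p + 1 / q + 1 / s = 2"
  shows "(\<integral>\<^sup>+x. (\<integral>\<^sup>+y. ennreal (g x) * (ennreal (norm (\<kappa> x y) * f y) * indicator {y. f y \<le> g x powr (s / p)} y) \<partial>lborel) \<partial>lborel)
    \<le> ennreal (q / (q - 1) * A powr (1 / q) / (p - p / s))"
proof -
  define K where "K = q / (q - 1) * A powr (1 / q)"
  have K: "0 \<le> K" using q A by (simp add: K_def)
  define b where "b = p - p / s"
  have "p / s < p / 1" using p s by (intro divide_strict_left_mono) auto
  then have b: "0 < b" by (simp add: b_def)
  have theta: "1 - 1 / q = 1 / p + 1 / s - 1" using pqs by simp
  have pb: "1 - p * (1 - 1 / q) = b" unfolding theta b_def using p by (simp add: field_simps)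
  have "(\<integral>\<^sup>+y. ennreal (g x) * (ennreal (norm (\<kappa> x y) * f y) * indicator {y. f y \<le> g x powr (s / p)} y) \<partial>lborel)
    \<le> ennreal (K / b) * ennreal (g x powr s)" for x
  proof -
    have "(\<integral>\<^sup>+y. ennreal (g x) * (ennreal (norm (\<kappa> x y) * f y) * indicator {y. f y \<le> g x powr (s / p)} y) \<partial>lborel)
      = ennreal (g x) * (\<integral>\<^sup>+y. ennreal (norm (\<kappa> x y) * f y) * indicator {y. f y \<le> g x powr (s / p)} y \<partial>lborel)"
      by (rule nn_integral_cmult) measurable
    also have "\<dots> \<le> ennreal (g x) * ennreal (q / (q - 1) * A powr (1 / q) / (1 - p * (1 - 1 / q)) * (g x powr (s / p)) powr (1 - p * (1 - 1 / q)))"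
      using p pb b by (intro mult_left_mono nn_integral_weak_truncated_le \<kappa> q A f0 fp m) auto
    also have "\<dots> = ennreal (g x * (K / b * (g x powr (s / p)) powr b))"
      unfolding pb K_def[symmetric] by (rule ennreal_mult'[OF g0, symmetric])
    also have "g x * (K / b * (g x powr (s / p)) powr b) = K / b * g x powr s"
    proof (cases "g x = 0")
      case False
      then have "g x * (g x powr (s / p)) powr b = g x powr (1 + (s / p) * b)"
        using g0[of x] by (simp add: powr_powr powr_add)
      also have "1 + (s / p) * b = s" using p s by (simp add: b_def field_simps)
      finally show ?thesis by (simp add: algebra_simps)
    qed simp
    also have "ennreal (K / b * g x powr s) = ennreal (K / b) * ennreal (g x powr s)"
      by (rule ennreal_mult) (use K b in auto)
    finally show ?thesis .
  qed
  then have "(\<integral>\<^sup>+x. (\<integral>\<^sup>+y. ennreal (g x) * (ennreal (norm (\<kappa> x y) * f y) * indicator {y. f y \<le> g x powr (s / p)} y) \<partial>lborel) \<partial>lborel)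
    \<le> (\<integral>\<^sup>+x. ennreal (K / b) * ennreal (g x powr s) \<partial>lborel)"
    by (intro nn_integral_mono)
  also have "\<dots> = ennreal (K / b) * (\<integral>\<^sup>+x. ennreal (g x powr s) \<partial>lborel)"
    by (rule nn_integral_cmult) measurable
  also have "\<dots> \<le> ennreal (K / b) * 1" by (intro mult_left_mono gs) simp
  finally show ?thesis by (simp add: K_def b_def)
qed

text \<open>The pairs \<open>(x, y)\<close> satisfy \<open>f y \<le> g x powr (s / p)\<close> or \<open>g x \<le> f y powr (p / s)\<close>. The two cases are
  interchanged when \<open>f\<close> and \<open>g\<close> trade places, and the previous lemma handles each.\<close>

lemma weak_Young_trilinear:
  fixes k :: "'a::euclidean_space \<Rightarrow> complex" and f g :: "'a \<Rightarrow> real"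
  assumes [measurable]: "k \<in> borel_measurable borel" "f \<in> borel_measurable borel" "g \<in> borel_measurable borel"
    and k: "weak_bound q A k" and A: "0 < A"
    and f0: "\<And>y. 0 \<le> f y" and g0: "\<And>y. 0 \<le> g y"
    and fp: "(\<integral>\<^sup>+y. ennreal (f y powr p) \<partial>lborel) \<le> 1" and gs: "(\<integral>\<^sup>+y. ennreal (g y powr s) \<partial>lborel) \<le> 1"
    and p: "1 < p" and s: "1 < s" and q: "1 < q" and pqs: "1 / p + 1 / q + 1 / s = 2"
  shows "(\<integral>\<^sup>+x. (\<integral>\<^sup>+y. ennreal (g x * (norm (k (x - y)) * f y)) \<partial>lborel) \<partial>lborel)
    \<le> ennreal (q / (q - 1) * (1 / (p - p / s) + 1 / (s - s / p)) * A powr (1 / q))"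
proof -
  define K where "K = q / (q - 1) * A powr (1 / q)"
  have K: "0 \<le> K" using q A by (simp add: K_def)
  define b where "b = p - p / s"
  define a where "a = s - s / p"
  have "p / s < p / 1" "s / p < s / 1" using p s by (intro divide_strict_left_mono; simp)+
  then have ab: "0 < a" "0 < b" by (auto simp: a_def b_def)
  have kx: "weak_bound q A (\<lambda>y. k (x - y))" for x by (rule weak_bound_reflect[OF _ k]) simp
  have ky: "weak_bound q A (\<lambda>x. k (x - y))" for y
    using weak_bound_reflect[OF _ weak_bound_reflect[OF _ k, of 0], of y] by simp
  let ?F1 = "\<lambda>x y. ennreal (g x) * (ennreal (norm (k (x - y)) * f y) * indicator {y. f y \<le> g x powr (s / p)} y)"
  let ?F2 = "\<lambda>x y. ennreal (f y) * (ennreal (norm (k (x - y)) * g x) * indicator {x. g x \<le> f y powr (p / s)} x)"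
  have pt: "ennreal (g x * (norm (k (x - y)) * f y)) \<le> ?F1 x y + ?F2 x y" for x y
  proof (cases "f y \<le> g x powr (s / p)")
    case True
    then have "ennreal (g x * (norm (k (x - y)) * f y)) = ?F1 x y"
      using g0[of x] f0[of y] by (simp add: ennreal_mult)
    then show ?thesis by simp
  next
    case False
    have "g x = (g x powr (s / p)) powr (p / s)" using p s g0[of x] by (simp add: powr_powr)
    also have "\<dots> \<le> f y powr (p / s)" using False p s by (intro powr_mono2) auto
    finally have "ennreal (g x * (norm (k (x - y)) * f y)) = ?F2 x y"
      using g0[of x] f0[of y] by (simp add: ennreal_mult mult_ac)
    then show ?thesis by simp
  qed
  have F1m [measurable]: "(\<lambda>(x, y). ?F1 x y) \<in> borel_measurable (lborel \<Otimes>\<^sub>M lborel)"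
    by (simp add: indicator_def, measurable)
  have F2m [measurable]: "(\<lambda>(x, y). ?F2 x y) \<in> borel_measurable (lborel \<Otimes>\<^sub>M lborel)"
    by (simp add: indicator_def, measurable)
  have F1y [measurable]: "(\<lambda>y. ?F1 x y) \<in> borel_measurable lborel" for x
    by (simp add: indicator_def, measurable)
  have F2y [measurable]: "(\<lambda>y. ?F2 x y) \<in> borel_measurable lborel" for x
    by (simp add: indicator_def, measurable)
  have part1: "(\<integral>\<^sup>+x. (\<integral>\<^sup>+y. ?F1 x y \<partial>lborel) \<partial>lborel) \<le> ennreal (K / b)"
    unfolding K_def b_def by (rule weak_Young_half[OF _ _ _ kx A f0 g0 fp gs p s q pqs]) measurable
  have "1 / s + 1 / q + 1 / p = 2" using pqs by simp
  from weak_Young_half[OF _ _ _ ky A g0 f0 gs fp s p q this]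
  have "(\<integral>\<^sup>+y. (\<integral>\<^sup>+x. ?F2 x y \<partial>lborel) \<partial>lborel) \<le> ennreal (K / a)"
    unfolding K_def a_def by simp
  then have part2: "(\<integral>\<^sup>+x. (\<integral>\<^sup>+y. ?F2 x y \<partial>lborel) \<partial>lborel) \<le> ennreal (K / a)"
    unfolding lborel_pair.Fubini'[OF F2m] .
  have "(\<integral>\<^sup>+x. (\<integral>\<^sup>+y. ennreal (g x * (norm (k (x - y)) * f y)) \<partial>lborel) \<partial>lborel)
    \<le> (\<integral>\<^sup>+x. (\<integral>\<^sup>+y. ?F1 x y + ?F2 x y \<partial>lborel) \<partial>lborel)"
    by (intro nn_integral_mono pt)
  also have "\<dots> = (\<integral>\<^sup>+x. (\<integral>\<^sup>+y. ?F1 x y \<partial>lborel) + (\<integral>\<^sup>+y. ?F2 x y \<partial>lborel) \<partial>lborel)"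
    by (intro nn_integral_cong nn_integral_add F1y F2y)
  also have "\<dots> = (\<integral>\<^sup>+x. (\<integral>\<^sup>+y. ?F1 x y \<partial>lborel) \<partial>lborel) + (\<integral>\<^sup>+x. (\<integral>\<^sup>+y. ?F2 x y \<partial>lborel) \<partial>lborel)"
    using lborel.borel_measurable_nn_integral[OF F1m] lborel.borel_measurable_nn_integral[OF F2m]
    by (intro nn_integral_add) auto
  also have "\<dots> \<le> ennreal (K / b) + ennreal (K / a)" by (intro add_mono part1 part2)
  also have "\<dots> = ennreal (q / (q - 1) * (1 / b + 1 / a) * A powr (1 / q))"
  proof -
    have "ennreal (K / b) + ennreal (K / a) = ennreal (K / b + K / a)"
      using K ab by (intro ennreal_plus[symmetric]) auto
    also have "K / b + K / a = q / (q - 1) * (1 / b + 1 / a) * A powr (1 / q)"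
      by (simp add: K_def add_divide_distrib distrib_left distrib_right)
    finally show ?thesis .
  qed
  finally show ?thesis by (simp add: a_def b_def)
qed

text \<open>The converse of Hoelder's inequality. The function is not known to be finite, let alone in \<open>L\<^sub>r\<close>, so it is tested
  against the dual functions of its truncations in height and in space.\<close>

lemma nn_integral_powr_le_by_duality:
  fixes H :: "'a::euclidean_space \<Rightarrow> ennreal"
  assumes [measurable]: "H \<in> borel_measurable borel" and rs: "1 < r" "1 / r + 1 / s = 1" and C: "0 \<le> C"
    and dual: "\<And>g. g \<in> borel_measurable borel \<Longrightarrow> (\<And>x. 0 \<le> g x) \<Longrightarrow> (\<integral>\<^sup>+x. ennreal (g x powr s) \<partial>lborel) \<le> 1 \<Longrightarrow>
      (\<integral>\<^sup>+x. ennreal (g x) * H x \<partial>lborel) \<le> ennreal C"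
  shows "AE x in lborel. H x < \<infinity>" "(\<integral>\<^sup>+x. ennreal (enn2real (H x) powr r) \<partial>lborel) \<le> ennreal (C powr r)"
proof -
  have s: "1 < s" by (rule conj_exponent_gt_1[OF rs])
  have rss: "(r - 1) * s = r" using rs s by (simp add: field_simps)
  define h where "h m x = enn2real (min (H x) (of_nat m)) * indicator (ball 0 (real m)) x" for m :: nat and x
  have [measurable]: "ball (0::'a) \<rho> \<in> sets borel" for \<rho> by simp
  have [measurable]: "h m \<in> borel_measurable borel" for m unfolding h_def[abs_def] by measurable
  have h0: "0 \<le> h m x" for m x by (simp add: h_def)
  have minfin: "min (H x) (of_nat m) < \<infinity>" for m x
    by (simp add: min_less_iff_disj of_nat_less_top)
  have hH: "ennreal (h m x) \<le> H x" for m x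
    using minfin[of x m] by (auto simp: h_def indicator_def ennreal_enn2real_if less_top)
  have hm: "h m x \<le> real m * indicator (ball 0 (real m)) x" for m x
  proof -
    have "enn2real (min (H x) (of_nat m)) \<le> enn2real (of_nat m)"
      by (intro enn2real_mono) (auto simp: of_nat_less_top)
    then show ?thesis by (auto simp: h_def indicator_def ennreal_of_nat_eq_real_of_nat)
  qed
  have bound: "(\<integral>\<^sup>+x. ennreal (h m x powr r) \<partial>lborel) \<le> ennreal (C powr r)" for m
  proof -
    have "(\<integral>\<^sup>+x. ennreal (h m x powr r) \<partial>lborel) \<le> (\<integral>\<^sup>+x. ennreal (real m powr r) * indicator (ball (0::'a) (real m)) x \<partial>lborel)"
    proof (rule nn_integral_mono)
      fix x
      have "h m x powr r \<le> (real m * indicator (ball 0 (real m)) x) powr r"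
        using hm[of m x] h0 rs by (intro powr_mono2) auto
      then show "ennreal (h m x powr r) \<le> ennreal (real m powr r) * indicator (ball 0 (real m)) x"
        using rs by (auto simp: indicator_def intro: ennreal_leI split: if_splits)
    qed
    also have "\<dots> = ennreal (real m powr r) * emeasure lborel (ball (0::'a) (real m))"
      by (rule nn_integral_cmult_indicator) simp
    also have "\<dots> < \<infinity>" using emeasure_lborel_ball_finite[of "0::'a" "real m"] by (simp add: ennreal_mult_less_top)
    finally obtain N where N: "0 \<le> N" "(\<integral>\<^sup>+x. ennreal (h m x powr r) \<partial>lborel) = ennreal N"
      by (cases "\<integral>\<^sup>+x. ennreal (h m x powr r) \<partial>lborel") auto
    show ?thesis
    proof (cases "N = 0")
      case True
      then show ?thesis using N by simp
    next
      case False
      with N have "0 < N" by simp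
      define g where "g x = N powr (- 1 / s) * h m x powr (r - 1)" for x
      have [measurable]: "g \<in> borel_measurable borel" unfolding g_def[abs_def] by measurable
      have "(\<integral>\<^sup>+x. ennreal (g x powr s) \<partial>lborel) = (\<integral>\<^sup>+x. ennreal (1 / N) * ennreal (h m x powr r) \<partial>lborel)"
      proof (rule nn_integral_cong)
        fix x
        have "g x powr s = 1 / N * h m x powr r"
        proof -
          have "g x powr s = (N powr (- 1 / s)) powr s * (h m x powr (r - 1)) powr s"
            by (simp add: g_def powr_mult)
          also have "(N powr (- 1 / s)) powr s = N powr (- 1)" using s by (simp add: powr_powr)
          also have "\<dots> = 1 / N" using \<open>0 < N\<close> by (simp add: powr_minus_divide)
          also have "(h m x powr (r - 1)) powr s = h m x powr r" by (simp add: powr_powr rss)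
          finally show ?thesis .
        qed
        then show "ennreal (g x powr s) = ennreal (1 / N) * ennreal (h m x powr r)"
          using \<open>0 < N\<close> ennreal_mult[of "1 / N" "h m x powr r"] by simp
      qed
      also have "\<dots> = ennreal (1 / N) * ennreal N"
        by (subst nn_integral_cmult) (auto simp: N)
      also have "\<dots> = 1" using \<open>0 < N\<close> by (simp add: ennreal_mult'[symmetric])
      finally have g1: "(\<integral>\<^sup>+x. ennreal (g x powr s) \<partial>lborel) \<le> 1" by simp
      have "ennreal (N powr (- 1 / s)) * ennreal N = (\<integral>\<^sup>+x. ennreal (N powr (- 1 / s)) * ennreal (h m x powr r) \<partial>lborel)"
        by (subst nn_integral_cmult) (auto simp: N)
      also have "\<dots> \<le> (\<integral>\<^sup>+x. ennreal (g x) * H x \<partial>lborel)"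
      proof (rule nn_integral_mono)
        fix x
        have "h m x powr r = h m x powr (r - 1) * h m x"
          using h0[of m x] powr_add[of "h m x" "r - 1" 1] by (cases "h m x = 0") auto
        then have "ennreal (N powr (- 1 / s)) * ennreal (h m x powr r) = ennreal (g x) * ennreal (h m x)"
          using h0[of m x] by (simp add: g_def ennreal_mult' mult.assoc)
        also have "\<dots> \<le> ennreal (g x) * H x" by (intro mult_left_mono hH) simp
        finally show "ennreal (N powr (- 1 / s)) * ennreal (h m x powr r) \<le> ennreal (g x) * H x" .
      qed
      also have "\<dots> \<le> ennreal C" by (rule dual[OF _ _ g1]) (auto simp: g_def)
      finally have "ennreal (N powr (- 1 / s) * N) \<le> ennreal C" using \<open>0 < N\<close> by (simp add: ennreal_mult')
      then have "N powr (- 1 / s) * N \<le> C" using C by simp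
      moreover have "N powr (- 1 / s) * N = N powr (1 / r)"
      proof -
        have "1 / r = - 1 / s + 1" using rs(2) by simp
        then show ?thesis using \<open>0 < N\<close> by (simp only: powr_add powr_one)
      qed
      ultimately have "(N powr (1 / r)) powr r \<le> C powr r" using rs by (intro powr_mono2) auto
      then show ?thesis using N \<open>0 < N\<close> rs by (simp add: powr_powr ennreal_leI)
    qed
  qed
  have hmono: "h m x \<le> h n x" if "m \<le> n" for m n x
  proof -
    have "enn2real (min (H x) (of_nat m)) \<le> enn2real (min (H x) (of_nat n))"
      using that minfin[of x n] by (intro enn2real_mono min.mono) auto
    then show ?thesis using that by (auto simp: h_def indicator_def)
  qed
  define G where "G x = (SUP m. ennreal (h m x powr r))" for x
  have [measurable]: "G \<in> borel_measurable borel" unfolding G_def[abs_def] by measurable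
  have "(\<integral>\<^sup>+x. G x \<partial>lborel) = (SUP m. \<integral>\<^sup>+x. ennreal (h m x powr r) \<partial>lborel)"
    unfolding G_def
    by (rule nn_integral_monotone_convergence_SUP)
       (use rs h0 hmono in \<open>auto intro!: incseq_SucI le_funI ennreal_leI powr_mono2\<close>)
  also have "\<dots> \<le> ennreal (C powr r)" by (rule SUP_least) (rule bound)
  finally have G: "(\<integral>\<^sup>+x. G x \<partial>lborel) \<le> ennreal (C powr r)" .
  then have "(\<integral>\<^sup>+x. G x \<partial>lborel) \<noteq> \<infinity>" by (auto simp: top_unique)
  then have Gfin: "AE x in lborel. G x \<noteq> \<infinity>" by (intro nn_integral_PInf_AE) auto
  have Hfin: "H x < \<infinity>" if fin: "G x \<noteq> \<infinity>" for x
  proof (rule ccontr)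
    assume "\<not> H x < \<infinity>"
    then have H: "H x = \<infinity>" by (simp add: less_top[symmetric])
    obtain B where B: "0 \<le> B" "G x = ennreal B" using fin by (cases "G x") auto
    obtain m where m: "norm x < real m" "B powr (1 / r) < real m"
      using reals_Archimedean2[of "max (norm x) (B powr (1 / r))"] by auto
    have "h m x = real m"
      using m H by (simp add: h_def ennreal_of_nat_eq_real_of_nat)
    moreover have "ennreal (h m x powr r) \<le> G x" unfolding G_def by (rule SUP_upper) simp
    ultimately have "real m powr r \<le> B" using B by simp
    then have "(real m powr r) powr (1 / r) \<le> B powr (1 / r)" using rs by (intro powr_mono2) auto
    then show False using m rs by (simp add: powr_powr)
  qed
  show "AE x in lborel. H x < \<infinity>" using Gfin by eventually_elim (rule Hfin)
  have "(\<integral>\<^sup>+x. ennreal (enn2real (H x) powr r) \<partial>lborel) \<le> (\<integral>\<^sup>+x. G x \<partial>lborel)"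
  proof (rule nn_integral_mono_AE)
    show "AE x in lborel. ennreal (enn2real (H x) powr r) \<le> G x"
      using Gfin
    proof eventually_elim
      case (elim x)
      obtain B where B: "0 \<le> B" "H x = ennreal B" using Hfin[OF elim] by (cases "H x") auto
      obtain m where m: "norm x < real m" "B < real m"
        using reals_Archimedean2[of "max (norm x) B"] by auto
      have "min (ennreal B) (of_nat m) = ennreal B"
        using m(2) by (intro min_absorb1) (simp add: ennreal_of_nat_eq_real_of_nat ennreal_leI)
      then have "h m x = enn2real (H x)" using m B by (simp add: h_def)
      moreover have "ennreal (h m x powr r) \<le> G x" unfolding G_def by (rule SUP_upper) simp
      ultimately show ?case by simp
    qed
  qed
  with G show "(\<integral>\<^sup>+x. ennreal (enn2real (H x) powr r) \<partial>lborel) \<le> ennreal (C powr r)" by simp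
qed

definition convolve :: "('a::euclidean_space \<Rightarrow> complex) \<Rightarrow> ('a \<Rightarrow> complex) \<Rightarrow> 'a \<Rightarrow> complex" where
  "convolve k f x = (\<integral>y. k y * f (x - y) \<partial>lborel)"

text \<open>The constant of the trilinear estimate for \<open>s = r / (r - 1)\<close>.\<close>

definition weak_Young_const :: "real \<Rightarrow> real \<Rightarrow> real \<Rightarrow> real" where
  "weak_Young_const p q r =
    q / (q - 1) * (1 / (p - p / (r / (r - 1))) + 1 / (r / (r - 1) - r / (r - 1) / p))"

text \<open>With \<open>p' = p / (p - 1)\<close> and \<open>s = r / (r - 1)\<close>, the triple \<open>(s, q, p')\<close> satisfies the same
  relations as \<open>(p, q, r)\<close>. This is why every statement about convolution also applies to the adjoint.\<close>

lemma conv_exponents: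
  fixes p q r :: real
  assumes "1 < p" "p < r" "1 / p + 1 / q = 1 + 1 / r"
  shows "1 < q" "1 < r / (r - 1)" "1 / r + 1 / (r / (r - 1)) = 1" "1 / p + 1 / q + 1 / (r / (r - 1)) = 2"
    "r / (r - 1) < p / (p - 1)" "1 / p + 1 / (p / (p - 1)) = 1" "1 < p / (p - 1)"
    "1 / (r / (r - 1)) + 1 / q = 1 + 1 / (p / (p - 1))"
proof -
  have "1 / r < 1 / p" "1 / p < 1" "0 < 1 / r" using assms by (auto simp: field_simps)
  then have "1 / q < 1" "0 < 1 / q" using assms(3) by linarith+
  then show "1 < q" by (simp add: field_simps split: if_splits)
  show "1 < r / (r - 1)" "1 < p / (p - 1)" using assms by (auto simp: field_simps)
  have 1: "1 / (r / (r - 1)) = 1 - 1 / r" using assms by (simp add: field_simps)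
  have 2: "1 / (p / (p - 1)) = 1 - 1 / p" using assms by (simp add: field_simps)
  show "1 / r + 1 / (r / (r - 1)) = 1" "1 / p + 1 / q + 1 / (r / (r - 1)) = 2"
    "1 / p + 1 / (p / (p - 1)) = 1" "1 / (r / (r - 1)) + 1 / q = 1 + 1 / (p / (p - 1))"
    unfolding 1 2 using assms(3) by auto
  show "r / (r - 1) < p / (p - 1)" using assms by (simp add: field_simps)
qed

lemma weak_Young_const_pos:
  assumes "1 < p" "p < r" "1 / p + 1 / q = 1 + 1 / r"
  shows "0 < weak_Young_const p q r"
proof -
  note e = conv_exponents[OF assms]
  define s where "s = r / (r - 1)"
  have "p / s < p / 1" "s / p < s / 1" using assms e by (intro divide_strict_left_mono; simp add: s_def)+
  then show ?thesis
    unfolding weak_Young_const_def s_def[symmetric] using e(1)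
    by (intro mult_pos_pos add_pos_pos divide_pos_pos) auto
qed

lemma convolve_measurable [measurable]:
  assumes [measurable]: "k \<in> borel_measurable borel" "f \<in> borel_measurable borel"
  shows "convolve k f \<in> borel_measurable borel"
  unfolding convolve_def[abs_def] by measurable

text \<open>Any \<open>N\<close> above the norm of \<open>f\<close> is admitted, so that the case of norm 0 can be reached as a limit.\<close>

lemma weak_Young_scaled:
  fixes k f :: "'a::euclidean_space \<Rightarrow> complex"
  assumes e: "1 < p" "p < r" "1 / p + 1 / q = 1 + 1 / r"
    and [measurable]: "k \<in> borel_measurable borel" and k: "weak_bound q A k" "0 < A"
    and f: "f \<in> lpspace lborel p" and N: "0 < N" "lpint lborel p f \<le> N powr p"
  shows "AE x in lborel. integrable lborel (\<lambda>y. k y * f (x - y))"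
    "convolve k f \<in> lpspace lborel r"
    "lpint lborel r (convolve k f) \<le> (weak_Young_const p q r * A powr (1 / q) * N) powr r"
proof -
  define C where "C = weak_Young_const p q r * A powr (1 / q)"
  note ee = conv_exponents[OF e]
  define s where "s = r / (r - 1)"
  have C: "0 \<le> C" using weak_Young_const_pos[OF e] by (simp add: C_def)
  have [measurable]: "f \<in> borel_measurable borel" using lpspaceD(1)[OF f] by simp
  define H where "H x = (\<integral>\<^sup>+y. ennreal (norm (k (x - y)) * (norm (f y) / N)) \<partial>lborel)" for x
  have [measurable]: "H \<in> borel_measurable borel" unfolding H_def[abs_def] by measurable
  have fN: "(\<integral>\<^sup>+y. ennreal ((norm (f y) / N) powr p) \<partial>lborel) \<le> 1"
  proof -
    have "(\<integral>\<^sup>+y. ennreal ((norm (f y) / N) powr p) \<partial>lborel) = (\<integral>\<^sup>+y. ennreal (norm (f y) powr p / N powr p) \<partial>lborel)"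
      using N by (simp add: powr_divide)
    also have "\<dots> = ennreal (\<integral>y. norm (f y) powr p / N powr p \<partial>lborel)"
      using lpspaceD(2)[OF f] by (intro nn_integral_eq_integral) auto
    also have "(\<integral>y. norm (f y) powr p / N powr p \<partial>lborel) = lpint lborel p f / N powr p" by (simp add: lpint_def)
    also have "ennreal (lpint lborel p f / N powr p) \<le> ennreal 1" using N by (intro ennreal_leI) simp
    finally show ?thesis by simp
  qed
  have dual: "(\<integral>\<^sup>+x. ennreal (g x) * H x \<partial>lborel) \<le> ennreal C"
    if [measurable]: "g \<in> borel_measurable borel" and g: "\<And>x. 0 \<le> g x" "(\<integral>\<^sup>+x. ennreal (g x powr s) \<partial>lborel) \<le> 1"
    for g :: "'a \<Rightarrow> real"
  proof -
    have "ennreal (g x) * H x = (\<integral>\<^sup>+y. ennreal (g x * (norm (k (x - y)) * (norm (f y) / N))) \<partial>lborel)" for x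
    proof -
      have "ennreal (g x) * H x = (\<integral>\<^sup>+y. ennreal (g x) * ennreal (norm (k (x - y)) * (norm (f y) / N)) \<partial>lborel)"
        unfolding H_def by (rule nn_integral_cmult[symmetric]) measurable
      also have "\<dots> = (\<integral>\<^sup>+y. ennreal (g x * (norm (k (x - y)) * (norm (f y) / N))) \<partial>lborel)"
        by (intro nn_integral_cong ennreal_mult'[symmetric] g)
      finally show ?thesis .
    qed
    then have "(\<integral>\<^sup>+x. ennreal (g x) * H x \<partial>lborel)
      = (\<integral>\<^sup>+x. (\<integral>\<^sup>+y. ennreal (g x * (norm (k (x - y)) * (norm (f y) / N))) \<partial>lborel) \<partial>lborel)" by simp
    also have "\<dots> \<le> ennreal (q / (q - 1) * (1 / (p - p / s) + 1 / (s - s / p)) * A powr (1 / q))"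
      using e ee g N k fN by (intro weak_Young_trilinear) (auto simp: s_def)
    finally show ?thesis by (simp add: C_def weak_Young_const_def s_def)
  qed
  have rs: "1 < r" "1 / r + 1 / s = 1" using e ee by (auto simp: s_def)
  have Hm: "H \<in> borel_measurable borel" by measurable
  have HH: "AE x in lborel. H x < \<infinity>"
      "(\<integral>\<^sup>+x. ennreal (enn2real (H x) powr r) \<partial>lborel) \<le> ennreal (C powr r)"
    by (rule nn_integral_powr_le_by_duality[OF Hm rs C], rule dual, assumption+)+
  have nn: "(\<integral>\<^sup>+y. ennreal (norm (k y * f (x - y))) \<partial>lborel) = ennreal N * H x" for x
  proof -
    have "(\<integral>\<^sup>+y. ennreal (norm (k y * f (x - y))) \<partial>lborel) = (\<integral>\<^sup>+y. ennreal (norm (k (x - y) * f y)) \<partial>lborel)"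
      using nn_integral_reflect[of "\<lambda>y. ennreal (norm (k (x - y) * f y))" x] by simp
    also have "\<dots> = (\<integral>\<^sup>+y. ennreal N * ennreal (norm (k (x - y)) * (norm (f y) / N)) \<partial>lborel)"
      using N by (intro nn_integral_cong) (simp add: norm_mult flip: ennreal_mult')
    also have "\<dots> = ennreal N * H x" unfolding H_def by (rule nn_integral_cmult) measurable
    finally show ?thesis .
  qed
  have int: "integrable lborel (\<lambda>y. k y * f (x - y))" if "H x < \<infinity>" for x
    using that by (intro integrableI_bounded) (auto simp: nn ennreal_mult_less_top)
  show "AE x in lborel. integrable lborel (\<lambda>y. k y * f (x - y))"
    using HH(1) by (auto elim!: eventually_mono intro: int)
  have le: "norm (convolve k f x) \<le> N * enn2real (H x)" if "H x < \<infinity>" for x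
  proof -
    have "ennreal (norm (convolve k f x)) \<le> (\<integral>\<^sup>+y. ennreal (norm (k y * f (x - y))) \<partial>lborel)"
      unfolding convolve_def by (rule integral_norm_bound_ennreal[OF int[OF that]])
    also have "\<dots> = ennreal (N * enn2real (H x))" unfolding nn using that N
      by (simp add: ennreal_mult' ennreal_enn2real_if less_top)
    finally show ?thesis using N by simp
  qed
  have nnle: "(\<integral>\<^sup>+x. ennreal (norm (convolve k f x) powr r) \<partial>lborel) \<le> ennreal ((C * N) powr r)"
  proof -
    have "(\<integral>\<^sup>+x. ennreal (norm (convolve k f x) powr r) \<partial>lborel) \<le> (\<integral>\<^sup>+x. ennreal (N powr r) * ennreal (enn2real (H x) powr r) \<partial>lborel)"
    proof (rule nn_integral_mono_AE)
      show "AE x in lborel. ennreal (norm (convolve k f x) powr r) \<le> ennreal (N powr r) * ennreal (enn2real (H x) powr r)"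
        using HH(1)
      proof eventually_elim
        case (elim x)
        then have "norm (convolve k f x) powr r \<le> (N * enn2real (H x)) powr r"
          using e by (intro powr_mono2 le) auto
        then show ?case by (simp add: powr_mult ennreal_leI flip: ennreal_mult')
      qed
    qed
    also have "\<dots> = ennreal (N powr r) * (\<integral>\<^sup>+x. ennreal (enn2real (H x) powr r) \<partial>lborel)"
      by (rule nn_integral_cmult) measurable
    also have "\<dots> \<le> ennreal (N powr r) * ennreal (C powr r)" by (intro mult_left_mono HH(2)) simp
    also have "\<dots> = ennreal ((C * N) powr r)" by (simp add: powr_mult mult.commute flip: ennreal_mult')
    finally show ?thesis .
  qed
  have I: "integrable lborel (\<lambda>x. norm (convolve k f x) powr r)"
    using nnle by (intro integrableI_bounded) (auto simp: less_top top_unique intro: le_less_trans)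
  then show "convolve k f \<in> lpspace lborel r" by (simp add: lpspace_def)
  have "ennreal (lpint lborel r (convolve k f)) \<le> ennreal ((C * N) powr r)"
    unfolding lpint_def using nnle by (subst nn_integral_eq_integral[symmetric, OF I]) auto
  then show "lpint lborel r (convolve k f) \<le> (weak_Young_const p q r * A powr (1 / q) * N) powr r"
    by (simp add: C_def)
qed

lemma weak_Young:
  fixes k f :: "'a::euclidean_space \<Rightarrow> complex"
  assumes e: "1 < p" "p < r" "1 / p + 1 / q = 1 + 1 / r"
    and k: "k \<in> borel_measurable borel" "weak_bound q A k" "0 < A"
    and f: "f \<in> lpspace lborel p"
  shows "AE x in lborel. integrable lborel (\<lambda>y. k y * f (x - y))"
    "convolve k f \<in> lpspace lborel r"
    "lpint lborel r (convolve k f) \<le> (weak_Young_const p q r * A powr (1 / q)) powr r * lpint lborel p f powr (r / p)"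
proof -
  note w = weak_Young_scaled[OF e k f]
  define L where "L = lpint lborel p f"
  have L0: "0 \<le> L" by (simp add: L_def)
  have "lpint lborel p f \<le> (L powr (1 / p) + 1) powr p"
  proof -
    have "L = (L powr (1 / p)) powr p" using e L0 by (simp add: powr_powr)
    also have "\<dots> \<le> (L powr (1 / p) + 1) powr p" using e by (intro powr_mono2) auto
    finally show ?thesis by (simp add: L_def)
  qed
  then show "AE x in lborel. integrable lborel (\<lambda>y. k y * f (x - y))" "convolve k f \<in> lpspace lborel r"
    using w(1,2)[of "L powr (1 / p) + 1"] by (auto simp: add_nonneg_pos)
  define C where "C = weak_Young_const p q r * A powr (1 / q)"
  have C: "0 < C" using weak_Young_const_pos[OF e] k by (simp add: C_def)
  show "lpint lborel r (convolve k f) \<le> (weak_Young_const p q r * A powr (1 / q)) powr r * lpint lborel p f powr (r / p)"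
  proof (cases "L = 0")
    case False
    have "lpint lborel r (convolve k f) \<le> (C * L powr (1 / p)) powr r"
      unfolding C_def using L0 False e by (intro w(3)) (auto simp: L_def powr_powr)
    then show ?thesis using e by (simp add: powr_mult powr_powr C_def L_def)
  next
    case True
    define M where "M = lpint lborel r (convolve k f)"
    have "M \<le> 0"
    proof (rule ccontr)
      assume "\<not> M \<le> 0"
      then have "0 < M" by simp
      define N where "N = (M / 2) powr (1 / r) / C"
      have "0 < N" using \<open>0 < M\<close> C by (simp add: N_def)
      then have "M \<le> (C * N) powr r"
        unfolding C_def M_def using True by (intro w(3)) (auto simp: L_def)
      also have "C * N = (M / 2) powr (1 / r)" using C by (simp add: N_def)
      also have "\<dots> powr r = M / 2" using \<open>0 < M\<close> e by (simp add: powr_powr)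
      finally show False using \<open>0 < M\<close> by simp
    qed
    then show ?thesis using True e by (simp add: M_def L_def)
  qed
qed

lemma weak_bound_norm: "weak_bound q A (\<lambda>x. complex_of_real (norm (k x))) \<longleftrightarrow> weak_bound q A k"
  by (simp add: weak_bound_def)

lemma lpspace_norm: "f \<in> lpspace M p \<Longrightarrow> (\<lambda>x. complex_of_real (norm (f x))) \<in> lpspace M p"
  by (auto simp: lpspace_def)

text \<open>Fubini's theorem; absolute integrability is the weak Young inequality for \<open>|k|\<close> and \<open>|f|\<close>.\<close>

lemma convolve_adjoint:
  fixes k f g :: "'a::euclidean_space \<Rightarrow> complex"
  assumes e: "1 < p" "p < r" "1 / p + 1 / q = 1 + 1 / r"
    and k: "k \<in> borel_measurable borel" "weak_bound q A k" "0 < A"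
    and f: "f \<in> lpspace lborel p" and g: "g \<in> lpspace lborel (r / (r - 1))"
  shows "(\<integral>x. convolve k f x * g x \<partial>lborel) = (\<integral>y. f y * convolve (\<lambda>z. k (- z)) g y \<partial>lborel)"
proof -
  note ee = conv_exponents[OF e]
  have [measurable]: "k \<in> borel_measurable borel" "f \<in> borel_measurable borel" "g \<in> borel_measurable borel"
    using k lpspaceD(1)[OF f] lpspaceD(1)[OF g] by auto
  let ?F = "\<lambda>x y. k (x - y) * f y * g x"
  let ?k = "\<lambda>x. complex_of_real (norm (k x))" and ?f = "\<lambda>x. complex_of_real (norm (f x))"
  note w = weak_Young[OF e _ _ k(3) lpspace_norm[OF f], of ?k, unfolded weak_bound_norm, OF _ k(2)]
  have wi: "AE x in lborel. integrable lborel (\<lambda>y. ?k y * ?f (x - y))" and wl: "convolve ?k ?f \<in> lpspace lborel r"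
    using w(1,2) by simp_all
  have "integrable (lborel \<Otimes>\<^sub>M lborel) (\<lambda>(x, y). ?F x y)"
  proof (rule lborel_pair.Fubini_integrable)
    have "(\<integral>y. norm (?F x y) \<partial>lborel) = norm (convolve ?k ?f x * g x)" for x
    proof -
      have "(\<integral>y. norm (?F x y) \<partial>lborel) = (\<integral>y. norm (k (x - y)) * norm (f y) \<partial>lborel) * norm (g x)"
        by (simp add: norm_mult)
      moreover have "convolve ?k ?f x = complex_of_real (\<integral>y. norm (k (x - y)) * norm (f y) \<partial>lborel)"
      proof -
        have "convolve ?k ?f x = (\<integral>y. complex_of_real (norm (k (x - y)) * norm (f y)) \<partial>lborel)"
          unfolding convolve_def using integral_reflect[of "\<lambda>y. complex_of_real (norm (k (x - y)) * norm (f y))" x] by simp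
        then show ?thesis by (simp only: integral_complex_of_real)
      qed
      ultimately show ?thesis by (simp add: norm_mult integral_nonneg_AE)
    qed
    then show "integrable lborel (\<lambda>x. \<integral>y. norm (case (x, y) of (x, y) \<Rightarrow> ?F x y) \<partial>lborel)"
      using integrable_norm[OF Holder_ineq(1)[OF wl g _ ee(3)]] e by simp
    show "AE x in lborel. integrable lborel (\<lambda>y. case (x, y) of (x, y) \<Rightarrow> ?F x y)"
      using wi
    proof eventually_elim
      case (elim x)
      then have "integrable lborel (\<lambda>y. norm (?k y * ?f (x - y)))" by (rule integrable_norm)
      then have "integrable lborel (\<lambda>y. norm (k (x - y) * f y))"
        using integrable_reflect[of "\<lambda>y. norm (k (x - y) * f y)" x] by (simp add: norm_mult)
      then have "integrable lborel (\<lambda>y. k (x - y) * f y)"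
        by (rule integrable_norm_cancel) measurable
      then show ?case by simp
    qed
  qed measurable
  from lborel_pair.Fubini_integral[OF this]
  have "(\<integral>y. (\<integral>x. ?F x y \<partial>lborel) \<partial>lborel) = (\<integral>x. (\<integral>y. ?F x y \<partial>lborel) \<partial>lborel)" .
  moreover have "(\<integral>y. ?F x y \<partial>lborel) = convolve k f x * g x" for x
    unfolding convolve_def using integral_reflect[of "\<lambda>y. k (x - y) * f y" x] by simp
  moreover have "(\<integral>x. ?F x y \<partial>lborel) = f y * convolve (\<lambda>z. k (- z)) g y" for y
  proof -
    have "(\<integral>x. ?F x y \<partial>lborel) = (\<integral>x. f y * (k (x - y) * g x) \<partial>lborel)" by (simp add: mult_ac)
    also have "\<dots> = f y * (\<integral>x. k (x - y) * g x \<partial>lborel)" by simp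
    also have "(\<integral>x. k (x - y) * g x \<partial>lborel) = convolve (\<lambda>z. k (- z)) g y"
      unfolding convolve_def using integral_reflect[of "\<lambda>x. k (x - y) * g x" y] by simp
    finally show ?thesis .
  qed
  ultimately show ?thesis by (simp only:)
qed

section \<open>Kernels approximable by bounded ones, and the improvement step\<close>

text \<open>Up to a constant, \<open>dual_map t \<circ> u\<close> is the function that attains equality in Hoelder's inequality with
  \<open>u \<in> L\<^sub>t\<close>. Writing it with \<open>sgn\<close> makes it continuous at 0 for all \<open>t > 1\<close>.\<close>

definition dual_map :: "real \<Rightarrow> complex \<Rightarrow> complex" where
  "dual_map t z = cnj (sgn z) * of_real (norm z powr (t - 1))"

lemma norm_dual_map: "norm (dual_map t z) = norm z powr (t - 1)"
  by (simp add: dual_map_def norm_mult norm_sgn)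

lemma mult_dual_map: "z * dual_map t z = of_real (norm z powr t)"
proof (cases "z = 0")
  case False
  have "z * cnj (sgn z) = of_real (norm z)"
    using False complex_norm_square[of z] by (simp add: sgn_div_norm scaleR_conv_of_real power2_eq_square field_simps)
  then have "z * dual_map t z = of_real (norm z * norm z powr (t - 1))"
    by (simp add: dual_map_def mult.assoc[symmetric])
  also have "norm z * norm z powr (t - 1) = norm z powr t"
    using False powr_add[of "norm z" 1 "t - 1"] by simp
  finally show ?thesis .
qed simp

lemma dual_map_measurable [measurable]: "dual_map t \<in> borel_measurable borel"
proof -
  have [measurable]: "cnj \<in> borel_measurable borel"
    by (intro borel_measurable_continuous_onI continuous_intros)
  show ?thesis unfolding dual_map_def[abs_def] sgn_div_norm by measurable
qed

lemma tendsto_dual_map: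
  assumes "(u \<longlongrightarrow> z) F" "1 < t"
  shows "((\<lambda>x. dual_map t (u x)) \<longlongrightarrow> dual_map t z) F"
proof (cases "z = 0")
  case True
  have "((\<lambda>x. norm (u x)) \<longlongrightarrow> 0) F" using tendsto_norm[OF assms(1)] True by simp
  then have "((\<lambda>x. norm (u x) powr (t - 1)) \<longlongrightarrow> 0) F"
    using assms(2) by (intro tendsto_zero_powrI[where b = "t - 1"]) auto
  then have "((\<lambda>x. norm (dual_map t (u x))) \<longlongrightarrow> 0) F" by (simp add: norm_dual_map)
  then show ?thesis using True by (simp add: tendsto_norm_zero_iff dual_map_def)
next
  case False
  then show ?thesis unfolding dual_map_def
    by (intro tendsto_intros assms(1) tendsto_sgn) auto
qed

lemma lpspace_dual_map:
  assumes "u \<in> lpspace M t" "1 < t" "1 / t + 1 / t' = 1"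
  shows "(\<lambda>x. dual_map t (u x)) \<in> lpspace M t'" "lpint M t' (\<lambda>x. dual_map t (u x)) = lpint M t u"
proof -
  have "1 < t'" by (rule conj_exponent_gt_1[OF assms(2,3)])
  then have "(t - 1) * t' = t" using assms by (simp add: field_simps)
  then have "norm (dual_map t z) powr t' = norm z powr t" for z by (simp add: norm_dual_map powr_powr)
  moreover have "(\<lambda>x. dual_map t (u x)) \<in> borel_measurable M"
    using lpspaceD(1)[OF assms(1)] by measurable
  ultimately show "(\<lambda>x. dual_map t (u x)) \<in> lpspace M t'" "lpint M t' (\<lambda>x. dual_map t (u x)) = lpint M t u"
    using lpspaceD(2)[OF assms(1)] by (simp_all add: lpspace_def lpint_def)
qed

lemma integral_mult_dual_map: "(\<integral>x. u x * dual_map t (u x) \<partial>M) = of_real (lpint M t u)"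
  by (simp add: mult_dual_map lpint_def integral_complex_of_real)

lemma convolve_scale: "convolve k (\<lambda>x. c * f x) x = c * convolve k f x"
proof -
  have "convolve k (\<lambda>x. c * f x) x = (\<integral>y. c * (k y * f (x - y)) \<partial>lborel)" unfolding convolve_def by (simp add: mult_ac)
  then show ?thesis by (simp add: convolve_def)
qed

lemma convolve_shift: "convolve k (\<lambda>y. f (y + a)) x = convolve k f (x + a)"
  by (simp add: convolve_def algebra_simps)

lemma lpspace_shift:
  fixes f :: "'a::euclidean_space \<Rightarrow> complex"
  assumes "f \<in> lpspace lborel p"
  shows "(\<lambda>y. f (y + a)) \<in> lpspace lborel p" "lpint lborel p (\<lambda>y. f (y + a)) = lpint lborel p f"
proof -
  have [measurable]: "f \<in> borel_measurable borel" using lpspaceD(1)[OF assms] by simp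
  have d: "lborel = distr lborel borel (\<lambda>y :: 'a. y + a)" 
  proof -
    have "(\<lambda>y :: 'a. y + a) = (+) a" by (rule ext) (rule add.commute)
    then show ?thesis using lborel_distr_plus[of a] by simp
  qed
  have "integrable (distr lborel borel (\<lambda>y. y + a)) (\<lambda>y. norm (f y) powr p)"
    using lpspaceD(2)[OF assms] by (simp flip: d)
  then have "integrable lborel (\<lambda>y. norm (f (y + a)) powr p)"
    by (subst (asm) integrable_distr_eq) auto
  then show "(\<lambda>y. f (y + a)) \<in> lpspace lborel p" by (simp add: lpspace_def)
  show "lpint lborel p (\<lambda>y. f (y + a)) = lpint lborel p f"
    unfolding lpint_def by (subst (2) d) (simp add: integral_distr)
qed

text \<open>One step of the power iteration for the operator. The function \<open>g\<close> is normalized so that its adjoint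
  convolution has norm 1; then the new function also has norm 1 and depends continuously on that
  convolution. The bound on \<open>g\<close> keeps a sequence of such functions bounded as long as the image of \<open>f\<close> stays
  away from 0.\<close>

lemma improvement:
  fixes k f :: "'a::euclidean_space \<Rightarrow> complex"
  assumes e: "1 < p" "p < r" "1 / p + 1 / q = 1 + 1 / r"
    and k: "k \<in> borel_measurable borel" "weak_bound q A k" "0 < A"
    and f: "f \<in> lpspace lborel p" "lpint lborel p f = 1" and pos: "0 < lpint lborel r (convolve k f)"
  defines "s \<equiv> r / (r - 1)" and "p' \<equiv> p / (p - 1)"
  obtains g where "g \<in> lpspace lborel s" "lpint lborel s g \<le> lpint lborel r (convolve k f) powr (1 - s)"
    "(\<lambda>x. dual_map p' (convolve (\<lambda>z. k (- z)) g x)) \<in> lpspace lborel p"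
    "lpint lborel p (\<lambda>x. dual_map p' (convolve (\<lambda>z. k (- z)) g x)) = 1"
    "lpint lborel r (convolve k f) \<le> lpint lborel r (convolve k (\<lambda>x. dual_map p' (convolve (\<lambda>z. k (- z)) g x)))"
proof -
  note ee = conv_exponents[OF e, folded s_def p'_def]
  define h where "h = convolve k f"
  define a where "a = lpint lborel r h"
  have a: "0 < a" using pos by (simp add: a_def h_def)
  let ?k = "\<lambda>z. k (- z)"
  have k': "?k \<in> borel_measurable borel" "weak_bound q A ?k"
    using k(1) weak_bound_reflect[OF k(1,2), of 0] by auto
  have h: "h \<in> lpspace lborel r" unfolding h_def by (rule weak_Young(2)[OF e k f(1)])
  define g0 where "g0 x = dual_map r (h x)" for x
  have g0: "g0 \<in> lpspace lborel s" "lpint lborel s g0 = a"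
    unfolding g0_def a_def using lpspace_dual_map[OF h _ ee(3)] e by auto
  define u0 where "u0 = convolve ?k g0"
  have u0: "u0 \<in> lpspace lborel p'"
    unfolding u0_def by (rule weak_Young(2)[OF ee(2,5,8) k' k(3) g0(1)])
  define b where "b = lpint lborel p' u0"
  have "complex_of_real a = (\<integral>x. h x * g0 x \<partial>lborel)"
    unfolding g0_def a_def by (rule integral_mult_dual_map[symmetric])
  also have "\<dots> = (\<integral>x. f x * u0 x \<partial>lborel)"
    unfolding h_def u0_def using convolve_adjoint[OF e k f(1)] g0(1) by (simp add: s_def)
  finally have "a \<le> norm (\<integral>x. f x * u0 x \<partial>lborel)" using a by (metis abs_of_pos norm_of_real order_refl)
  also have "\<dots> \<le> lpint lborel p f powr (1 / p) * b powr (1 / p')"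
    unfolding b_def by (rule Holder_ineq(3)[OF f(1) u0 e(1) ee(6)])
  finally have ab: "a \<le> b powr (1 / p')" using f(2) by simp
  then have b: "0 < b" using a by (cases "b = 0") (auto simp: b_def order_less_le)
  \<comment> \<open>Normalizes the adjoint convolution of \<open>c g0\<close>.\<close>
  define c where "c = b powr (- 1 / p')"
  have c: "0 < c" using b by (simp add: c_def)
  have cb: "c powr p' * b = 1"
  proof -
    have "c powr p' = b powr (- 1)" using ee(7) by (simp add: c_def powr_powr)
    then show ?thesis using b by (simp add: powr_minus_divide)
  qed
  have ca: "c powr s \<le> a powr (- s)"
  proof -
    have "a powr s \<le> (b powr (1 / p')) powr s" using ab a ee(2) by (intro powr_mono2) auto
    then have "inverse ((b powr (1 / p')) powr s) \<le> inverse (a powr s)" using a by (intro le_imp_inverse_le) auto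
    also have "inverse ((b powr (1 / p')) powr s) = c powr s"
      unfolding c_def powr_powr powr_minus[symmetric] by simp
    finally show ?thesis by (simp add: powr_minus)
  qed
  define g where "g x = of_real c * g0 x" for x
  have g: "g \<in> lpspace lborel s" "lpint lborel s g = c powr s * a"
    unfolding g_def using lpspace_scale[OF g0(1), of "of_real c"] g0(2) c by auto
  have gle: "lpint lborel s g \<le> a powr (1 - s)"
  proof -
    have "c powr s * a \<le> a powr (- s) * a" using ca a by (intro mult_right_mono) auto
    also have "\<dots> = a powr (1 - s)" using a powr_add[of a "-s" 1] by simp
    finally show ?thesis using g(2) by simp
  qed
  define u where "u = convolve ?k g"
  have ux: "u x = of_real c * u0 x" for x
    unfolding u_def u0_def g_def by (rule convolve_scale)
  have u: "u \<in> lpspace lborel p'" "lpint lborel p' u = 1"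
  proof -
    have "u = (\<lambda>x. of_real c * u0 x)" using ux by auto
    then show "u \<in> lpspace lborel p'" "lpint lborel p' u = 1"
      using lpspace_scale[OF u0, of "of_real c"] c cb by (auto simp: b_def)
  qed
  define F where "F x = dual_map p' (u x)" for x
  have F: "F \<in> lpspace lborel p" "lpint lborel p F = 1"
    using lpspace_dual_map[OF u(1) ee(7), of p] ee(6) u(2) unfolding F_def by (auto simp: add.commute)
  have hF: "convolve k F \<in> lpspace lborel r" by (rule weak_Young(2)[OF e k F(1)])
  have "complex_of_real 1 = (\<integral>x. u x * F x \<partial>lborel)"
    unfolding F_def integral_mult_dual_map u(2) ..
  also have "\<dots> = (\<integral>x. convolve k F x * g x \<partial>lborel)"
    unfolding u_def using convolve_adjoint[OF e k F(1)] g(1) by (simp add: s_def mult.commute)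
  finally have "1 = norm (\<integral>x. convolve k F x * g x \<partial>lborel)" by (metis norm_one of_real_1)
  also have "\<dots> \<le> lpint lborel r (convolve k F) powr (1 / r) * lpint lborel s g powr (1 / s)"
    using e by (intro Holder_ineq(3)[OF hF g(1) _ ee(3)]) auto
  also have "\<dots> \<le> lpint lborel r (convolve k F) powr (1 / r) * (a powr (1 - s)) powr (1 / s)"
    using gle ee(2) by (intro mult_left_mono powr_mono2) auto
  also have "(a powr (1 - s)) powr (1 / s) = a powr (- 1 / r)"
  proof -
    have "(1 - s) * (1 / s) = - 1 / r" using ee(2,3) by (simp add: field_simps)
    then show ?thesis by (simp add: powr_powr)
  qed
  finally have "1 \<le> lpint lborel r (convolve k F) powr (1 / r) * a powr (- 1 / r)" .
  then have "a powr (1 / r) \<le> lpint lborel r (convolve k F) powr (1 / r)"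
    using a by (simp add: powr_minus_divide field_simps)
  then have "(a powr (1 / r)) powr r \<le> (lpint lborel r (convolve k F) powr (1 / r)) powr r"
    by (rule powr_mono2[rotated 2]) (use e in auto)
  then have "a \<le> lpint lborel r (convolve k F)" using a e by (simp add: powr_powr)
  with g(1) gle F show ?thesis
    by (intro that[of g]) (simp_all add: F_def[abs_def] u_def a_def h_def)
qed

text \<open>Such kernels lie in every \<open>L\<^sub>t\<close>: their convolutions are pairings at each point and map into a range of
  Lebesgue spaces.\<close>

definition bounded_fin_support :: "('a::euclidean_space \<Rightarrow> complex) \<Rightarrow> bool" where
  "bounded_fin_support k \<longleftrightarrow> k \<in> borel_measurable borel \<and> (\<exists>M. \<forall>x. norm (k x) \<le> M) \<and> emeasure lborel {x. k x \<noteq> 0} < \<infinity>"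

text \<open>The closure of the bounded kernels with support of finite measure in weak \<open>L\<^sub>q\<close>.\<close>

definition approximable :: "real \<Rightarrow> ('a::euclidean_space \<Rightarrow> complex) \<Rightarrow> bool" where
  "approximable q k \<longleftrightarrow> k \<in> borel_measurable borel \<and> (\<exists>A>0. weak_bound q A k) \<and>
     (\<forall>\<epsilon>>0. \<exists>k'. bounded_fin_support k' \<and> weak_bound q \<epsilon> (\<lambda>x. k x - k' x))"

lemma bounded_fin_support_reflect:
  assumes "bounded_fin_support k"
  shows "bounded_fin_support (\<lambda>y. k (x - y))"
proof -
  have [measurable]: "k \<in> borel_measurable borel" using assms by (simp add: bounded_fin_support_def)
  have "emeasure lborel {y. k (x - y) \<noteq> 0} = emeasure lborel {y. k y \<noteq> 0}"
    by (subst (2) distr_lborel_reflect[of x, symmetric]) (simp add: emeasure_distr vimage_def)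
  then show ?thesis using assms by (auto simp: bounded_fin_support_def)
qed

lemma approximable_reflect:
  assumes "approximable q k"
  shows "approximable q (\<lambda>z. k (- z))"
proof -
  have k [measurable]: "k \<in> borel_measurable borel" using assms by (simp add: approximable_def)
  have "\<exists>k'. bounded_fin_support k' \<and> weak_bound q \<epsilon> (\<lambda>z. k (- z) - k' z)" if eps: "0 < \<epsilon>" for \<epsilon>
  proof -
    obtain k' where k': "bounded_fin_support k'" "weak_bound q \<epsilon> (\<lambda>x. k x - k' x)"
      using assms eps by (auto simp: approximable_def)
    have [measurable]: "k' \<in> borel_measurable borel" using k'(1) by (simp add: bounded_fin_support_def)
    show ?thesis
      using bounded_fin_support_reflect[OF k'(1), of 0] weak_bound_reflect[OF _ k'(2), of 0]
      by (intro exI[of _ "\<lambda>z. k' (- z)"]) simp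
  qed
  moreover have "\<exists>A>0. weak_bound q A (\<lambda>z. k (- z))"
    using assms weak_bound_reflect[OF k, of q _ 0] by (auto simp: approximable_def)
  ultimately show ?thesis by (simp add: approximable_def)
qed

lemma lpspace_bounded_fin_support:
  assumes "bounded_fin_support k" "0 < t"
  shows "k \<in> lpspace lborel t"
proof -
  obtain M where [measurable]: "k \<in> borel_measurable borel" and M: "\<And>x. norm (k x) \<le> M" "emeasure lborel {x. k x \<noteq> 0} < \<infinity>"
    using assms by (auto simp: bounded_fin_support_def)
  have ind: "(\<lambda>x. indicator {x. k x \<noteq> 0} x :: complex) \<in> lpspace lborel t"
    using M assms(2) by (intro lpspace_indicator) auto
  show ?thesis
    by (rule lpspace_dominated(1)[OF _ lpspace_scale(1)[OF ind, of "of_real M"]])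
       (use assms(2) M(1) in \<open>auto simp: indicator_def norm_mult intro!: AE_I2 order_trans[OF M(1)]\<close>)
qed

lemma weak_bound_bounded_fin_support:
  assumes "bounded_fin_support k" "0 < t"
  shows "\<exists>A>0. weak_bound t A k"
proof -
  obtain M where [measurable]: "k \<in> borel_measurable borel" and M: "\<And>x. norm (k x) \<le> M" "emeasure lborel {x. k x \<noteq> 0} < \<infinity>"
    using assms by (auto simp: bounded_fin_support_def)
  obtain m where m: "0 \<le> m" "emeasure lborel {x. k x \<noteq> 0} = ennreal m"
    using M(2) by (cases "emeasure lborel {x. k x \<noteq> 0}") auto
  have M0: "0 \<le> M" using M(1)[of 0] norm_ge_zero order_trans by blast
  have "emeasure lborel {x. l < norm (k x)} \<le> ennreal ((M powr t * m + 1) * l powr (- t))" if l: "0 < l" for l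
  proof (cases "l < M")
    case True
    have "emeasure lborel {x. l < norm (k x)} \<le> ennreal m"
      unfolding m(2)[symmetric] using l by (intro emeasure_mono) auto
    also have "m * 1 \<le> m * (M powr t * l powr (- t))"
    proof (rule mult_left_mono)
      have "1 \<le> (M / l) powr t" using True l assms(2) by (intro ge_one_powr_ge_zero) auto
      then show "1 \<le> M powr t * l powr (- t)" using l M0 by (simp add: powr_divide powr_minus_divide)
    qed (use m in auto)
    then have "m \<le> (M powr t * m + 1) * l powr (- t)"
      by (simp only: distrib_right mult_1) (simp add: mult_ac add_increasing2)
    then have "ennreal m \<le> ennreal ((M powr t * m + 1) * l powr (- t))" by (rule ennreal_leI)
    finally show ?thesis .
  next
    case False
    then have "{x. l < norm (k x)} = {}" using M(1) by (auto simp: not_less dest: order_trans)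
    then show ?thesis by simp
  qed
  then show ?thesis
    using m by (intro exI[of _ "M powr t * m + 1"]) (auto simp: weak_bound_def add_nonneg_pos)
qed

lemma convolve_as_pairing:
  assumes [measurable]: "k \<in> borel_measurable borel" "f \<in> borel_measurable borel"
  shows "convolve k f x = (\<integral>y. k (x - y) * f y \<partial>lborel)"
  unfolding convolve_def using integral_reflect[of "\<lambda>y. k (x - y) * f y" x] by simp

lemma AE_convolve_diff:
  fixes k f g :: "'a::euclidean_space \<Rightarrow> complex"
  assumes e: "1 < p" "p < r" "1 / p + 1 / q = 1 + 1 / r"
    and k: "k \<in> borel_measurable borel" "weak_bound q A k" "0 < A"
    and f: "f \<in> lpspace lborel p" "g \<in> lpspace lborel p"
  shows "AE x in lborel. convolve k (\<lambda>x. f x - g x) x = convolve k f x - convolve k g x"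
  using weak_Young(1)[OF e k f(1)] weak_Young(1)[OF e k f(2)]
  by eventually_elim (simp add: convolve_def right_diff_distrib)

lemma AE_convolve_kernel_diff:
  fixes k f :: "'a::euclidean_space \<Rightarrow> complex"
  assumes e: "1 < p" "p < r" "1 / p + 1 / q = 1 + 1 / r"
    and k: "k \<in> borel_measurable borel" "weak_bound q A k" "0 < A"
    and k': "k' \<in> borel_measurable borel" "weak_bound q A' k'" "0 < A'"
    and f: "f \<in> lpspace lborel p"
  shows "AE x in lborel. convolve (\<lambda>x. k x - k' x) f x = convolve k f x - convolve k' f x"
  using weak_Young(1)[OF e k f] weak_Young(1)[OF e k' f]
  by eventually_elim (simp add: convolve_def left_diff_distrib)

text \<open>The approximation is uniform on each ball of \<open>L\<^sub>p\<close>.\<close>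

lemma approximable_operator:
  fixes k :: "'a::euclidean_space \<Rightarrow> complex"
  assumes e: "1 < p" "p < r" "1 / p + 1 / q = 1 + 1 / r"
    and k: "approximable q k" and \<epsilon>: "0 < \<epsilon>"
  obtains k' where "bounded_fin_support k'"
    "\<forall>f \<in> lpspace lborel p. lpint lborel p f \<le> B \<longrightarrow>
       (\<lambda>x. convolve k f x - convolve k' f x) \<in> lpspace lborel r \<and> lpint lborel r (\<lambda>x. convolve k f x - convolve k' f x) \<le> \<epsilon>"
proof -
  obtain A where km: "k \<in> borel_measurable borel" and A: "0 < A" "weak_bound q A k"
    using k by (auto simp: approximable_def)
  note ee = conv_exponents[OF e]
  define C where "C = weak_Young_const p q r"
  have C: "0 < C" unfolding C_def by (rule weak_Young_const_pos[OF e])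
  define D where "D = (\<bar>B\<bar> + 1) powr (r / p)"
  have D: "0 < D" by (auto simp: D_def)
  \<comment> \<open>Solves \<open>(C \<eta>\<^bsup>1/q\<^esup>)\<^sup>r D = \<epsilon>\<close>, the bound of the weak Young inequality for a kernel of size \<open>\<eta>\<close>.\<close>
  define \<eta> where "\<eta> = ((\<epsilon> / D) powr (1 / r) / C) powr q"
  have \<eta>: "0 < \<eta>" using \<epsilon> D C by (simp add: \<eta>_def)
  have \<eta>': "(C * \<eta> powr (1 / q)) powr r * D = \<epsilon>"
    using \<epsilon> D C ee(1) e by (simp add: \<eta>_def powr_powr)
  obtain k' where k': "bounded_fin_support k'" "weak_bound q \<eta> (\<lambda>x. k x - k' x)"
    using k \<eta> by (auto simp: approximable_def)
  have k'm: "k' \<in> borel_measurable borel" using k'(1) by (simp add: bounded_fin_support_def)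
  obtain A' where A': "0 < A'" "weak_bound q A' k'"
    using weak_bound_bounded_fin_support[OF k'(1), of q] ee(1) by auto
  have dm: "(\<lambda>x. k x - k' x) \<in> borel_measurable borel" using km k'm by simp
  have main: "(\<lambda>x. convolve k f x - convolve k' f x) \<in> lpspace lborel r \<and> lpint lborel r (\<lambda>x. convolve k f x - convolve k' f x) \<le> \<epsilon>"
    if f: "f \<in> lpspace lborel p" "lpint lborel p f \<le> B" for f
  proof -
    have [measurable]: "f \<in> borel_measurable borel" "k \<in> borel_measurable borel" "k' \<in> borel_measurable borel"
      using lpspaceD(1)[OF f(1)] km k'm by auto
    note ae = AE_convolve_kernel_diff[OF e km A(2,1) k'm A'(2,1) f(1)]
    note w = weak_Young[OF e dm k'(2) \<eta> f(1)]
    have "(\<lambda>x. convolve k f x - convolve k' f x) \<in> lpspace lborel r"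
      by (rule lpspace_dominated(1)[OF _ w(2)]) (use e ae in auto)
    moreover have "lpint lborel r (\<lambda>x. convolve k f x - convolve k' f x) = lpint lborel r (convolve (\<lambda>x. k x - k' x) f)"
      using ae by (intro lpint_cong_AE) auto
    moreover have "lpint lborel r (convolve (\<lambda>x. k x - k' x) f) \<le> (C * \<eta> powr (1 / q)) powr r * D"
    proof -
      have "lpint lborel p f powr (r / p) \<le> D"
        unfolding D_def using f(2) e by (intro powr_mono2) auto
      then show ?thesis using w(3) unfolding C_def by (meson mult_left_mono order_trans powr_ge_zero)
    qed
    ultimately show ?thesis using \<eta>' by simp
  qed
  show ?thesis by (rule that[OF k'(1)]) (use main in auto)
qed

section \<open>Existence of a maximizer\<close>

text \<open>The kernel is in weak \<open>L\<^sub>q\<close> for every positive \<open>q\<close>, in particular for the one that maps \<open>L\<^sub>p\<close> to \<open>L\<^sub>t\<close> with \<open>p < t < r\<close>. If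
  the image were below \<open>\<delta>\<close> everywhere, then \<open>|u|\<^sup>r \<le> \<delta>\<^bsup>r-t\<^esup> |u|\<^sup>t\<close> would make its \<open>L\<^sub>r\<close> norm too small.\<close>

lemma nonvanishing:
  fixes k :: "'a::euclidean_space \<Rightarrow> complex"
  assumes k: "bounded_fin_support k" and e: "1 < p" "p < r" and c: "0 < c"
  obtains \<delta> where "0 < \<delta>"
    "\<forall>f \<in> lpspace lborel p. lpint lborel p f = 1 \<longrightarrow> c \<le> lpint lborel r (convolve k f) \<longrightarrow>
      convolve k f \<in> lpspace lborel r \<longrightarrow> (\<exists>x. \<delta> \<le> norm (convolve k f x))"
proof -
  \<comment> \<open>Any exponent strictly between \<open>p\<close> and \<open>r\<close> would do.\<close>
  define t where "t = (p + r) / 2"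
  define q where "q = 1 / (1 + 1 / t - 1 / p)"
  have pt: "p < t" "t < r" using e by (auto simp: t_def)
  then have ept: "1 < p" "p < t" "1 / p + 1 / q = 1 + 1 / t" using e by (auto simp: q_def)
  have q: "1 < q" by (rule conv_exponents(1)[OF ept])
  obtain A where A: "0 < A" "weak_bound q A k"
    using weak_bound_bounded_fin_support[OF k, of q] q by auto
  have km [measurable]: "k \<in> borel_measurable borel" using k by (simp add: bounded_fin_support_def)
  define B where "B = (weak_Young_const p q t * A powr (1 / q)) powr t + 1"
  have B: "0 < B" by (auto simp: B_def add_nonneg_pos)
  define \<delta> where "\<delta> = (c / (2 * B)) powr (1 / (r - t))"
  have \<delta>: "0 < \<delta>" using c B by (simp add: \<delta>_def)
  have \<delta>B: "\<delta> powr (r - t) * B = c / 2" using c B pt by (simp add: \<delta>_def powr_powr)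
  have "\<exists>x. \<delta> \<le> norm (convolve k f x)"
    if f: "f \<in> lpspace lborel p" "lpint lborel p f = 1" "c \<le> lpint lborel r (convolve k f)" "convolve k f \<in> lpspace lborel r" for f
  proof (rule ccontr)
    assume "\<not> (\<exists>x. \<delta> \<le> norm (convolve k f x))"
    then have lt: "norm (convolve k f x) < \<delta>" for x by (auto simp: not_le)
    note w = weak_Young[OF ept km A(2,1) f(1)]
    have pt: "norm (convolve k f x) powr r \<le> \<delta> powr (r - t) * norm (convolve k f x) powr t" for x
    proof (cases "convolve k f x = 0")
      case False
      have "norm (convolve k f x) powr r = norm (convolve k f x) powr (r - t) * norm (convolve k f x) powr t"
        using False by (simp flip: powr_add)
      also have "\<dots> \<le> \<delta> powr (r - t) * norm (convolve k f x) powr t"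
        using lt[of x] pt by (intro mult_right_mono powr_mono2) auto
      finally show ?thesis .
    qed (use e in simp)
    have "lpint lborel r (convolve k f) \<le> (\<integral>x. \<delta> powr (r - t) * norm (convolve k f x) powr t \<partial>lborel)"
      unfolding lpint_def using lpspaceD(2)[OF f(4)] lpspaceD(2)[OF w(2)] by (intro integral_mono pt) auto
    also have "\<dots> = \<delta> powr (r - t) * lpint lborel t (convolve k f)" by (simp add: lpint_def)
    also have "\<dots> \<le> \<delta> powr (r - t) * B"
      using w(3) f(2) by (intro mult_left_mono) (auto simp: B_def)
    finally show False using f(3) \<delta>B c by simp
  qed
  with \<delta> show ?thesis by (intro that[of \<delta>]) auto
qed

text \<open>For a truncated kernel the value at a point is a pairing with a fixed function, hence converges along
  a weakly convergent subsequence; the truncation error is uniform in the sequence.\<close>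

lemma convolve_AE_compact:
  fixes k :: "'a::euclidean_space \<Rightarrow> complex"
  assumes e: "1 < p" "p < r" "1 / p + 1 / q = 1 + 1 / r" and k: "approximable q k"
    and f: "\<And>j. f j \<in> lpspace lborel p" "\<And>j. lpint lborel p (f j) \<le> B"
  obtains \<sigma> v where "strict_mono (\<sigma> :: nat \<Rightarrow> nat)" "v \<in> borel_measurable borel"
    "AE x in lborel. (\<lambda>j. convolve k (f (\<sigma> j)) x) \<longlonglongrightarrow> v x"
proof -
  note ee = conv_exponents[OF e]
  obtain \<tau> where \<tau>: "strict_mono \<tau>"
    "\<forall>\<phi> \<in> lpspace lborel (p / (p - 1)). convergent (\<lambda>j. \<integral>x. \<phi> x * f (\<tau> j) x \<partial>lborel)"
    by (rule weak_sequential_compactness[OF f e(1) ee(6)])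
  have km: "k \<in> borel_measurable borel" using k by (simp add: approximable_def)
  have fm: "f j \<in> borel_measurable borel" for j using lpspaceD(1)[OF f(1)] by simp
  obtain \<sigma> v where \<sigma>: "strict_mono \<sigma>" "v \<in> borel_measurable lborel"
    "AE x in lborel. (\<lambda>j. convolve k (f (\<tau> (\<sigma> j))) x) \<longlonglongrightarrow> v x"
  proof (rule lborel.AE_convergent_subseq[where p = r and u = "\<lambda>j. convolve k (f (\<tau> j))"])
    show "convolve k (f (\<tau> j)) \<in> borel_measurable lborel" for j using km fm by simp
    fix \<epsilon> :: real assume "0 < \<epsilon>"
    obtain k' where k': "bounded_fin_support k'"
      "\<forall>f \<in> lpspace lborel p. lpint lborel p f \<le> B \<longrightarrow>
         (\<lambda>x. convolve k f x - convolve k' f x) \<in> lpspace lborel r \<and> lpint lborel r (\<lambda>x. convolve k f x - convolve k' f x) \<le> \<epsilon>"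
      by (rule approximable_operator[OF e k \<open>0 < \<epsilon>\<close>, of B])
    have k'm: "k' \<in> borel_measurable borel" using k'(1) by (simp add: bounded_fin_support_def)
    show "\<exists>a. (\<forall>j. a j \<in> borel_measurable lborel \<and> (\<lambda>x. convolve k (f (\<tau> j)) x - a j x) \<in> lpspace lborel r
        \<and> lpint lborel r (\<lambda>x. convolve k (f (\<tau> j)) x - a j x) \<le> \<epsilon>) \<and> (\<forall>x. convergent (\<lambda>j. a j x))"
    proof (intro exI[of _ "\<lambda>j. convolve k' (f (\<tau> j))"] conjI allI)
      show "convolve k' (f (\<tau> j)) \<in> borel_measurable lborel" for j using k'm fm by simp
      show "convergent (\<lambda>j. convolve k' (f (\<tau> j)) x)" for x
        unfolding convolve_as_pairing[OF k'm fm]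
        using ee(7) by (intro \<tau>(2)[rule_format] lpspace_bounded_fin_support bounded_fin_support_reflect k'(1)) auto
    qed (use k'(2) f in auto)
  qed (use e in auto)
  show ?thesis
    by (rule that[of "\<tau> \<circ> \<sigma>" v]) (use \<sigma> \<tau>(1) in \<open>auto intro: strict_mono_o\<close>)
qed

lemma unit_norm_function:
  assumes "0 < p"
  shows "(\<lambda>x :: 'a::euclidean_space. indicator (box 0 One) x :: complex) \<in> lpspace lborel p"
    "lpint lborel p (\<lambda>x :: 'a. indicator (box 0 One) x :: complex) = 1"
proof -
  have fin: "emeasure lborel (box 0 One :: 'a set) < \<infinity>" by (metis emeasure_lborel_box_finite)
  show "(\<lambda>x :: 'a. indicator (box 0 One) x :: complex) \<in> lpspace lborel p"
    "lpint lborel p (\<lambda>x :: 'a. indicator (box 0 One) x :: complex) = 1"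
    using lpspace_indicator[of "box 0 One :: 'a set" lborel p] fin assms by (auto simp: measure_lborel_box_eq)
qed

text \<open>The argument outlined at the beginning, for Borel functions.\<close>

theorem convolve_has_maximizer:
  fixes k :: "'a::euclidean_space \<Rightarrow> complex"
  assumes e: "1 < p" "p < r" "1 / p + 1 / q = 1 + 1 / r" and k: "approximable q k"
  shows "\<exists>F \<in> lpspace lborel p. lpint lborel p F = 1 \<and>
    (\<forall>f \<in> lpspace lborel p. lpint lborel p f \<le> 1 \<longrightarrow> lpint lborel r (convolve k f) \<le> lpint lborel r (convolve k F))"
proof -
  note ee = conv_exponents[OF e]
  define s where "s = r / (r - 1)"
  define p' where "p' = p / (p - 1)"
  obtain A where A: "0 < A" "weak_bound q A k" and km [measurable]: "k \<in> borel_measurable borel"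
    using k by (auto simp: approximable_def)
  note WY = weak_Young[OF e km A(2,1)]
  define V where "V = {lpint lborel r (convolve k f) |f. f \<in> lpspace lborel p \<and> lpint lborel p f = 1}"
  have V_bdd: "bdd_above V"
    using WY(3) by (intro bdd_aboveI[of _ "(weak_Young_const p q r * A powr (1 / q)) powr r"])
       (fastforce simp: V_def)
  have V_ne: "V \<noteq> {}"
    using unit_norm_function[of p, where 'a = 'a] e unfolding V_def by fastforce
  define S where "S = Sup V"
  have S_upper: "lpint lborel r (convolve k f) \<le> S" if "f \<in> lpspace lborel p" "lpint lborel p f = 1" for f
    unfolding S_def using that V_bdd by (intro cSup_upper) (auto simp: V_def)
  have S0: "0 \<le> S"
    using S_upper[OF unit_norm_function] e order_trans[OF lpint_nonneg] by fastforce
  \<comment> \<open>The bound \<open>S\<close> on the unit sphere, extended to all functions by scaling.\<close>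
  have homog: "lpint lborel r (convolve k f) \<le> S * lpint lborel p f powr (r / p)" if f: "f \<in> lpspace lborel p" for f
  proof (cases "lpint lborel p f = 0")
    case True
    then show ?thesis using WY(3)[OF f] e by simp
  next
    case False
    define n where "n = lpint lborel p f"
    have n: "0 < n" using False by (simp add: n_def order_less_le)
    define c where "c = n powr (- 1 / p)"
    have "c powr p = n powr (- 1)" "c powr r = n powr (- (r / p))"
      unfolding c_def powr_powr using e by simp_all
    then have c: "0 < c" "c powr p = 1 / n" "c powr r = n powr (- (r / p))"
      using n by (simp_all add: c_def powr_minus_divide)
    have "(\<lambda>x. of_real c * f x) \<in> lpspace lborel p" "lpint lborel p (\<lambda>x. of_real c * f x) = 1"
      using lpspace_scale[OF f, of "of_real c"] c n by (auto simp: n_def)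
    then have "lpint lborel r (convolve k (\<lambda>x. of_real c * f x)) \<le> S" by (rule S_upper)
    moreover have "lpint lborel r (convolve k (\<lambda>x. of_real c * f x)) = c powr r * lpint lborel r (convolve k f)"
    proof -
      have "convolve k (\<lambda>x. of_real c * f x) = (\<lambda>x. of_real c * convolve k f x)" by (rule ext) (rule convolve_scale)
      then show ?thesis using lpspace_scale(2)[OF WY(2)[OF f], of "of_real c"] c by simp
    qed
    ultimately have "n powr (- (r / p)) * lpint lborel r (convolve k f) \<le> S" using c by simp
    then show ?thesis using n by (simp add: powr_minus_divide n_def divide_le_eq)
  qed
  have suffices: "\<exists>F \<in> lpspace lborel p. lpint lborel p F = 1 \<and>
    (\<forall>f \<in> lpspace lborel p. lpint lborel p f \<le> 1 \<longrightarrow> lpint lborel r (convolve k f) \<le> lpint lborel r (convolve k F))"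
    if F: "F \<in> lpspace lborel p" "lpint lborel p F = 1" "S \<le> lpint lborel r (convolve k F)" for F
  proof (intro bexI[of _ F] conjI ballI impI)
    fix f :: "'a \<Rightarrow> complex" assume f: "f \<in> lpspace lborel p" "lpint lborel p f \<le> 1"
    have "lpint lborel p f powr (r / p) \<le> 1" using f(2) e by (intro powr_le1) auto
    then have "S * lpint lborel p f powr (r / p) \<le> S" using S0 mult_left_mono by fastforce
    then show "lpint lborel r (convolve k f) \<le> lpint lborel r (convolve k F)" using homog[OF f(1)] F(3) by linarith
  qed (use F in auto)
  show ?thesis
  proof (cases "S = 0")
    case True
    have "0 < p" using e by simp
    from suffices[OF unit_norm_function[OF this]] show ?thesis using True by simp
  next
    case False
    then have S: "0 < S" using S0 by simp
    have "\<exists>f. f \<in> lpspace lborel p \<and> lpint lborel p f = 1 \<and> max (S / 2) (S - 1 / real (Suc j)) < lpint lborel r (convolve k f)" for j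
    proof -
      have "max (S / 2) (S - 1 / real (Suc j)) < Sup V" using S by (simp add: S_def[symmetric])
      then obtain v where "v \<in> V" "max (S / 2) (S - 1 / real (Suc j)) < v" using V_ne by (metis less_cSupD)
      then show ?thesis by (auto simp: V_def)
    qed
    then obtain h where h: "\<And>j. h j \<in> lpspace lborel p" "\<And>j. lpint lborel p (h j) = 1"
      "\<And>j. max (S / 2) (S - 1 / real (Suc j)) < lpint lborel r (convolve k (h j))" by metis
    let ?k = "\<lambda>z. k (- z)"
    define T where "T g = (\<lambda>x. dual_map p' (convolve ?k g x))" for g
    have "\<exists>g. g \<in> lpspace lborel s \<and> lpint lborel s g \<le> (S / 2) powr (1 - s) \<and>
      T g \<in> lpspace lborel p \<and> lpint lborel p (T g) = 1 \<and>
      max (S / 2) (S - 1 / real (Suc j)) < lpint lborel r (convolve k (T g))" for j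
    proof -
      have pos: "S / 2 < lpint lborel r (convolve k (h j))" using h(3)[of j] by simp
      then have "0 < lpint lborel r (convolve k (h j))" using S by linarith
      then obtain g where g: "g \<in> lpspace lborel s" "lpint lborel s g \<le> lpint lborel r (convolve k (h j)) powr (1 - s)"
        "T g \<in> lpspace lborel p" "lpint lborel p (T g) = 1" "lpint lborel r (convolve k (h j)) \<le> lpint lborel r (convolve k (T g))"
        using improvement[OF e km A(2,1) h(1,2)] unfolding T_def s_def p'_def by blast
      have "lpint lborel r (convolve k (h j)) powr (1 - s) \<le> (S / 2) powr (1 - s)"
        using pos S ee(2) by (intro powr_mono2') (auto simp: s_def)
      then show ?thesis using g h(3)[of j] by (intro exI[of _ g]) auto
    qed
    then obtain g where g: "\<And>j. g j \<in> lpspace lborel s" "\<And>j. lpint lborel s (g j) \<le> (S / 2) powr (1 - s)"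
      "\<And>j. T (g j) \<in> lpspace lborel p" "\<And>j. lpint lborel p (T (g j)) = 1"
      "\<And>j. max (S / 2) (S - 1 / real (Suc j)) < lpint lborel r (convolve k (T (g j)))" by metis
    \<comment> \<open>A truncation so close to \<open>k\<close> that it keeps a fixed part of the images, which all exceed \<open>S / 2\<close>.\<close>
    define \<epsilon>\<^sub>0 where "\<epsilon>\<^sub>0 = S / (4 * 2 powr r)"
    have \<epsilon>\<^sub>0: "0 < \<epsilon>\<^sub>0" using S by (simp add: \<epsilon>\<^sub>0_def)
    obtain k\<^sub>0 where k\<^sub>0: "bounded_fin_support k\<^sub>0"
      "\<forall>f \<in> lpspace lborel p. lpint lborel p f \<le> 1 \<longrightarrow>
         (\<lambda>x. convolve k f x - convolve k\<^sub>0 f x) \<in> lpspace lborel r \<and> lpint lborel r (\<lambda>x. convolve k f x - convolve k\<^sub>0 f x) \<le> \<epsilon>\<^sub>0"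
      by (rule approximable_operator[OF e k \<epsilon>\<^sub>0, of 1])
    have k\<^sub>0m [measurable]: "k\<^sub>0 \<in> borel_measurable borel" using k\<^sub>0(1) by (simp add: bounded_fin_support_def)
    obtain \<delta> where \<delta>: "0 < \<delta>"
      "\<forall>f \<in> lpspace lborel p. lpint lborel p f = 1 \<longrightarrow> \<epsilon>\<^sub>0 \<le> lpint lborel r (convolve k\<^sub>0 f) \<longrightarrow>
        convolve k\<^sub>0 f \<in> lpspace lborel r \<longrightarrow> (\<exists>x. \<delta> \<le> norm (convolve k\<^sub>0 f x))"
      by (rule nonvanishing[OF k\<^sub>0(1) e(1,2) \<epsilon>\<^sub>0])
    have "\<exists>x. \<delta> \<le> norm (convolve k\<^sub>0 (T (g j)) x)" for j
    proof (rule \<delta>(2)[rule_format, OF g(3,4)])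
      have one: "lpint lborel p (T (g j)) \<le> 1" using g(4) by simp
      have d: "(\<lambda>x. convolve k (T (g j)) x - convolve k\<^sub>0 (T (g j)) x) \<in> lpspace lborel r"
        "lpint lborel r (\<lambda>x. convolve k (T (g j)) x - convolve k\<^sub>0 (T (g j)) x) \<le> \<epsilon>\<^sub>0"
        using k\<^sub>0(2) g(3) one by auto
      note w = WY(2)[OF g(3)[of j]]
      have r0: "0 \<le> r" using e by simp
      have "(\<lambda>x. convolve k (T (g j)) x - (convolve k (T (g j)) x - convolve k\<^sub>0 (T (g j)) x)) \<in> lpspace lborel r"
        by (rule lpspace_diff(1)[OF w d(1) r0])
      then show L: "convolve k\<^sub>0 (T (g j)) \<in> lpspace lborel r" by simp
      have "lpint lborel r (\<lambda>x. convolve k\<^sub>0 (T (g j)) x + (convolve k (T (g j)) x - convolve k\<^sub>0 (T (g j)) x))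
        \<le> 2 powr r * (lpint lborel r (convolve k\<^sub>0 (T (g j))) + lpint lborel r (\<lambda>x. convolve k (T (g j)) x - convolve k\<^sub>0 (T (g j)) x))"
        by (rule lpspace_add(2)[OF L d(1) r0])
      also have "\<dots> \<le> 2 powr r * (lpint lborel r (convolve k\<^sub>0 (T (g j))) + \<epsilon>\<^sub>0)"
        by (intro mult_left_mono add_left_mono d(2)) simp
      finally have "S / 2 < 2 powr r * (lpint lborel r (convolve k\<^sub>0 (T (g j))) + \<epsilon>\<^sub>0)"
        using g(5)[of j] by simp
      also have "S / 2 = 2 powr r * (\<epsilon>\<^sub>0 + \<epsilon>\<^sub>0)" by (simp add: \<epsilon>\<^sub>0_def)
      finally show "\<epsilon>\<^sub>0 \<le> lpint lborel r (convolve k\<^sub>0 (T (g j)))" by simp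
    qed
    then obtain x\<^sub>0 where x\<^sub>0: "\<And>j. \<delta> \<le> norm (convolve k\<^sub>0 (T (g j)) (x\<^sub>0 j))" by metis
    \<comment> \<open>Translating \<open>g\<^sub>j\<close> translates the maximizing sequence, since the adjoint convolution and the
      dual map commute with translations.\<close>
    define g' where "g' j = (\<lambda>y. g j (y + x\<^sub>0 j))" for j
    have g': "g' j \<in> lpspace lborel s" "lpint lborel s (g' j) \<le> (S / 2) powr (1 - s)" for j
      using lpspace_shift[OF g(1)] g(2) by (auto simp: g'_def)
    have Tg': "T (g' j) = (\<lambda>y. T (g j) (y + x\<^sub>0 j))" for j
      by (simp add: T_def g'_def convolve_shift)
    obtain \<sigma> v where \<sigma>: "strict_mono \<sigma>" "v \<in> borel_measurable borel"
      "AE x in lborel. (\<lambda>j. convolve ?k (g' (\<sigma> j)) x) \<longlonglongrightarrow> v x"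
      by (rule convolve_AE_compact[OF ee(2,5,8)[folded s_def] approximable_reflect[OF k] g'])
    define f where "f j = T (g' (\<sigma> j))" for j
    define G where "G x = dual_map p' (v x)" for x
    have f: "f j \<in> lpspace lborel p" "lpint lborel p (f j) = 1" "lpint lborel p (f j) \<le> 1" for j
      using lpspace_shift[OF g(3)] g(4) by (auto simp: f_def Tg')
    have fv: "convolve k' (f j) x = convolve k' (T (g (\<sigma> j))) (x + x\<^sub>0 (\<sigma> j))" for k' j x
      by (simp add: f_def Tg' convolve_shift)
    have f\<delta>: "\<delta> \<le> norm (convolve k\<^sub>0 (f j) 0)" for j using x\<^sub>0 by (simp add: fv)
    have fS: "S - 1 / real (Suc j) \<le> lpint lborel r (convolve k (f j))" for j
    proof -
      have "convolve k (f j) = (\<lambda>x. convolve k (T (g (\<sigma> j))) (x + x\<^sub>0 (\<sigma> j)))" by (rule ext) (rule fv)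
      then have "lpint lborel r (convolve k (f j)) = lpint lborel r (convolve k (T (g (\<sigma> j))))"
        using lpspace_shift(2)[OF WY(2)[OF g(3)]] by simp
      moreover have "S - 1 / real (Suc (\<sigma> j)) < lpint lborel r (convolve k (T (g (\<sigma> j))))" using g(5)[of "\<sigma> j"] by simp
      moreover have "1 / real (Suc (\<sigma> j)) \<le> 1 / real (Suc j)"
        using strict_mono_imp_increasing[OF \<sigma>(1), of j] by (intro divide_left_mono) auto
      ultimately show ?thesis by linarith
    qed
    have Gm [measurable]: "G \<in> borel_measurable borel" unfolding G_def[abs_def] using \<sigma>(2) by measurable
    have fG: "AE x in lborel. (\<lambda>j. f j x) \<longlonglongrightarrow> G x"
      using \<sigma>(3)
    proof eventually_elim
      case (elim x)
      then show ?case unfolding f_def T_def G_def using ee(7) by (intro tendsto_dual_map) (auto simp: p'_def)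
    qed
    have G: "G \<in> lpspace lborel p" "lpint lborel p G \<le> 1"
      using lpspace_AE_limit[OF f(1,3) _ fG] e by auto
    define \<alpha> where "\<alpha> = lpint lborel p G"
    have fm: "f j \<in> borel_measurable borel" for j using lpspaceD(1)[OF f(1)] by simp
    have weak: "(\<lambda>j. convolve k' (f j) x) \<longlonglongrightarrow> convolve k' G x" if "bounded_fin_support k'" for k' x
    proof -
      have k'm: "k' \<in> borel_measurable borel" using that by (simp add: bounded_fin_support_def)
      show ?thesis
        unfolding convolve_as_pairing[OF k'm fm] convolve_as_pairing[OF k'm Gm]
        using ee(7) by (intro weak_limit_of_AE_limit[OF f(1) G(1) f(3) _ e(1) ee(6) fG]
            lpspace_bounded_fin_support bounded_fin_support_reflect that) auto
    qed
    \<comment> \<open>The truncated convolutions of \<open>f\<^sub>j\<close> have modulus at least \<open>\<delta>\<close> at the origin and converge there to that of \<open>G\<close>.\<close>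
    have "\<alpha> \<noteq> 0"
    proof
      assume "\<alpha> = 0"
      then have ae: "AE x in lborel. G x = 0" using lpint_eq_0_iff[OF G(1)] by (simp add: \<alpha>_def)
      have "convolve k\<^sub>0 G 0 = (\<integral>y. 0 \<partial>(lborel :: 'a measure))"
        unfolding convolve_as_pairing[OF k\<^sub>0m Gm] by (rule integral_cong_AE) (use ae in auto)
      moreover have "\<delta> \<le> norm (convolve k\<^sub>0 G 0)"
        by (rule tendsto_lowerbound[OF tendsto_norm[OF weak[OF k\<^sub>0(1)]]]) (use f\<delta> in auto)
      ultimately show False using \<delta>(1) by simp
    qed
    then have \<alpha>: "0 < \<alpha>" "\<alpha> \<le> 1" using G(2) by (auto simp: \<alpha>_def order_less_le)
    define d where "d j = (\<lambda>x. f j x - G x)" for j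
    have d: "d j \<in> lpspace lborel p" "lpint lborel p (d j) \<le> 2 powr p * 2" for j
    proof -
      have p0: "0 \<le> p" using e by simp
      show "d j \<in> lpspace lborel p" unfolding d_def by (rule lpspace_diff(1)[OF f(1) G(1) p0])
      have "lpint lborel p (d j) \<le> 2 powr p * (lpint lborel p (f j) + lpint lborel p G)"
        unfolding d_def by (rule lpspace_diff(2)[OF f(1) G(1) p0])
      also have "\<dots> \<le> 2 powr p * 2" using f(2) G(2) by (intro mult_left_mono) auto
      finally show "lpint lborel p (d j) \<le> 2 powr p * 2" .
    qed
    have dm: "d j \<in> borel_measurable borel" for j using lpspaceD(1)[OF d(1)] by simp
    \<comment> \<open>The images of \<open>d\<^sub>j = f\<^sub>j - G\<close> under truncated kernels tend to 0 at every point, because \<open>f\<^sub>j\<close> tends to \<open>G\<close> weakly.\<close>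
    obtain \<tau> where \<tau>: "strict_mono \<tau>" "AE x in lborel. (\<lambda>j. convolve k (d (\<tau> j)) x) \<longlonglongrightarrow> 0"
    proof (rule lborel.AE_zero_subseq[where p = r and e = "\<lambda>j. convolve k (d j)"])
      show "convolve k (d j) \<in> borel_measurable lborel" for j using dm by simp
      fix \<epsilon> :: real assume "0 < \<epsilon>"
      obtain k' where k': "bounded_fin_support k'"
        "\<forall>f \<in> lpspace lborel p. lpint lborel p f \<le> 2 powr p * 2 \<longrightarrow>
           (\<lambda>x. convolve k f x - convolve k' f x) \<in> lpspace lborel r \<and> lpint lborel r (\<lambda>x. convolve k f x - convolve k' f x) \<le> \<epsilon>"
        by (rule approximable_operator[OF e k \<open>0 < \<epsilon>\<close>, of "2 powr p * 2"])
      have k'm: "k' \<in> borel_measurable borel" using k'(1) by (simp add: bounded_fin_support_def)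
      show "\<exists>a. (\<forall>j. a j \<in> borel_measurable lborel \<and> (\<lambda>x. convolve k (d j) x - a j x) \<in> lpspace lborel r
          \<and> lpint lborel r (\<lambda>x. convolve k (d j) x - a j x) \<le> \<epsilon>) \<and> (\<forall>x. (\<lambda>j. a j x) \<longlonglongrightarrow> 0)"
      proof (intro exI[of _ "\<lambda>j. convolve k' (d j)"] conjI allI)
        show "convolve k' (d j) \<in> borel_measurable lborel" for j using k'm dm by simp
        show "(\<lambda>j. convolve k' (d j) x) \<longlonglongrightarrow> 0" for x
        proof -
          have pair: "(\<lambda>y. k' (x - y)) \<in> lpspace lborel (p / (p - 1))"
            using ee(7) by (intro lpspace_bounded_fin_support bounded_fin_support_reflect k'(1)) auto
          have qp: "1 / (p / (p - 1)) + 1 / p = 1" using ee(6) by simp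
          have "convolve k' (d j) x = convolve k' (f j) x - convolve k' G x" for j
            unfolding convolve_as_pairing[OF k'm dm] convolve_as_pairing[OF k'm fm] convolve_as_pairing[OF k'm Gm]
            using Holder_ineq(1)[OF pair f(1) ee(7) qp] Holder_ineq(1)[OF pair G(1) ee(7) qp]
            by (simp add: d_def right_diff_distrib)
          then show ?thesis using LIM_zero[OF weak[OF k'(1)]] by simp
        qed
      qed (use k'(2) d in auto)
    qed (use e in auto)
    have AEd: "AE x in lborel. \<forall>j. convolve k (d j) x = convolve k (f j) x - convolve k G x"
      unfolding AE_all_countable d_def using AE_convolve_diff[OF e km A(2,1) f(1) G(1)] by blast
    have cvlim: "AE x in lborel. (\<lambda>j. convolve k (f (\<tau> j)) x) \<longlonglongrightarrow> convolve k G x"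
      using \<tau>(2) AEd by eventually_elim (simp add: LIM_zero_iff)
    have BL1: "(\<lambda>j. lpint lborel p (d (\<tau> j))) \<longlonglongrightarrow> 1 - \<alpha>"
    proof -
      have "AE x in lborel. (\<lambda>j. f (\<tau> j) x) \<longlonglongrightarrow> G x"
        using fG by eventually_elim (rule LIMSEQ_subseq_LIMSEQ[OF _ \<tau>(1), unfolded comp_def])
      from Brezis_Lieb[OF f(1) G(1) f(3) _ this] have "(\<lambda>j. 1 - lpint lborel p (d (\<tau> j))) \<longlonglongrightarrow> \<alpha>"
        using e by (simp add: f(2) d_def \<alpha>_def)
      then have "(\<lambda>j. 1 - (1 - lpint lborel p (d (\<tau> j)))) \<longlonglongrightarrow> 1 - \<alpha>" by (intro tendsto_diff tendsto_const)
      then show ?thesis by simp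
    qed
    have BL2: "(\<lambda>j. lpint lborel r (convolve k (f (\<tau> j))) - lpint lborel r (convolve k (d (\<tau> j)))) \<longlonglongrightarrow> lpint lborel r (convolve k G)"
    proof -
      have "(\<lambda>j. lpint lborel r (convolve k (f (\<tau> j))) - lpint lborel r (\<lambda>x. convolve k (f (\<tau> j)) x - convolve k G x)) \<longlonglongrightarrow> lpint lborel r (convolve k G)"
        using e f S_upper by (intro Brezis_Lieb[OF WY(2) WY(2) _ _ cvlim, where B = S] G) auto
      moreover have "lpint lborel r (\<lambda>x. convolve k (f (\<tau> j)) x - convolve k G x) = lpint lborel r (convolve k (d (\<tau> j)))" for j
        using AEd fm dm by (intro lpint_cong_AE) auto
      ultimately show ?thesis by simp
    qed
    \<comment> \<open>The images of \<open>d\<^sub>j\<close> take away at most \<open>S\<close> times the power \<open>r / p\<close> of the lost mass \<open>1 - \<alpha>\<close>.\<close>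
    have "S - S * (1 - \<alpha>) powr (r / p) \<le> lpint lborel r (convolve k G)"
    proof (rule LIMSEQ_le[OF _ BL2])
      have "(\<lambda>j. 1 / real (Suc (\<tau> j))) \<longlonglongrightarrow> 0"
        using LIMSEQ_subseq_LIMSEQ[OF LIMSEQ_inverse_real_of_nat \<tau>(1)] by (simp add: comp_def inverse_eq_divide)
      then have "(\<lambda>j. S - 1 / real (Suc (\<tau> j)) - S * lpint lborel p (d (\<tau> j)) powr (r / p))
        \<longlonglongrightarrow> S - 0 - S * (1 - \<alpha>) powr (r / p)"
        using e by (intro tendsto_diff tendsto_mult tendsto_const tendsto_powr'[OF BL1 tendsto_const]) auto
      then show "(\<lambda>j. S - 1 / real (Suc (\<tau> j)) - S * lpint lborel p (d (\<tau> j)) powr (r / p))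
        \<longlonglongrightarrow> S - S * (1 - \<alpha>) powr (r / p)" by simp
      show "\<exists>N. \<forall>j\<ge>N. S - 1 / real (Suc (\<tau> j)) - S * lpint lborel p (d (\<tau> j)) powr (r / p)
        \<le> lpint lborel r (convolve k (f (\<tau> j))) - lpint lborel r (convolve k (d (\<tau> j)))"
        by (intro exI[of _ 0] allI impI diff_mono fS homog d)
    qed
    moreover have "lpint lborel r (convolve k G) \<le> S * \<alpha> powr (r / p)"
      unfolding \<alpha>_def by (rule homog[OF G(1)])
    ultimately have "S * 1 \<le> S * (\<alpha> powr (r / p) + (1 - \<alpha>) powr (r / p))"
      and SG: "S - S * (1 - \<alpha>) powr (r / p) \<le> lpint lborel r (convolve k G)"
      by (simp_all add: distrib_left)
    then have ge1: "1 \<le> \<alpha> powr (r / p) + (1 - \<alpha>) powr (r / p)" using S by simp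
    have "\<alpha> = 1"
    proof (rule ccontr)
      assume "\<alpha> \<noteq> 1"
      then have a1: "\<alpha> < 1" using \<alpha> by simp
      have rp: "1 < r / p" using e by simp
      have "\<alpha> powr (r / p) < \<alpha> powr 1" using \<alpha> a1 rp by (intro powr_less_mono') auto
      moreover have "(1 - \<alpha>) powr (r / p) < (1 - \<alpha>) powr 1" using \<alpha> a1 rp by (intro powr_less_mono') auto
      ultimately show False using ge1 \<alpha> a1 by simp
    qed
    then show ?thesis using suffices[OF G(1)] SG by (simp add: \<alpha>_def)
  qed
qed

section \<open>Lebesgue measurable representatives and the spaces \<open>weak_L0\<close>\<close>

lemma lebesgue_borel_representative:
  fixes f :: "'a::euclidean_space \<Rightarrow> complex"
  assumes f: "f \<in> borel_measurable lebesgue"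
  obtains g where "g \<in> borel_measurable borel" "AE x in lborel. f x = g x"
proof -
  have m: "(\<lambda>x. Re (f x)) \<in> borel_measurable (completion lborel)" "(\<lambda>x. Im (f x)) \<in> borel_measurable (completion lborel)"
    using f by auto
  obtain u v where uv: "u \<in> borel_measurable lborel" "AE x in lborel. Re (f x) = u x"
    "v \<in> borel_measurable lborel" "AE x in lborel. Im (f x) = v x"
    using completion_ex_borel_measurable_real[OF m(1)] completion_ex_borel_measurable_real[OF m(2)] by blast
  note [measurable] = uv(1,3)
  have "AE x in lborel. f x = Complex (u x) (v x)"
    using uv(2,4) by eventually_elim (simp add: complex_eq_iff)
  moreover have "(\<lambda>x. Complex (u x) (v x)) \<in> borel_measurable borel"
    unfolding borel_measurable_complex_iff using uv by simp
  ultimately show ?thesis by (intro that)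
qed

text \<open>The completed measure makes every subset of a null set measurable.\<close>

lemma measurable_lebesgue_cong_AE:
  fixes f g :: "'a::euclidean_space \<Rightarrow> complex"
  assumes g: "g \<in> borel_measurable borel" and ae: "AE x in lborel. f x = g x"
  shows "f \<in> borel_measurable lebesgue"
proof (rule measurableI)
  fix B :: "complex set" assume B: "B \<in> sets borel"
  obtain N where N: "\<And>x. x \<in> space lborel - N \<Longrightarrow> f x = g x" "N \<in> null_sets lborel"
    by (rule AE_E3[OF ae]) blast
  have sub: "S \<in> sets lebesgue" if "S \<subseteq> N" for S
    using null_sets_completion_subset[OF that null_sets_completionI[OF N(2)]] by auto
  have "f -` B \<inter> space lebesgue = (g -` B - N) \<union> (f -` B \<inter> N)"
    using N(1) by auto
  moreover have "g -` B \<in> sets lborel" using measurable_sets_borel[OF g B] by simp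
  then have "g -` B - N \<in> sets lborel" using N(2) by (intro sets.Diff) auto
  then have "g -` B - N \<in> sets lebesgue" by (rule sets_completionI_sets)
  then have "(g -` B - N) \<union> (f -` B \<inter> N) \<in> sets lebesgue" using sub[of "f -` B \<inter> N"] by (intro sets.Un) auto
  ultimately show "f -` B \<inter> space lebesgue \<in> sets lebesgue" by (simp only:)
qed simp

lemma AE_lebesgue_iff: "(AE x in lebesgue. P x) \<longleftrightarrow> (AE x in lborel. P x)"
  by (rule AE_completion_iff)

lemma AE_lborel_reflect:
  assumes "AE y in lborel. P y"
  shows "AE y in lborel. P (x - y :: 'a::euclidean_space)"
proof (rule AE_distrD[of "\<lambda>y. x - y" lborel borel])
  show "AE y in distr lborel borel (\<lambda>y. x - y). P y" unfolding distr_lborel_reflect by fact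
qed measurable

lemma Lp_cong_lborel:
  fixes f g :: "'a::euclidean_space \<Rightarrow> complex"
  assumes g: "g \<in> borel_measurable borel" and ae: "AE x in lborel. f x = g x"
  shows "f \<in> Lp p \<longleftrightarrow> g \<in> lpspace lborel p" "Lp_norm p f = lpint lborel p g powr (1 / p)"
proof -
  have f: "f \<in> borel_measurable lebesgue" by (rule measurable_lebesgue_cong_AE[OF g ae])
  have g': "g \<in> borel_measurable lebesgue" using g by (simp add: measurable_completion)
  have ae': "AE x in lebesgue. norm (f x) powr p = norm (g x) powr p"
    unfolding AE_lebesgue_iff using ae by eventually_elim simp
  have gm: "(\<lambda>x. norm (g x) powr p) \<in> borel_measurable lborel" using g by simp
  have "integrable lebesgue (\<lambda>x. norm (f x) powr p) \<longleftrightarrow> integrable lebesgue (\<lambda>x. norm (g x) powr p)"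
    using f g' by (intro integrable_cong_AE ae') auto
  also have "\<dots> \<longleftrightarrow> integrable lborel (\<lambda>x. norm (g x) powr p)" by (rule integrable_completion[OF gm])
  finally show "f \<in> Lp p \<longleftrightarrow> g \<in> lpspace lborel p"
    using f g by (simp add: Lp_def lpspace_def)
  have "(\<integral>x. norm (f x) powr p \<partial>lebesgue) = (\<integral>x. norm (g x) powr p \<partial>lebesgue)"
    using f g' by (intro integral_cong_AE ae') auto
  also have "\<dots> = (\<integral>x. norm (g x) powr p \<partial>lborel)" by (rule integral_completion[OF gm])
  finally show "Lp_norm p f = lpint lborel p g powr (1 / p)" by (simp add: Lp_norm_def lpint_def)
qed

lemma Lp_borel_representative:
  fixes f :: "'a::euclidean_space \<Rightarrow> complex"
  assumes "f \<in> Lp p"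
  obtains g where "g \<in> lpspace lborel p" "AE x in lborel. f x = g x" "Lp_norm p f = lpint lborel p g powr (1 / p)"
proof -
  obtain g where g: "g \<in> borel_measurable borel" "AE x in lborel. f x = g x"
    using assms lebesgue_borel_representative[of f] by (auto simp: Lp_def)
  then show ?thesis using Lp_cong_lborel[OF g] assms by (intro that[of g]) auto
qed

lemma conv_regular_distr_eq_convolve:
  fixes k f :: "'a::euclidean_space \<Rightarrow> complex"
  assumes k': "k' \<in> borel_measurable borel" "AE x in lborel. k x = k' x"
    and f': "f' \<in> borel_measurable borel" "AE x in lborel. f x = f' x"
  shows "conv (regular_distr k) f x = convolve k' f' x"
proof -
  have ae: "AE y in lborel. k y * f (x - y) = k' y * f' (x - y)"
    using k'(2) AE_lborel_reflect[OF f'(2), of x] by eventually_elim simp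
  have m: "(\<lambda>y. k' y * f' (x - y)) \<in> borel_measurable borel" using k'(1) f'(1) by measurable
  have "conv (regular_distr k) f x = (\<integral>y. k y * f (x - y) \<partial>lebesgue)"
    by (simp add: conv_def regular_distr_def)
  also have "\<dots> = (\<integral>y. k' y * f' (x - y) \<partial>lebesgue)"
    using measurable_lebesgue_cong_AE[OF m ae] m ae
    by (intro integral_cong_AE) (auto simp: AE_lebesgue_iff measurable_completion)
  also have "\<dots> = (\<integral>y. k' y * f' (x - y) \<partial>lborel)"
    using m by (intro integral_completion) simp
  finally show ?thesis by (simp add: convolve_def)
qed

lemma distr_fun_eq:
  fixes k :: "'a::euclidean_space \<Rightarrow> complex"
  assumes [measurable]: "k' \<in> borel_measurable borel" and ae: "AE x in lborel. k x = k' x"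
  shows "distr_fun k s = emeasure lborel {x. s < norm (k' x)}"
proof -
  have [measurable]: "k \<in> borel_measurable lebesgue" by (rule measurable_lebesgue_cong_AE[OF assms])
  have [measurable]: "k' \<in> borel_measurable lebesgue" by (simp add: measurable_completion)
  have "distr_fun k s = emeasure lebesgue {x \<in> space lebesgue. s < norm (k x)}" by (simp add: distr_fun_def)
  also have "\<dots> = emeasure lebesgue {x \<in> space lebesgue. s < norm (k' x)}"
  proof (rule emeasure_eq_AE)
    show "AE x in lebesgue. (x \<in> {x \<in> space lebesgue. s < norm (k x)}) = (x \<in> {x \<in> space lebesgue. s < norm (k' x)})"
      unfolding AE_lebesgue_iff using ae by eventually_elim simp
  qed measurable
  also have "\<dots> = emeasure lborel {x. s < norm (k' x)}" by simp
  finally show ?thesis .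
qed

text \<open>The rearrangement is a generalized inverse of the distribution function.\<close>

lemma le_decr_rearr:
  fixes k :: "'a::euclidean_space \<Rightarrow> complex"
  assumes k: "k \<in> borel_measurable lebesgue" and "ennreal t < distr_fun k l" "0 < l"
  shows "ennreal l \<le> decr_rearr k t"
  unfolding decr_rearr_def
proof (rule Inf_greatest, safe)
  fix s :: real assume s: "0 < s" "distr_fun k s \<le> ennreal t"
  show "ennreal l \<le> ennreal s"
  proof (rule ennreal_leI, rule ccontr)
    assume "\<not> l \<le> s"
    moreover have "{x \<in> space lebesgue. s < norm (k x)} \<in> sets lebesgue" using k by measurable
    ultimately have "distr_fun k l \<le> distr_fun k s"
      unfolding distr_fun_def by (intro emeasure_mono) auto
    then show False using s(2) assms(2) by (meson leD le_less_trans order_trans)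
  qed
qed

text \<open>A bound \<open>\<eta>\<close> for \<open>t powr (1 / q) * decr_rearr k t\<close> just above the critical \<open>t = (\<eta> / l) powr q\<close> already
  bounds the distribution function at \<open>l\<close>: if it exceeded the critical value, some \<open>t\<close> in between would
  violate the bound. Only a right neighbourhood of the critical value is involved, which makes the lemma fit
  the global bound and both limits.\<close>

lemma distr_fun_le:
  fixes k :: "'a::euclidean_space \<Rightarrow> complex"
  assumes k: "k \<in> borel_measurable lebesgue" and l: "0 < l" and q: "0 < q" and \<eta>: "0 \<le> \<eta>"
    and b: "\<eta> powr q * l powr (- q) < b"
    and R: "\<And>t. \<eta> powr q * l powr (- q) < t \<Longrightarrow> t < b \<Longrightarrow> ennreal (t powr (1 / q)) * decr_rearr k t \<le> ennreal \<eta>"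
  shows "distr_fun k l \<le> ennreal (\<eta> powr q * l powr (- q))"
proof (rule ccontr)
  assume "\<not> distr_fun k l \<le> ennreal (\<eta> powr q * l powr (- q))"
  moreover have "0 < b" by (rule le_less_trans[OF _ b]) simp
  ultimately have lt: "ennreal (\<eta> powr q * l powr (- q)) < min (distr_fun k l) (ennreal b)"
    using b by (simp add: not_le ennreal_less_iff)
  obtain y where y: "ennreal (\<eta> powr q * l powr (- q)) < y" "y < distr_fun k l" "y < ennreal b"
    using dense[OF lt] by auto
  obtain t where t: "0 \<le> t" "y = ennreal t" using y(3) by (cases y) auto
  have t1: "\<eta> powr q * l powr (- q) < t" using y(1) t by (simp add: ennreal_less_iff)
  have t2: "t < b" using y(3) t by (simp add: ennreal_less_iff)
  have t0: "0 < t" by (rule le_less_trans[OF _ t1]) simp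
  have "ennreal (t powr (1 / q) * l) \<le> ennreal (t powr (1 / q)) * decr_rearr k t"
    using le_decr_rearr[OF k _ l, of t] y(2) t l by (simp add: ennreal_mult mult_left_mono)
  also have "\<dots> \<le> ennreal \<eta>" by (rule R[OF t1 t2])
  finally have "t powr (1 / q) * l \<le> \<eta>" using \<eta> by simp
  then have "t powr (1 / q) \<le> \<eta> / l" using l by (simp add: field_simps)
  then have "(t powr (1 / q)) powr q \<le> (\<eta> / l) powr q" using q by (intro powr_mono2) auto
  then have "t \<le> \<eta> powr q * l powr (- q)"
    using t0 q l \<eta> by (simp add: powr_powr powr_divide powr_minus_divide)
  then show False using t1 by simp
qed

text \<open>Large levels \<open>l\<close> correspond to small \<open>t\<close> and small levels to large \<open>t\<close>. So the two limits in \<open>weak_L0\<close> say that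
  \<open>l powr q\<close> times the distribution function is small for large and for small \<open>l\<close>, and these are the parts
  which the truncation to \<open>{m < |k| \<le> M}\<close> removes.\<close>

lemma weak_L0_approximable:
  fixes k :: "'a::euclidean_space \<Rightarrow> complex"
  assumes k: "k \<in> weak_L0 q" and q: "0 < q"
    and k' [measurable]: "k' \<in> borel_measurable borel" and ae: "AE x in lborel. k x = k' x"
  shows "approximable q k'"
proof -
  have km: "k \<in> borel_measurable lebesgue" and wn: "weak_norm q k < \<infinity>"
    and lim0: "((\<lambda>t. ennreal (t powr (1 / q)) * decr_rearr k t) \<longlongrightarrow> 0) (at_right 0)"
    and lim1: "((\<lambda>t. ennreal (t powr (1 / q)) * decr_rearr k t) \<longlongrightarrow> 0) at_top"
    using k by (auto simp: weak_L0_def weak_L_def)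
  define d where "d l = emeasure lborel {x. l < norm (k' x)}" for l
  have d: "distr_fun k l = d l" for l unfolding d_def by (rule distr_fun_eq[OF k' ae])
  have bound: "\<exists>A>0. weak_bound q A k'"
  proof -
    obtain w where w: "0 \<le> w" "weak_norm q k = ennreal w" using wn by (cases "weak_norm q k") auto
    have "d l \<le> ennreal ((w powr q + 1) * l powr (- q))" if l: "0 < l" for l
    proof -
      have "d l \<le> ennreal (w powr q * l powr (- q))"
        unfolding d[symmetric]
      proof (rule distr_fun_le[OF km l q w(1), where b = "w powr q * l powr (- q) + 1"])
        fix t assume "w powr q * l powr (- q) < t"
        moreover have "0 \<le> w powr q * l powr (- q)" by simp
        ultimately have "0 < t" by linarith
        then show "ennreal (t powr (1 / q)) * decr_rearr k t \<le> ennreal w"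
          unfolding w(2)[symmetric] weak_norm_def by (intro SUP_upper) simp
      qed simp
      also have "\<dots> \<le> ennreal ((w powr q + 1) * l powr (- q))"
        by (intro ennreal_leI mult_right_mono) auto
      finally show ?thesis .
    qed
    then show ?thesis
      by (intro exI[of _ "w powr q + 1"]) (auto simp: weak_bound_def d_def add_nonneg_pos)
  qed
  have "\<exists>k''. bounded_fin_support k'' \<and> weak_bound q \<epsilon> (\<lambda>x. k' x - k'' x)" if \<epsilon>: "0 < \<epsilon>" for \<epsilon>
  proof -
    define \<eta> where "\<eta> = (\<epsilon> / 2) powr (1 / q)"
    have \<eta>: "0 < \<eta>" "\<eta> powr q = \<epsilon> / 2" using \<epsilon> q by (auto simp: \<eta>_def powr_powr)
    have "\<forall>\<^sub>F t in at_right 0. ennreal (t powr (1 / q)) * decr_rearr k t < ennreal \<eta>"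
      using \<eta> by (intro order_tendstoD(2)[OF lim0]) auto
    then obtain t0 where t0: "0 < t0" "\<And>t. 0 < t \<Longrightarrow> t < t0 \<Longrightarrow> ennreal (t powr (1 / q)) * decr_rearr k t < ennreal \<eta>"
      using eventually_at_right[of 0 "1::real"] by auto
    have "\<forall>\<^sub>F t in at_top. ennreal (t powr (1 / q)) * decr_rearr k t < ennreal \<eta>"
      using \<eta> by (intro order_tendstoD(2)[OF lim1]) auto
    then obtain t1 where t1: "\<And>t. t1 \<le> t \<Longrightarrow> ennreal (t powr (1 / q)) * decr_rearr k t < ennreal \<eta>"
      by (auto simp: eventually_at_top_linorder)
    have "((\<lambda>l::real. \<epsilon> / 2 * l powr (- q)) \<longlongrightarrow> \<epsilon> / 2 * 0) at_top"
      using q by (intro tendsto_mult tendsto_const tendsto_neg_powr filterlim_ident) auto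
    then have "\<forall>\<^sub>F l in at_top. \<epsilon> / 2 * l powr (- q) < t0" using t0 by (intro order_tendstoD(2)) auto
    then obtain M where M: "0 < M" "\<epsilon> / 2 * M powr (- q) < t0"
      using eventually_conj[OF _ eventually_gt_at_top[of "0::real"]] by (metis (mono_tags, lifting) eventually_at_top_linorder order_refl)
    have large: "d l \<le> ennreal (\<epsilon> / 2 * l powr (- q))" if "M \<le> l" for l
      unfolding d[symmetric] \<eta>(2)[symmetric]
    proof (rule distr_fun_le[OF km _ q, where b = t0])
      have "l powr (- q) \<le> M powr (- q)" using M that q by (intro powr_mono2') auto
      then have "\<epsilon> / 2 * l powr (- q) \<le> \<epsilon> / 2 * M powr (- q)" using \<epsilon> by (intro mult_left_mono) auto
      then show "\<eta> powr q * l powr (- q) < t0" unfolding \<eta>(2) using M(2) by linarith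
      fix t assume "\<eta> powr q * l powr (- q) < t" "t < t0"
      moreover have "0 \<le> \<eta> powr q * l powr (- q)" by simp
      ultimately have "0 < t" by linarith
      then show "ennreal (t powr (1 / q)) * decr_rearr k t \<le> ennreal \<eta>" using t0(2) \<open>t < t0\<close> by (intro less_imp_le)
    qed (use M that \<eta> in auto)
    define m where "m = (\<epsilon> / 2 / (\<bar>t1\<bar> + 1)) powr (1 / q)"
    have m: "0 < m" using \<epsilon> by (simp add: m_def)
    have small: "d l \<le> ennreal (\<epsilon> / 2 * l powr (- q))" if "0 < l" "l \<le> m" for l
      unfolding d[symmetric] \<eta>(2)[symmetric]
    proof (rule distr_fun_le[OF km _ q, where b = "\<eta> powr q * l powr (- q) + 1"])
      fix t assume t: "\<eta> powr q * l powr (- q) < t"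
      have "m powr (- q) \<le> l powr (- q)" using that q by (intro powr_mono2') auto
      moreover have "m powr (- q) = (\<bar>t1\<bar> + 1) / (\<epsilon> / 2)"
        using \<epsilon> q by (simp add: m_def powr_powr powr_minus_divide powr_divide)
      ultimately have "\<epsilon> / 2 * ((\<bar>t1\<bar> + 1) / (\<epsilon> / 2)) \<le> \<epsilon> / 2 * l powr (- q)"
        using \<epsilon> by (intro mult_left_mono) auto
      then have "t1 \<le> t" using t \<epsilon> unfolding \<eta>(2) by simp
      then show "ennreal (t powr (1 / q)) * decr_rearr k t \<le> ennreal \<eta>" using t1 by (intro less_imp_le)
    qed (use that \<eta> in auto)
    \<comment> \<open>The two discarded parts contribute \<open>\<epsilon> / 2\<close> each.\<close>
    define k'' where "k'' x = (if m < norm (k' x) \<and> norm (k' x) \<le> M then k' x else 0)" for x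
    have [measurable]: "k'' \<in> borel_measurable borel" unfolding k''_def[abs_def] by measurable
    have "bounded_fin_support k''"
      unfolding bounded_fin_support_def
    proof (intro conjI)
      show "\<exists>M. \<forall>x. norm (k'' x) \<le> M" using M by (intro exI[of _ M]) (auto simp: k''_def)
      have "emeasure lborel {x. k'' x \<noteq> 0} \<le> d m"
        unfolding d_def by (intro emeasure_mono) (auto simp: k''_def)
      also have "\<dots> \<le> ennreal (\<epsilon> / 2 * m powr (- q))" using m by (intro small) auto
      finally show "emeasure lborel {x. k'' x \<noteq> 0} < \<infinity>" by (simp add: le_less_trans)
    qed simp
    moreover have "weak_bound q \<epsilon> (\<lambda>x. k' x - k'' x)"
      unfolding weak_bound_def
    proof (intro allI impI)
      fix l :: real assume l: "0 < l"
      have diff: "norm (k' x - k'' x) = (if m < norm (k' x) \<and> norm (k' x) \<le> M then 0 else norm (k' x))" for x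
        by (simp add: k''_def)
      have le: "ennreal (\<epsilon> / 2 * l powr (- q)) \<le> ennreal (\<epsilon> * l powr (- q))"
        using \<epsilon> by (intro ennreal_leI mult_right_mono) auto
      show "emeasure lborel {x. l < norm (k' x - k'' x)} \<le> ennreal (\<epsilon> * l powr (- q))"
      proof (cases "M \<le> l")
        case True
        have "emeasure lborel {x. l < norm (k' x - k'' x)} \<le> d l"
          unfolding d_def using l by (intro emeasure_mono) (auto simp: diff split: if_splits)
        also note large[OF True]
        also note le
        finally show ?thesis .
      next
        case False
        have dM: "d M \<le> ennreal (\<epsilon> / 2 * l powr (- q))"
        proof -
          have "d M \<le> ennreal (\<epsilon> / 2 * M powr (- q))" by (rule large) simp
          also have "\<dots> \<le> ennreal (\<epsilon> / 2 * l powr (- q))"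
            using \<epsilon> False l q by (intro ennreal_leI mult_left_mono powr_mono2') auto
          finally show ?thesis .
        qed
        show ?thesis
        proof (cases "l < m")
          case True
          have "emeasure lborel {x. l < norm (k' x - k'' x)} \<le> emeasure lborel ({x. l < norm (k' x)} \<union> {x. M < norm (k' x)})"
            using l by (intro emeasure_mono) (auto simp: diff split: if_splits)
          also have "\<dots> \<le> d l + d M" unfolding d_def by (intro emeasure_subadditive) auto
          also have "\<dots> \<le> ennreal (\<epsilon> / 2 * l powr (- q)) + ennreal (\<epsilon> / 2 * l powr (- q))"
            using True l by (intro add_mono small dM) auto
          also have "\<dots> = ennreal (\<epsilon> * l powr (- q))"
            using \<epsilon> by (subst ennreal_plus[symmetric]) auto
          finally show ?thesis .
        next
          case ml: False
          have "emeasure lborel {x. l < norm (k' x - k'' x)} \<le> d M"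
            unfolding d_def using ml l by (intro emeasure_mono) (auto simp: diff split: if_splits)
          also note dM
          also note le
          finally show ?thesis .
        qed
      qed
    qed
    ultimately show ?thesis by blast
  qed
  with bound show ?thesis by (simp add: approximable_def)
qed

section \<open>Schwartz functions\<close>

text \<open>Sum over the balls of integer radius \<open>j + 1\<close>, whose volume is of order \<open>(j + 1) ^ DIM('a)\<close>; the
  exponent exceeds the dimension by 2 to leave the convergent series of inverse squares.\<close>

lemma integrable_inverse_one_plus_norm_power:
  "integrable lborel (\<lambda>x :: 'a::euclidean_space. 1 / (1 + norm x) ^ (DIM('a) + 2))"
proof (rule integrableI_bounded)
  let ?n = "DIM('a)"
  define V where "V = unit_ball_vol (real ?n)"
  have V: "0 \<le> V" by (simp add: V_def)
  have cancel: "1 / z ^ (?n + 2) * (V * z ^ ?n) = V * (1 / z ^ 2)" if "0 < z" for z :: real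
    using that by (simp add: power_add power2_eq_square field_simps)
  have [measurable]: "ball (0 :: 'a) \<rho> \<in> sets borel" for \<rho> by simp
  have "(\<integral>\<^sup>+x. ennreal (norm (1 / (1 + norm (x :: 'a)) ^ (?n + 2))) \<partial>lborel)
    \<le> (\<integral>\<^sup>+x. (\<Sum>j. ennreal (1 / real (Suc j) ^ (?n + 2)) * indicator (ball 0 (real (Suc j))) (x :: 'a)) \<partial>lborel)"
  proof (rule nn_integral_mono)
    fix x :: 'a
    define j where "j = nat \<lfloor>norm x\<rfloor>"
    have j: "real j \<le> norm x" "norm x < real (Suc j)" by (simp_all add: j_def) linarith
    have "norm (1 / (1 + norm x) ^ (?n + 2)) \<le> 1 / real (Suc j) ^ (?n + 2)"
      using j by (auto intro!: divide_left_mono power_mono mult_pos_pos zero_less_power simp del: power_Suc simp: add_pos_nonneg)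
    then have "ennreal (norm (1 / (1 + norm x) ^ (?n + 2)))
      \<le> ennreal (1 / real (Suc j) ^ (?n + 2)) * indicator (ball 0 (real (Suc j))) x"
      using j(2) by (simp add: ennreal_leI del: of_nat_Suc power_add norm_divide)
    also have "\<dots> = (\<Sum>i\<in>{j}. ennreal (1 / real (Suc i) ^ (?n + 2)) * indicator (ball 0 (real (Suc i))) x)"
      by (simp only: sum.insert sum.empty finite.emptyI empty_iff not_False_eq_True add_0_right)
    also have "\<dots> \<le> (\<Sum>j. ennreal (1 / real (Suc j) ^ (?n + 2)) * indicator (ball 0 (real (Suc j))) x)"
      by (rule sum_le_suminf) auto
    finally show "ennreal (norm (1 / (1 + norm x) ^ (?n + 2)))
      \<le> (\<Sum>j. ennreal (1 / real (Suc j) ^ (?n + 2)) * indicator (ball 0 (real (Suc j))) x)" .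
  qed
  also have "\<dots> = (\<Sum>j. \<integral>\<^sup>+x. ennreal (1 / real (Suc j) ^ (?n + 2)) * indicator (ball 0 (real (Suc j))) (x :: 'a) \<partial>lborel)"
    by (rule nn_integral_suminf) measurable
  also have "\<dots> = (\<Sum>j. ennreal (V * (1 / real (Suc j) ^ 2)))"
  proof (rule suminf_cong)
    fix j
    have "(\<integral>\<^sup>+x. ennreal (1 / real (Suc j) ^ (?n + 2)) * indicator (ball 0 (real (Suc j))) (x :: 'a) \<partial>lborel)
      = ennreal (1 / real (Suc j) ^ (?n + 2)) * emeasure lborel (ball (0 :: 'a) (real (Suc j)))"
      by (rule nn_integral_cmult_indicator) simp
    also have "\<dots> = ennreal (1 / real (Suc j) ^ (?n + 2) * (V * real (Suc j) ^ ?n))"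
    proof -
      have "emeasure lborel (ball (0 :: 'a) (real (Suc j))) = ennreal (V * real (Suc j) ^ ?n)"
        unfolding V_def by (rule emeasure_ball) simp
      then show ?thesis by (simp only:) (rule ennreal_mult'[symmetric], simp)
    qed
    also have "1 / real (Suc j) ^ (?n + 2) * (V * real (Suc j) ^ ?n) = V * (1 / real (Suc j) ^ 2)"
      by (rule cancel) simp
    finally show "(\<integral>\<^sup>+x. ennreal (1 / real (Suc j) ^ (?n + 2)) * indicator (ball 0 (real (Suc j))) (x :: 'a) \<partial>lborel)
      = ennreal (V * (1 / real (Suc j) ^ 2))" .
  qed
  also have "\<dots> = ennreal (\<Sum>j. V * (1 / real (Suc j) ^ 2))"
  proof (rule suminf_ennreal2)
    have "summable (\<lambda>j. inverse (real (Suc j) ^ 2))"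
      using inverse_power_summable[of 2, where 'a = real] by (subst summable_Suc_iff) simp
    then show "summable (\<lambda>j. V * (1 / real (Suc j) ^ 2))"
      by (intro summable_mult) (simp add: inverse_eq_divide del: of_nat_Suc)
  qed (use V in auto)
  also have "\<dots> < \<infinity>" by simp
  finally show "(\<integral>\<^sup>+x. ennreal (norm (1 / (1 + norm (x :: 'a)) ^ (?n + 2))) \<partial>lborel) < \<infinity>" .
qed measurable

lemma schwartzD:
  assumes "f \<in> schwartz" "set bs \<subseteq> Basis"
  shows "partial_deriv bs f differentiable (at x)"
    "bdd_above (range (\<lambda>x. (1 + norm x) ^ N * norm (partial_deriv bs f x)))"
  using assms by (auto simp: schwartz_def)

lemma schwartz_borel:
  assumes "f \<in> schwartz"
  shows "f \<in> borel_measurable borel"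
proof (rule borel_measurable_continuous_onI)
  have "f differentiable (at x)" for x using schwartzD(1)[OF assms, of "[]"] by simp
  then show "continuous_on UNIV f"
    by (intro differentiable_imp_continuous_on) (simp add: differentiable_on_def)
qed

lemma schwartz_seminorm_bound:
  fixes f :: "'a::euclidean_space \<Rightarrow> complex"
  assumes f: "f \<in> schwartz"
  shows "(1 + norm x) ^ N * norm (f x) \<le> schwartz_seminorm N f"
proof -
  let ?S = "{bs :: 'a list. set bs \<subseteq> Basis \<and> length bs \<le> N}"
  let ?q = "\<lambda>bs. SUP x. (1 + norm x) ^ N * norm (partial_deriv bs f x)"
  have fin: "finite ?S" by (rule finite_lists_length_le) simp
  have le: "(1 + norm x) ^ N * norm (partial_deriv bs f x) \<le> ?q bs" if "bs \<in> ?S" for bs x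
    by (rule cSUP_upper) (use schwartzD(2)[OF f] that in auto)
  have nn: "0 \<le> ?q bs" if "bs \<in> ?S" for bs
    by (rule order_trans[OF _ le[OF that, of 0]]) simp
  have "(1 + norm x) ^ N * norm (f x) \<le> ?q []" using le[of "[]"] by simp
  also have "\<dots> \<le> schwartz_seminorm N f"
    unfolding schwartz_seminorm_def by (rule member_le_sum[OF _ _ fin]) (use nn in auto)
  finally show ?thesis .
qed

lemma schwartz_lpspace:
  fixes f :: "'a::euclidean_space \<Rightarrow> complex"
  assumes f: "f \<in> schwartz" and p: "1 \<le> p"
  shows "f \<in> lpspace lborel p"
proof -
  define N where "N = DIM('a) + 2"
  define C where "C = schwartz_seminorm N f"
  have C: "(1 + norm x) ^ N * norm (f x) \<le> C" for x unfolding C_def by (rule schwartz_seminorm_bound[OF f])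
  have C0: "0 \<le> C" using C[of 0] by (rule order_trans[rotated]) simp
  note [measurable] = schwartz_borel[OF f]
  have "norm (f x) powr p \<le> C powr p * (1 / (1 + norm x) ^ N)" for x
  proof -
    have pos: "0 < (1 + norm x) ^ N" by (intro zero_less_power) (simp add: add_pos_nonneg)
    have "1 \<le> (1 + norm x) ^ N" by (rule one_le_power) simp
    then have le1: "1 / (1 + norm x) ^ N \<le> 1" using pos by (simp only: divide_le_eq_1_pos)
    have "norm (f x) \<le> C * (1 / (1 + norm x) ^ N)"
      using C[of x] pos by (simp add: field_simps)
    then have "norm (f x) powr p \<le> (C * (1 / (1 + norm x) ^ N)) powr p"
      using p by (intro powr_mono2) auto
    also have "\<dots> = C powr p * (1 / (1 + norm x) ^ N) powr p" by (simp only: powr_mult)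
    also have "(1 / (1 + norm x) ^ N) powr p \<le> (1 / (1 + norm x) ^ N) powr 1"
      using p pos le1 by (intro powr_mono') auto
    also have "\<dots> = 1 / (1 + norm x) ^ N" using pos by (intro powr_one) auto
    finally show ?thesis by (simp add: mult_left_mono)
  qed
  note le = this
  have I: "integrable lborel (\<lambda>x :: 'a. C powr p * (1 / (1 + norm x) ^ N))"
    unfolding N_def by (intro integrable_mult_right integrable_inverse_one_plus_norm_power)
  have "integrable lborel (\<lambda>x. norm (f x) powr p)"
  proof (rule Bochner_Integration.integrable_bound[OF I])
    show "AE x in lborel. norm (norm (f x) powr p) \<le> norm (C powr p * (1 / (1 + norm x) ^ N))"
    proof (rule AE_I2)
      fix x
      have "norm (norm (f x) powr p) \<le> C powr p * (1 / (1 + norm x) ^ N)" using le[of x] by simp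
      also have "\<dots> \<le> norm (C powr p * (1 / (1 + norm x) ^ N))" unfolding real_norm_def by (rule abs_ge_self)
      finally show "norm (norm (f x) powr p) \<le> norm (C powr p * (1 / (1 + norm x) ^ N))" .
    qed
  qed measurable
  then show ?thesis by (simp add: lpspace_def)
qed

lemma partial_deriv_add:
  assumes "f \<in> schwartz" "g \<in> schwartz" "set bs \<subseteq> Basis"
  shows "partial_deriv bs (\<lambda>x. f x + g x) = (\<lambda>x. partial_deriv bs f x + partial_deriv bs g x)"
  using assms(3)
proof (induction bs)
  case (Cons b bs)
  have "frechet_derivative (\<lambda>x. partial_deriv bs f x + partial_deriv bs g x) (at x)
    = (\<lambda>h. frechet_derivative (partial_deriv bs f) (at x) h + frechet_derivative (partial_deriv bs g) (at x) h)" for x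
    using Cons.prems schwartzD(1)[OF assms(1)] schwartzD(1)[OF assms(2)]
    by (intro frechet_derivative_at[symmetric] has_derivative_add) (simp_all flip: frechet_derivative_works)
  then show ?case using Cons by simp
qed simp

lemma partial_deriv_scale:
  assumes "f \<in> schwartz" "set bs \<subseteq> Basis"
  shows "partial_deriv bs (\<lambda>x. c * f x) = (\<lambda>x. c * partial_deriv bs f x)"
  using assms(2)
proof (induction bs)
  case (Cons b bs)
  have "frechet_derivative (\<lambda>x. c * partial_deriv bs f x) (at x)
    = (\<lambda>h. c * frechet_derivative (partial_deriv bs f) (at x) h)" for x
    using Cons.prems schwartzD(1)[OF assms(1)]
    by (intro frechet_derivative_at[symmetric] has_derivative_mult_right) (simp_all flip: frechet_derivative_works)
  then show ?case using Cons by simp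
qed simp

lemma schwartz_add:
  assumes f: "f \<in> schwartz" and g: "g \<in> schwartz"
  shows "(\<lambda>x. f x + g x) \<in> schwartz"
  unfolding schwartz_def
proof (intro CollectI allI impI conjI)
  fix bs :: "'a list" assume bs: "set bs \<subseteq> Basis"
  show "partial_deriv bs (\<lambda>x. f x + g x) differentiable (at x)" for x
    unfolding partial_deriv_add[OF f g bs] by (intro differentiable_add schwartzD(1) f g bs)
  fix N
  obtain A B where AB: "\<And>x. (1 + norm x) ^ N * norm (partial_deriv bs f x) \<le> A"
    "\<And>x. (1 + norm x) ^ N * norm (partial_deriv bs g x) \<le> B"
    using schwartzD(2)[OF f bs, of N] schwartzD(2)[OF g bs, of N] by (auto simp: bdd_above_def)
  show "bdd_above (range (\<lambda>x. (1 + norm x) ^ N * norm (partial_deriv bs (\<lambda>x. f x + g x) x)))"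
    unfolding partial_deriv_add[OF f g bs]
  proof (intro bdd_aboveI[of _ "A + B"], safe)
    fix x :: 'a
    have "(1 + norm x) ^ N * norm (partial_deriv bs f x + partial_deriv bs g x)
      \<le> (1 + norm x) ^ N * (norm (partial_deriv bs f x) + norm (partial_deriv bs g x))"
      by (intro mult_left_mono norm_triangle_ineq) simp
    also have "\<dots> \<le> A + B" unfolding distrib_left by (intro add_mono AB)
    finally show "(1 + norm x) ^ N * norm (partial_deriv bs f x + partial_deriv bs g x) \<le> A + B" .
  qed
qed

lemma schwartz_scale:
  assumes f: "f \<in> schwartz"
  shows "(\<lambda>x. c * f x) \<in> schwartz"
  unfolding schwartz_def
proof (intro CollectI allI impI conjI)
  fix bs :: "'a list" assume bs: "set bs \<subseteq> Basis"
  show "partial_deriv bs (\<lambda>x. c * f x) differentiable (at x)" for x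
    unfolding partial_deriv_scale[OF f bs] by (intro differentiable_mult differentiable_const schwartzD(1) f bs)
  fix N
  obtain A where A: "\<And>x. (1 + norm x) ^ N * norm (partial_deriv bs f x) \<le> A"
    using schwartzD(2)[OF f bs, of N] by (auto simp: bdd_above_def)
  show "bdd_above (range (\<lambda>x. (1 + norm x) ^ N * norm (partial_deriv bs (\<lambda>x. c * f x) x)))"
    unfolding partial_deriv_scale[OF f bs]
  proof (intro bdd_aboveI[of _ "norm c * A"], safe)
    fix x :: 'a
    show "(1 + norm x) ^ N * norm (c * partial_deriv bs f x) \<le> norm c * A"
      using mult_left_mono[OF A[of x], of "norm c"] by (simp add: norm_mult mult_ac)
  qed
qed

lemma real_polynomial_function_has_derivative:
  fixes P :: "'a::euclidean_space \<Rightarrow> real"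
  assumes "real_polynomial_function P"
  shows "\<exists>D. (\<forall>x. (P has_derivative D x) (at x)) \<and> (\<forall>b. real_polynomial_function (\<lambda>x. D x b))"
  using assms
proof induction
  case (linear f)
  then show ?case
    by (intro exI[of _ "\<lambda>x. f"]) (auto intro: bounded_linear_imp_has_derivative)
next
  case (const c)
  show ?case by (intro exI[of _ "\<lambda>x h. 0"]) auto
next
  case (add f g)
  then obtain D E where "\<And>x. (f has_derivative D x) (at x)" "\<And>b. real_polynomial_function (\<lambda>x. D x b)"
    "\<And>x. (g has_derivative E x) (at x)" "\<And>b. real_polynomial_function (\<lambda>x. E x b)" by blast
  then show ?case by (intro exI[of _ "\<lambda>x h. D x h + E x h"]) (auto intro: has_derivative_add)
next
  case (mult f g)
  then obtain D E where "\<And>x. (f has_derivative D x) (at x)" "\<And>b. real_polynomial_function (\<lambda>x. D x b)"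
    "\<And>x. (g has_derivative E x) (at x)" "\<And>b. real_polynomial_function (\<lambda>x. E x b)" by blast
  then show ?case using mult(1,2)
    by (intro exI[of _ "\<lambda>x h. f x * E x h + D x h * g x"] conjI allI has_derivative_mult
        real_polynomial_function.intros(3,4))
qed

lemma real_polynomial_function_growth:
  fixes P :: "'a::euclidean_space \<Rightarrow> real"
  assumes "real_polynomial_function P"
  shows "\<exists>C M. \<forall>x. \<bar>P x\<bar> \<le> C * (1 + norm x) ^ M"
  using assms
proof induction
  case (linear f)
  then obtain K where K: "0 \<le> K" "\<And>x. norm (f x) \<le> norm x * K" using bounded_linear.nonneg_bounded by blast
  have "\<bar>f x\<bar> \<le> K * (1 + norm x) ^ 1" for x using K(2)[of x] K(1) by (simp add: algebra_simps)
  then show ?case by blast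
next
  case (const c)
  have "\<bar>c\<bar> \<le> \<bar>c\<bar> * (1 + norm x) ^ 0" for x :: 'a by simp
  then show ?case by blast
next
  case (add f g)
  then obtain A M B N where AB: "\<And>x. \<bar>f x\<bar> \<le> A * (1 + norm x) ^ M" "\<And>x. \<bar>g x\<bar> \<le> B * (1 + norm x) ^ N" by blast
  have "0 \<le> A" "0 \<le> B" using AB(1)[of 0] AB(2)[of 0] by auto
  have "\<bar>f x + g x\<bar> \<le> (A + B) * (1 + norm x) ^ (M + N)" for x
  proof -
    have "\<bar>f x + g x\<bar> \<le> A * (1 + norm x) ^ M + B * (1 + norm x) ^ N" using AB(1)[of x] AB(2)[of x] by linarith
    also have "\<dots> \<le> A * (1 + norm x) ^ (M + N) + B * (1 + norm x) ^ (M + N)"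
      using \<open>0 \<le> A\<close> \<open>0 \<le> B\<close> by (intro add_mono mult_left_mono power_increasing) auto
    finally show ?thesis by (simp add: distrib_right)
  qed
  then show ?case by blast
next
  case (mult f g)
  then obtain A M B N where AB: "\<And>x. \<bar>f x\<bar> \<le> A * (1 + norm x) ^ M" "\<And>x. \<bar>g x\<bar> \<le> B * (1 + norm x) ^ N" by blast
  have "\<bar>f x * g x\<bar> \<le> (A * B) * (1 + norm x) ^ (M + N)" for x
    using mult_mono[OF AB(1)[of x] AB(2)[of x]] order_trans[OF abs_ge_zero AB(1)[of x]]
    by (simp add: abs_mult power_add mult_ac)
  then show ?case by blast
qed

text \<open>Polynomials times \<open>exp (- Q)\<close> are stable under partial derivatives, and the growth of \<open>Q\<close> absorbs every
  polynomial factor.\<close>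

lemma schwartz_polynomial_times_exp:
  fixes P Q :: "'a::euclidean_space \<Rightarrow> real"
  assumes P: "real_polynomial_function P" and Q: "real_polynomial_function Q"
    and B: "\<And>x. norm x - B \<le> Q x"
  shows "(\<lambda>x. complex_of_real (P x * exp (- Q x))) \<in> schwartz"
proof -
  obtain E where E: "\<And>x. (Q has_derivative E x) (at x)" "\<And>b. real_polynomial_function (\<lambda>x. E x b)"
    using real_polynomial_function_has_derivative[OF Q] by blast
  have der: "\<exists>D. (\<forall>x. ((\<lambda>x. complex_of_real (P x * exp (- Q x))) has_derivative (\<lambda>h. complex_of_real (D x h * exp (- Q x)))) (at x))
      \<and> (\<forall>b. real_polynomial_function (\<lambda>x. D x b))"
    if P: "real_polynomial_function P" for P
  proof -
    obtain D where D: "\<And>x. (P has_derivative D x) (at x)" "\<And>b. real_polynomial_function (\<lambda>x. D x b)"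
      using real_polynomial_function_has_derivative[OF P] by blast
    have "((\<lambda>x. complex_of_real (P x * exp (- Q x))) has_derivative
        (\<lambda>h. complex_of_real ((D x h - P x * E x h) * exp (- Q x)))) (at x)" for x
      by (intro has_derivative_of_real)
         (auto intro!: derivative_eq_intros D(1) E(1) simp: algebra_simps)
    moreover have "real_polynomial_function (\<lambda>x. D x b - P x * E x b)" for b
      using D(2) E(2) P by (intro real_polynomial_function_diff real_polynomial_function.intros(4))
    ultimately show ?thesis by (intro exI[of _ "\<lambda>x h. D x h - P x * E x h"]) auto
  qed
  have form: "\<exists>R. real_polynomial_function R \<and>
      partial_deriv bs (\<lambda>x. complex_of_real (P x * exp (- Q x))) = (\<lambda>x. complex_of_real (R x * exp (- Q x)))" for bs
  proof (induction bs)
    case Nil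
    then show ?case using P by auto
  next
    case (Cons b bs)
    then obtain R where R: "real_polynomial_function R"
      "partial_deriv bs (\<lambda>x. complex_of_real (P x * exp (- Q x))) = (\<lambda>x. complex_of_real (R x * exp (- Q x)))" by blast
    obtain D where D: "\<And>x. ((\<lambda>x. complex_of_real (R x * exp (- Q x))) has_derivative (\<lambda>h. complex_of_real (D x h * exp (- Q x)))) (at x)"
      "\<And>b. real_polynomial_function (\<lambda>x. D x b)" using der[OF R(1)] by blast
    have "partial_deriv (b # bs) (\<lambda>x. complex_of_real (P x * exp (- Q x))) = (\<lambda>x. complex_of_real (D x b * exp (- Q x)))"
      unfolding partial_deriv.simps R(2) frechet_derivative_at[OF D(1), symmetric] ..
    then show ?case using D(2) by blast
  qed
  show ?thesis
    unfolding schwartz_def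
  proof (intro CollectI allI impI conjI)
    fix bs :: "'a list"
    obtain R where R: "real_polynomial_function R"
      "partial_deriv bs (\<lambda>x. complex_of_real (P x * exp (- Q x))) = (\<lambda>x. complex_of_real (R x * exp (- Q x)))"
      using form by blast
    show "partial_deriv bs (\<lambda>x. complex_of_real (P x * exp (- Q x))) differentiable (at x)" for x
      unfolding R(2) using der[OF R(1)] by (auto simp: differentiable_def)
    fix N
    obtain C M where CM: "\<And>x. \<bar>R x\<bar> \<le> C * (1 + norm x) ^ M"
      using real_polynomial_function_growth[OF R(1)] by blast
    have C: "0 \<le> C" using CM[of 0] by auto
    \<comment> \<open>The successor keeps \<open>L\<close> positive for the estimate \<open>1 + t \<le> L exp (t / L)\<close>.\<close>
    define L where "L = Suc (N + M)"
    have bound: "(1 + norm x) ^ N * norm (complex_of_real (R x * exp (- Q x))) \<le> C * (real L ^ L * exp B)" for x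
    proof -
      have "1 + norm x \<le> real L * (1 + norm x / real L)" by (simp add: L_def field_simps)
      also have "\<dots> \<le> real L * exp (norm x / real L)"
        by (intro mult_left_mono exp_ge_add_one_self) simp
      finally have "(1 + norm x) ^ L \<le> (real L * exp (norm x / real L)) ^ L" by (intro power_mono) auto
      also have "\<dots> = real L ^ L * exp (norm x)"
      proof -
        have "exp (norm x / real L) ^ L = exp (real L * (norm x / real L))" by (rule exp_of_nat_mult[symmetric])
        also have "real L * (norm x / real L) = norm x" by (simp add: L_def)
        finally show ?thesis by (simp only: power_mult_distrib)
      qed
      finally have pow: "(1 + norm x) ^ L \<le> real L ^ L * exp (norm x)" .
      have "(1 + norm x) ^ N * norm (complex_of_real (R x * exp (- Q x))) = ((1 + norm x) ^ N * \<bar>R x\<bar>) * exp (- Q x)"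
        by (simp add: norm_mult abs_mult)
      also have "\<dots> \<le> ((1 + norm x) ^ N * (C * (1 + norm x) ^ M)) * exp (B - norm x)"
        using CM[of x] B[of x] C by (intro mult_mono) auto
      also have "\<dots> = C * ((1 + norm x) ^ (N + M) * exp (B - norm x))"
        by (simp add: power_add mult_ac)
      also have "\<dots> \<le> C * ((real L ^ L * exp (norm x)) * exp (B - norm x))"
        using C order_trans[OF power_increasing pow, of "N + M"]
        by (intro mult_left_mono mult_right_mono) (auto simp: L_def)
      also have "\<dots> = C * (real L ^ L * exp B)" by (simp flip: exp_add)
      finally show ?thesis .
    qed
    show "bdd_above (range (\<lambda>x. (1 + norm x) ^ N * norm (partial_deriv bs (\<lambda>x. complex_of_real (P x * exp (- Q x))) x)))"
      unfolding R(2) by (intro bdd_aboveI[of _ "C * (real L ^ L * exp B)"]) (use bound in auto)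
  qed
qed

text \<open>In coordinates \<open>y\<^sub>i\<close> that map the box to \<open>(-1, 1)\<close> in each direction, \<open>exp (- (\<Sum>\<^sub>i y\<^sub>i ^ (2 * m)))\<close> tends to 1 in the
  box and to 0 off its closure, and is dominated by a multiple of its value for \<open>m = 1\<close>.\<close>

lemma schwartz_approximates_box:
  fixes a b :: "'a::euclidean_space"
  assumes ab: "box a b \<noteq> {}" and p: "1 \<le> p"
  obtains F where "\<forall>m. F m \<in> schwartz" "(\<lambda>m. lpint lborel p (\<lambda>x. F m x - indicator (box a b) x)) \<longlonglongrightarrow> 0"
proof -
  have lt: "a \<bullet> i < b \<bullet> i" if "i \<in> Basis" for i using ab that by (auto simp: box_ne_empty)
  define y where "y i x = (2 * (x \<bullet> i) - a \<bullet> i - b \<bullet> i) / (b \<bullet> i - a \<bullet> i)" for i x :: 'a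
  define Q where "Q m x = (\<Sum>i\<in>Basis. y i x ^ (2 * m))" for m :: nat and x
  define F where "F m x = complex_of_real (1 * exp (- Q m x))" for m x
  have y_poly: "real_polynomial_function (y i)" for i
  proof -
    have "real_polynomial_function (\<lambda>x :: 'a. x \<bullet> i)"
      by (intro real_polynomial_function.intros(1) bounded_linear_inner_left)
    then show ?thesis unfolding y_def
      by (intro real_polynomial_function_divide real_polynomial_function_diff
          real_polynomial_function.intros(4)) (auto intro: real_polynomial_function.intros(2))
  qed
  have Q_poly: "real_polynomial_function (Q m)" for m
    unfolding Q_def by (intro real_polynomial_function_sum real_polynomial_function_power y_poly) auto
  have in_box: "\<bar>y i x\<bar> < 1 \<longleftrightarrow> a \<bullet> i < x \<bullet> i \<and> x \<bullet> i < b \<bullet> i" if "i \<in> Basis" for i x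
    using lt[OF that] by (auto simp: y_def abs_less_iff divide_less_eq less_divide_eq)
  have pow_ge: "t\<^sup>2 - 1 \<le> t ^ (2 * m)" if "1 \<le> m" for t :: real and m :: nat
  proof (cases "1 \<le> \<bar>t\<bar>")
    case True
    then have "\<bar>t\<bar> ^ 2 \<le> \<bar>t\<bar> ^ (2 * m)" using that by (intro power_increasing) auto
    then show ?thesis by (simp add: power_even_abs)
  next
    case False
    then have "t\<^sup>2 \<le> 1" by (simp add: abs_square_le_1)
    moreover have "0 \<le> t ^ (2 * m)" by (simp add: zero_le_even_power)
    ultimately show ?thesis by linarith
  qed
  have Q1: "Q 1 x - real DIM('a) \<le> Q m x" if "1 \<le> m" for m x
  proof -
    have "Q 1 x - real DIM('a) = (\<Sum>i\<in>Basis. (y i x)\<^sup>2 - 1)" by (simp add: Q_def sum_subtractf)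
    also have "\<dots> \<le> Q m x" unfolding Q_def by (intro sum_mono pow_ge that)
    finally show ?thesis .
  qed
  \<comment> \<open>From \<open>(|y\<^sub>i| - h)\<^sup>2 \<ge> 0\<close> with \<open>h\<close> a quarter of the side length, which makes the slope in \<open>|x\<^sub>i|\<close> equal to 1.\<close>
  define B where "B = (\<Sum>i\<in>Basis. (\<bar>a \<bullet> i\<bar> + \<bar>b \<bullet> i\<bar>) / 2 + ((b \<bullet> i - a \<bullet> i) / 4)\<^sup>2)"
  have lower: "norm x - (B + real DIM('a)) \<le> Q m x" if "1 \<le> m" for m x
  proof -
    have "\<bar>x \<bullet> i\<bar> - ((\<bar>a \<bullet> i\<bar> + \<bar>b \<bullet> i\<bar>) / 2 + ((b \<bullet> i - a \<bullet> i) / 4)\<^sup>2) \<le> (y i x)\<^sup>2" if i: "i \<in> Basis" for i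
    proof -
      define h where "h = (b \<bullet> i - a \<bullet> i) / 4"
      have h: "0 < h" using lt[OF i] by (simp add: h_def)
      have yh: "2 * h * y i x = x \<bullet> i - (a \<bullet> i + b \<bullet> i) / 2"
        using lt[OF i] by (simp add: y_def h_def field_simps)
      have "0 \<le> (\<bar>y i x\<bar> - h)\<^sup>2" by simp
      then have "2 * h * \<bar>y i x\<bar> - h\<^sup>2 \<le> (y i x)\<^sup>2" by (simp add: power2_diff algebra_simps)
      moreover have "2 * h * \<bar>y i x\<bar> = \<bar>x \<bullet> i - (a \<bullet> i + b \<bullet> i) / 2\<bar>"
        using h by (simp add: abs_mult flip: yh)
      moreover have "\<bar>x \<bullet> i\<bar> - (\<bar>a \<bullet> i\<bar> + \<bar>b \<bullet> i\<bar>) / 2 \<le> \<bar>x \<bullet> i - (a \<bullet> i + b \<bullet> i) / 2\<bar>"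
      proof -
        have "\<bar>x \<bullet> i\<bar> - (\<bar>a \<bullet> i\<bar> + \<bar>b \<bullet> i\<bar>) / 2 \<le> \<bar>x \<bullet> i\<bar> - \<bar>a \<bullet> i + b \<bullet> i\<bar> / 2"
          by (intro diff_left_mono divide_right_mono abs_triangle_ineq) simp
        also have "\<dots> \<le> \<bar>x \<bullet> i - (a \<bullet> i + b \<bullet> i) / 2\<bar>"
          using abs_triangle_ineq2[of "x \<bullet> i" "(a \<bullet> i + b \<bullet> i) / 2"] by simp
        finally show ?thesis .
      qed
      ultimately show ?thesis by (simp add: h_def)
    qed
    then have "(\<Sum>i\<in>Basis. \<bar>x \<bullet> i\<bar> - ((\<bar>a \<bullet> i\<bar> + \<bar>b \<bullet> i\<bar>) / 2 + ((b \<bullet> i - a \<bullet> i) / 4)\<^sup>2)) \<le> (\<Sum>i\<in>Basis. (y i x)\<^sup>2)"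
      by (rule sum_mono)
    then have "(\<Sum>i\<in>Basis. \<bar>x \<bullet> i\<bar>) - B \<le> Q 1 x" by (simp add: Q_def B_def sum_subtractf)
    then show ?thesis using norm_le_l1[of x] Q1[OF that, of x] by linarith
  qed
  have F: "F m \<in> schwartz" if "1 \<le> m" for m
    unfolding F_def[abs_def]
    by (intro schwartz_polynomial_times_exp[OF _ Q_poly lower[OF that]] real_polynomial_function.intros(2))
  have nF: "norm (F m x) = exp (- Q m x)" for m x by (simp add: F_def)
  have dom: "norm (F m x - indicator (box a b) x) \<le> exp (real DIM('a)) * exp (- Q 1 x)" if "1 \<le> m" for m x
  proof -
    have 1: "exp (- Q m x) \<le> exp (real DIM('a)) * exp (- Q 1 x)"
      using Q1[OF that, of x] by (simp flip: exp_add)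
    have Q0: "0 \<le> Q m x" unfolding Q_def by (intro sum_nonneg) (simp add: zero_le_even_power)
    show ?thesis
    proof (cases "x \<in> box a b")
      case True
      have "(y i x)\<^sup>2 \<le> 1" if "i \<in> Basis" for i
        using in_box[OF that, of x] True that by (auto simp: mem_box abs_square_le_1)
      then have "Q 1 x \<le> (\<Sum>i\<in>(Basis :: 'a set). 1)" unfolding Q_def by (intro sum_mono) auto
      then have "1 \<le> exp (real DIM('a)) * exp (- Q 1 x)" by (simp flip: exp_add)
      moreover have "norm (F m x - indicator (box a b) x) = 1 - exp (- Q m x)"
      proof -
        have "F m x - indicator (box a b) x = complex_of_real (exp (- Q m x) - 1)" using True by (simp add: F_def)
        then have "norm (F m x - indicator (box a b) x) = \<bar>exp (- Q m x) - 1\<bar>" by (simp only: norm_of_real)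
        then show ?thesis using Q0 by simp
      qed
      moreover have "0 \<le> exp (- Q m x)" by simp
      ultimately show ?thesis by linarith
    qed (use 1 nF in auto)
  qed
  have [measurable]: "F m \<in> borel_measurable borel" if "1 \<le> m" for m using schwartz_borel[OF F[OF that]] .
  have lim: "AE x in lborel. (\<lambda>m. F (Suc m) x) \<longlonglongrightarrow> indicator (box a b) x"
  proof -
    have hyper: "AE x in lborel. x \<bullet> i \<noteq> c" if "i \<in> Basis" for i :: 'a and c
    proof -
      have "{x. x \<bullet> i = c} \<in> null_sets lebesgue"
        using negligible_standard_hyperplane[OF that, of c] by (simp add: negligible_iff_null_sets)
      then have "AE x in lebesgue. x \<notin> {x. x \<bullet> i = c}" by (rule AE_not_in)
      then show ?thesis by (simp add: AE_lebesgue_iff)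
    qed
    have "AE x in lborel. \<forall>i\<in>Basis. x \<bullet> i \<noteq> a \<bullet> i \<and> x \<bullet> i \<noteq> b \<bullet> i"
      by (intro AE_finite_allI AE_conjI hyper) auto
    then show ?thesis
    proof eventually_elim
      case (elim x)
      show ?case
      proof (cases "x \<in> box a b")
        case True
        have "(\<lambda>m. Q (Suc m) x) \<longlonglongrightarrow> (\<Sum>i\<in>(Basis :: 'a set). 0)"
          unfolding Q_def
        proof (rule tendsto_sum)
          fix i :: 'a assume i: "i \<in> Basis"
          have "\<bar>y i x\<bar> < 1" using in_box[OF i] True i by (simp add: mem_box)
          then have "(y i x)\<^sup>2 < 1" by (simp add: abs_square_less_1)
          then have "(\<lambda>m. ((y i x)\<^sup>2) ^ m) \<longlonglongrightarrow> 0" by (intro LIMSEQ_realpow_zero) auto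
          then have "(\<lambda>m. ((y i x)\<^sup>2) ^ Suc m) \<longlonglongrightarrow> 0" by (rule LIMSEQ_Suc)
          then show "(\<lambda>m. y i x ^ (2 * Suc m)) \<longlonglongrightarrow> 0" by (simp only: power_mult)
        qed
        then have "(\<lambda>m. complex_of_real (1 * exp (- Q (Suc m) x))) \<longlonglongrightarrow> complex_of_real (1 * exp (- 0))"
          by (intro tendsto_intros) simp
        then show ?thesis using True by (simp add: F_def)
      next
        case False
        then obtain i where i: "i \<in> Basis" "\<not> (a \<bullet> i < x \<bullet> i \<and> x \<bullet> i < b \<bullet> i)" by (auto simp: mem_box)
        have "\<bar>y i x\<bar> \<noteq> 1" using elim i lt[OF i(1)] by (auto simp: y_def abs_if field_simps split: if_splits)
        then have y1: "1 < \<bar>y i x\<bar>" using in_box[OF i(1), of x] i(2) by linarith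
        have "filterlim (\<lambda>m. Q (Suc m) x) at_top sequentially"
        proof (rule filterlim_at_top_mono)
          have "1 < (y i x)\<^sup>2" using one_less_power[OF y1, of 2] by simp
          then have "filterlim (\<lambda>m. ((y i x)\<^sup>2) ^ m) at_top sequentially"
          proof (intro filterlim_at_infinity_imp_filterlim_at_top)
            assume y2: "1 < (y i x)\<^sup>2"
            show "filterlim (\<lambda>m. ((y i x)\<^sup>2) ^ m) at_infinity sequentially"
              using y2 by (intro filterlim_realpow_sequentially_gt1) simp
            have "0 < (y i x)\<^sup>2" using y2 by linarith
            then show "\<forall>\<^sub>F m in sequentially. 0 < ((y i x)\<^sup>2) ^ m"
              by (intro always_eventually allI) (rule zero_less_power)
          qed
          then show "filterlim (\<lambda>m. ((y i x)\<^sup>2) ^ Suc m) at_top sequentially"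
            by (rule filterlim_compose[OF _ filterlim_Suc])
          show "\<forall>\<^sub>F m in sequentially. ((y i x)\<^sup>2) ^ Suc m \<le> Q (Suc m) x"
            unfolding Q_def power_mult[symmetric]
            by (intro always_eventually allI member_le_sum i zero_le_even_power) auto
        qed
        then have "(\<lambda>m. exp (- Q (Suc m) x)) \<longlonglongrightarrow> 0"
          by (intro filterlim_compose[OF exp_at_bot] filterlim_compose[OF filterlim_uminus_at_bot_at_top])
        then have "(\<lambda>m. complex_of_real (1 * exp (- Q (Suc m) x))) \<longlonglongrightarrow> complex_of_real 0"
          by (intro tendsto_of_real) simp
        then show ?thesis using False by (simp add: F_def)
      qed
    qed
  qed
  have conv: "(\<lambda>m. lpint lborel p (\<lambda>x. F (Suc m) x - indicator (box a b) x)) \<longlonglongrightarrow> 0"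
  proof (rule lpint_tendsto_0_dominated[OF _ _ _ _ lim])
    have "(\<lambda>x. of_real (exp (real DIM('a))) * F 1 x) \<in> lpspace lborel p"
      by (intro lpspace_scale schwartz_lpspace F p) simp
    from lpspaceD(2)[OF this]
    show "integrable lborel (\<lambda>x. norm (exp (real DIM('a)) * exp (- Q 1 x)) powr p)"
      by (simp add: norm_mult nF)
    show "AE x in lborel. norm (F (Suc i) x - indicator (box a b) x) \<le> exp (real DIM('a)) * exp (- Q 1 x)" for i
      by (intro AE_I2 dom) simp
  qed (use p in auto)
  show ?thesis by (rule that[OF _ conv]) (use F in simp)
qed

lemma schwartz_dense:
  fixes f :: "'a::euclidean_space \<Rightarrow> complex"
  assumes f: "f \<in> lpspace lborel p" and p: "1 \<le> p"
  shows "\<forall>\<epsilon>>0. \<exists>g\<in>schwartz. lpint lborel p (\<lambda>x. g x - f x) < \<epsilon>"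
proof -
  have p0: "0 < p" "0 \<le> p" using p by auto
  note sl = schwartz_lpspace[OF _ p]
  show ?thesis
    using f p0(1)
  proof (induction rule: lpspace_induct)
    case (box a b)
    show ?case
    proof (intro allI impI)
      fix \<epsilon> :: real assume \<epsilon>: "0 < \<epsilon>"
      show "\<exists>g\<in>schwartz. lpint lborel p (\<lambda>x. g x - indicator (box a b) x) < \<epsilon>"
      proof (cases "box a b = {}")
        case True
        have unit: "box (0 :: 'a) One \<noteq> {}" by (simp add: box_ne_empty)
        obtain F :: "nat \<Rightarrow> 'a \<Rightarrow> complex" where "\<forall>m. F m \<in> schwartz"
          by (rule schwartz_approximates_box[OF unit p])
        then have "F 0 \<in> schwartz" by simp
        from schwartz_scale[OF this, of 0] show ?thesis
          using True \<epsilon> lpspace_zero(2)[OF p0(1), where M = "lborel :: 'a measure"] by (intro bexI[of _ "\<lambda>x. 0 * F 0 x"]) auto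
      next
        case False
        obtain F where F: "\<forall>m. F m \<in> schwartz"
          "(\<lambda>m. lpint lborel p (\<lambda>x. F m x - indicator (box a b) x)) \<longlonglongrightarrow> 0"
          by (rule schwartz_approximates_box[OF False p])
        have "\<forall>\<^sub>F m in sequentially. lpint lborel p (\<lambda>x. F m x - indicator (box a b) x) < \<epsilon>"
          using F(2) \<epsilon> by (intro order_tendstoD(2)) auto
        then show ?thesis using F(1) by (auto simp: eventually_sequentially)
      qed
    qed
  next
    case (add f h)
    show ?case
    proof (intro allI impI)
      fix \<epsilon> :: real assume \<epsilon>: "0 < \<epsilon>"
      then have \<epsilon>': "0 < \<epsilon> / (2 powr p * 2)" by simp
      obtain u v where uv: "u \<in> schwartz" "lpint lborel p (\<lambda>x. u x - f x) < \<epsilon> / (2 powr p * 2)"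
        "v \<in> schwartz" "lpint lborel p (\<lambda>x. v x - h x) < \<epsilon> / (2 powr p * 2)" using add(3,4) \<epsilon>' by blast
      have "lpint lborel p (\<lambda>x. (u x - f x) + (v x - h x)) \<le> 2 powr p * (lpint lborel p (\<lambda>x. u x - f x) + lpint lborel p (\<lambda>x. v x - h x))"
        by (intro lpspace_add(2) lpspace_diff(1) sl uv add p0)
      also have "\<dots> < 2 powr p * (\<epsilon> / (2 powr p * 2) + \<epsilon> / (2 powr p * 2))"
        using uv by (intro mult_strict_left_mono add_strict_mono) auto
      also have "\<dots> = \<epsilon>" by simp
      finally show "\<exists>g\<in>schwartz. lpint lborel p (\<lambda>x. g x - (f x + h x)) < \<epsilon>"
        by (intro bexI[OF _ schwartz_add[OF uv(1,3)]]) (simp add: algebra_simps)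
    qed
  next
    case (scale f c)
    show ?case
    proof (intro allI impI)
      fix \<epsilon> :: real assume \<epsilon>: "0 < \<epsilon>"
      define C where "C = norm c powr p + 1"
      have C: "0 < C" "norm c powr p \<le> C" by (auto simp: C_def add_nonneg_pos)
      have "0 < \<epsilon> / C" using \<epsilon> C by simp
      then obtain u where u: "u \<in> schwartz" "lpint lborel p (\<lambda>x. u x - f x) < \<epsilon> / C" using scale(2) by blast
      have "lpint lborel p (\<lambda>x. c * (u x - f x)) = norm c powr p * lpint lborel p (\<lambda>x. u x - f x)"
        by (intro lpspace_scale(2) lpspace_diff(1) sl u scale p0)
      also have "\<dots> \<le> C * lpint lborel p (\<lambda>x. u x - f x)" by (intro mult_right_mono C) simp
      also have "\<dots> < C * (\<epsilon> / C)" using u C by (intro mult_strict_left_mono)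
      also have "\<dots> = \<epsilon>" using C by simp
      finally show "\<exists>g\<in>schwartz. lpint lborel p (\<lambda>x. g x - c * f x) < \<epsilon>"
        by (intro bexI[OF _ schwartz_scale[OF u(1)]]) (simp add: algebra_simps)
    qed
  next
    case (lim F f)
    show ?case
    proof (intro allI impI)
      fix \<epsilon> :: real assume \<epsilon>: "0 < \<epsilon>"
      then have \<epsilon>': "0 < \<epsilon> / (2 powr p * 2)" by simp
      have "\<forall>\<^sub>F i in sequentially. lpint lborel p (\<lambda>x. F i x - f x) < \<epsilon> / (2 powr p * 2)"
        using lim(3) \<epsilon>' by (intro order_tendstoD(2)) auto
      then obtain i where i: "lpint lborel p (\<lambda>x. F i x - f x) < \<epsilon> / (2 powr p * 2)" by (auto simp: eventually_sequentially)
      obtain u where u: "u \<in> schwartz" "lpint lborel p (\<lambda>x. u x - F i x) < \<epsilon> / (2 powr p * 2)" using lim(4) \<epsilon>' by blast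
      have "lpint lborel p (\<lambda>x. (u x - F i x) + (F i x - f x)) \<le> 2 powr p * (lpint lborel p (\<lambda>x. u x - F i x) + lpint lborel p (\<lambda>x. F i x - f x))"
        by (intro lpspace_add(2) lpspace_diff(1) sl u lim p0)
      also have "\<dots> < 2 powr p * (\<epsilon> / (2 powr p * 2) + \<epsilon> / (2 powr p * 2))"
        using u i by (intro mult_strict_left_mono add_strict_mono) auto
      also have "\<dots> = \<epsilon>" by simp
      finally show "\<exists>g\<in>schwartz. lpint lborel p (\<lambda>x. g x - f x) < \<epsilon>"
        by (intro bexI[OF _ u(1)]) simp
    qed
  qed
qed

section \<open>The convolution operator on Lebesgue spaces\<close>

lemma Lp_eq_lpspace: "Lp p = lpspace lebesgue p"
  by (simp add: Lp_def lpspace_def)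

lemma Lp_norm_eq_lpint: "Lp_norm p f = lpint lebesgue p f powr (1 / p)"
  by (simp add: Lp_norm_def lpint_def)

text \<open>The part of the kernel where \<open>|k| > 1\<close> is integrable because \<open>q > 1\<close>, and the rest is bounded, so that the decay
  of the Schwartz function suffices there.\<close>

lemma integrable_weak_kernel_times_schwartz:
  fixes k f :: "'a::euclidean_space \<Rightarrow> complex"
  assumes k [measurable]: "k \<in> borel_measurable borel" and A: "weak_bound q A k" "0 < A" and q: "1 < q"
  obtains G where "integrable lborel G"
    "\<And>f x. f \<in> schwartz \<Longrightarrow> norm (k x * f x) \<le> schwartz_seminorm (DIM('a) + 2) f * G x"
proof -
  define N where "N = DIM('a) + 2"
  define E where "E = {x. 1 < norm (k x)}"
  have [measurable]: "E \<in> sets borel" unfolding E_def by measurable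
  have E: "emeasure lborel E \<le> ennreal A"
    using A(1)[unfolded weak_bound_def, rule_format, of 1] by (simp add: E_def)
  have "(\<integral>\<^sup>+x. ennreal (norm (k x)) * indicator E x \<partial>lborel) < \<infinity>"
    by (rule le_less_trans[OF nn_integral_weak_le[OF k _ A(1) q A(2) E A(2)]]) auto
  then have iE: "integrable lborel (\<lambda>x. norm (k x) * indicator E x)"
    by (intro integrableI_bounded) (auto simp: ennreal_mult ennreal_indicator)
  define G where "G x = norm (k x) * indicator E x + 1 / (1 + norm x) ^ N" for x
  have "integrable lborel G"
    unfolding G_def N_def by (intro Bochner_Integration.integrable_add iE integrable_inverse_one_plus_norm_power)
  moreover have "norm (k x * f x) \<le> schwartz_seminorm N f * G x" if f: "f \<in> schwartz" for f x
  proof -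
    define C where "C = schwartz_seminorm N f"
    define z where "z = (1 + norm x) ^ N"
    have "1 \<le> (1 + norm x) ^ N" by (rule one_le_power) simp
    then have z: "1 \<le> z" by (simp add: z_def)
    have fz: "z * norm (f x) \<le> C" unfolding z_def C_def by (rule schwartz_seminorm_bound[OF f])
    have C0: "0 \<le> C" by (rule order_trans[OF _ fz]) (use z in simp)
    have "norm (f x) \<le> z * norm (f x)" using z by (simp add: mult_le_cancel_right1)
    then have fC: "norm (f x) \<le> C" using fz by linarith
    show ?thesis
    proof (cases "x \<in> E")
      case True
      have "norm (k x * f x) \<le> norm (k x) * C" unfolding norm_mult by (intro mult_left_mono fC) simp
      also have "\<dots> \<le> C * G x"
        using True C0 z by (simp add: G_def z_def[symmetric] distrib_left mult.commute)
      finally show ?thesis by (simp add: C_def)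
    next
      case False
      have "norm (k x * f x) \<le> 1 * norm (f x)"
        unfolding norm_mult using False by (intro mult_right_mono) (auto simp: E_def)
      also have "\<dots> \<le> C / z" using fz z by (simp add: field_simps)
      also have "\<dots> = C * G x" using False by (simp add: G_def z_def[symmetric])
      finally show ?thesis by (simp add: C_def)
    qed
  qed
  ultimately show ?thesis by (rule that[of G, folded N_def])
qed

lemma tempered_regular_distr:
  fixes k k' :: "'a::euclidean_space \<Rightarrow> complex"
  assumes k' [measurable]: "k' \<in> borel_measurable borel" and ae: "AE x in lborel. k x = k' x"
    and A: "weak_bound q A k'" "0 < A" and q: "1 < q"
  shows "tempered (regular_distr k)"
proof -
  obtain G where G: "integrable lborel G"
    and le: "\<forall>f\<in>schwartz. \<forall>x. norm (k' x * f x) \<le> schwartz_seminorm (DIM('a) + 2) f * G x"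
    using integrable_weak_kernel_times_schwartz[OF k' A q] by metis
  have T: "regular_distr k f = (\<integral>x. k' x * f x \<partial>lborel)" if f: "f \<in> schwartz" for f
  proof -
    note [measurable] = schwartz_borel[OF f]
    have m: "(\<lambda>x. k' x * f x) \<in> borel_measurable borel" by measurable
    have ae': "AE x in lborel. k x * f x = k' x * f x" using ae by eventually_elim simp
    have "regular_distr k f = (\<integral>x. k' x * f x \<partial>lebesgue)"
      unfolding regular_distr_def
      using measurable_lebesgue_cong_AE[OF m ae'] m ae'
      by (intro integral_cong_AE) (auto simp: AE_lebesgue_iff measurable_completion)
    also have "\<dots> = (\<integral>x. k' x * f x \<partial>lborel)" by (intro integral_completion) simp
    finally show ?thesis .
  qed
  have int: "integrable lborel (\<lambda>x. k' x * f x)" if f: "f \<in> schwartz" for f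
  proof (rule Bochner_Integration.integrable_bound)
    show "integrable lborel (\<lambda>x. schwartz_seminorm (DIM('a) + 2) f * G x)" using G by simp
    show "(\<lambda>x. k' x * f x) \<in> borel_measurable lborel" using schwartz_borel[OF f] by simp
    show "AE x in lborel. norm (k' x * f x) \<le> norm (schwartz_seminorm (DIM('a) + 2) f * G x)"
      unfolding real_norm_def using le f by (intro AE_I2 order_trans[OF _ abs_ge_self]) auto
  qed
  have bd: "norm (regular_distr k f) \<le> (\<integral>x. G x \<partial>lborel) * schwartz_seminorm (DIM('a) + 2) f" if f: "f \<in> schwartz" for f
  proof -
    have "norm (regular_distr k f) \<le> (\<integral>x. norm (k' x * f x) \<partial>lborel)" unfolding T[OF f] by (rule integral_norm_bound)
    also have "\<dots> \<le> (\<integral>x. schwartz_seminorm (DIM('a) + 2) f * G x \<partial>lborel)"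
      using le f G int[OF f] by (intro integral_mono integrable_norm integrable_mult_right) auto
    finally show ?thesis by (simp add: mult.commute)
  qed
  show ?thesis
    unfolding tempered_def
  proof (intro conjI ballI allI)
    fix f g :: "'a \<Rightarrow> complex" assume fg: "f \<in> schwartz" "g \<in> schwartz"
    show "regular_distr k (\<lambda>x. f x + g x) = regular_distr k f + regular_distr k g"
      unfolding T[OF fg(1)] T[OF fg(2)] T[OF schwartz_add[OF fg]]
      using int[OF fg(1)] int[OF fg(2)] by (simp add: distrib_left)
  next
    fix c and f :: "'a \<Rightarrow> complex"
    have "regular_distr k (\<lambda>x. c * f x) = (\<integral>x. c * (k x * f x) \<partial>lebesgue)"
      unfolding regular_distr_def by (simp add: mult_ac)
    then show "regular_distr k (\<lambda>x. c * f x) = c * regular_distr k f" by (simp add: regular_distr_def)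
  next
    show "\<exists>C N. \<forall>f\<in>schwartz. norm (regular_distr k f) \<le> C * schwartz_seminorm N f" using bd by blast
  qed
qed

lemma powr_root_bound:
  fixes L M C :: real
  assumes "L \<le> C powr r * M powr (r / p)" "0 \<le> L" "0 \<le> C" "0 < r"
  shows "L powr (1 / r) \<le> C * M powr (1 / p)"
proof -
  have "L powr (1 / r) \<le> (C powr r * M powr (r / p)) powr (1 / r)"
    using assms by (intro powr_mono2) auto
  also have "\<dots> = C * M powr (1 / p)"
    using assms by (simp add: powr_mult powr_powr)
  finally show ?thesis .
qed

lemma tendsto_lpint_of_Lp_norm:
  assumes "(\<lambda>m. Lp_norm p (f m)) \<longlonglongrightarrow> 0" "0 < p"
  shows "(\<lambda>m. lpint lebesgue p (f m)) \<longlonglongrightarrow> 0"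
proof -
  have "(\<lambda>m. Lp_norm p (f m) powr p) \<longlonglongrightarrow> 0"
    by (rule tendsto_zero_powrI[OF assms(1) tendsto_const _ assms(2)]) (simp add: Lp_norm_eq_lpint)
  then show ?thesis using assms(2) by (simp add: Lp_norm_eq_lpint powr_powr)
qed

text \<open>The convolution integral itself is the continuous extension; the weak Young inequality gives its Lipschitz
  bound.\<close>

lemma Lp_continuous_conv:
  fixes k k' :: "'a::euclidean_space \<Rightarrow> complex"
  assumes e: "1 < p" "p < r" "1 / p + 1 / q = 1 + 1 / r"
    and k': "k' \<in> borel_measurable borel" "AE x in lborel. k x = k' x"
    and A: "weak_bound q A k'" "0 < A"
  shows "Lp_continuous p r (conv (regular_distr k))"
    "f \<in> Lp p \<Longrightarrow> Lp_norm r (conv (regular_distr k) f) \<le> weak_Young_const p q r * A powr (1 / q) * Lp_norm p f"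
proof -
  define C where "C = weak_Young_const p q r * A powr (1 / q)"
  have C: "0 \<le> C" using weak_Young_const_pos[OF e] by (simp add: C_def)
  note WY = weak_Young[OF e k'(1) A]
  let ?K = "conv (regular_distr k)"
  have cvK: "?K f = convolve k' f'" if "f' \<in> borel_measurable borel" "AE x in lborel. f x = f' x" for f f'
    by (rule ext) (rule conv_regular_distr_eq_convolve[OF k' that])
  have bound: "?K f \<in> Lp r \<and> Lp_norm r (?K f) \<le> C * Lp_norm p f" if f: "f \<in> Lp p" for f
  proof -
    obtain f' where f': "f' \<in> lpspace lborel p" "AE x in lborel. f x = f' x" "Lp_norm p f = lpint lborel p f' powr (1 / p)"
      by (rule Lp_borel_representative[OF f])
    have m: "f' \<in> borel_measurable borel" using lpspaceD(1)[OF f'(1)] by simp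
    have cm: "convolve k' f' \<in> borel_measurable borel" using m k'(1) by measurable
    note L = Lp_cong_lborel[OF cm, of "convolve k' f'"]
    have "lpint lborel r (convolve k' f') powr (1 / r) \<le> C * lpint lborel p f' powr (1 / p)"
      using WY(3)[OF f'(1)] C e unfolding C_def by (intro powr_root_bound) auto
    then show ?thesis unfolding cvK[OF m f'(2)] f'(3) using L WY(2)[OF f'(1)] by auto
  qed
  then show "f \<in> Lp p \<Longrightarrow> Lp_norm r (?K f) \<le> weak_Young_const p q r * A powr (1 / q) * Lp_norm p f"
    by (simp add: C_def)
  have diff: "Lp_norm r (\<lambda>x. ?K g x - ?K f x) \<le> C * Lp_norm p (\<lambda>x. g x - f x)"
    if fg: "f \<in> Lp p" "g \<in> Lp p" for f g
  proof -
    obtain f' where f': "f' \<in> lpspace lborel p" "AE x in lborel. f x = f' x"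
      using Lp_borel_representative[OF fg(1)] by metis
    obtain g' where g': "g' \<in> lpspace lborel p" "AE x in lborel. g x = g' x"
      using Lp_borel_representative[OF fg(2)] by metis
    have m [measurable]: "f' \<in> borel_measurable borel" "g' \<in> borel_measurable borel" "k' \<in> borel_measurable borel"
      using lpspaceD(1)[OF f'(1)] lpspaceD(1)[OF g'(1)] k' by simp_all
    have d: "AE x in lborel. ?K g x - ?K f x = ?K (\<lambda>x. g x - f x) x"
    proof -
      have ae: "AE x in lborel. g x - f x = g' x - f' x" using f'(2) g'(2) by eventually_elim simp
      have dm: "(\<lambda>x. g' x - f' x) \<in> borel_measurable borel" by measurable
      show ?thesis
        unfolding cvK[OF dm ae] cvK[OF m(1) f'(2)] cvK[OF m(2) g'(2)]
        using AE_convolve_diff[OF e k'(1) A g'(1) f'(1)] by eventually_elim simp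
    qed
    have dl: "(\<lambda>x. g x - f x) \<in> Lp p"
      using fg e unfolding Lp_eq_lpspace by (intro lpspace_diff(1)) auto
    have "Lp_norm r (\<lambda>x. ?K g x - ?K f x) = Lp_norm r (?K (\<lambda>x. g x - f x))"
      unfolding Lp_norm_eq_lpint
      using bound[OF fg(1)] bound[OF fg(2)] bound[OF dl] d
      by (intro arg_cong[where f = "\<lambda>t. t powr (1 / r)"] lpint_cong_AE) (auto simp: AE_lebesgue_iff Lp_def)
    then show ?thesis using bound[OF dl] by simp
  qed
  show "Lp_continuous p r ?K"
    unfolding Lp_continuous_def
  proof (intro conjI ballI allI impI)
    show "?K f \<in> Lp r" if "f \<in> Lp p" for f using bound[OF that] by simp
    fix f and F :: "nat \<Rightarrow> 'a \<Rightarrow> complex"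
    assume f: "f \<in> Lp p" and F: "(\<forall>m. F m \<in> Lp p) \<and> (\<lambda>m. Lp_norm p (\<lambda>x. F m x - f x)) \<longlonglongrightarrow> 0"
    show "(\<lambda>m. Lp_norm r (\<lambda>x. ?K (F m) x - ?K f x)) \<longlonglongrightarrow> 0"
    proof (rule tendsto_sandwich[where f = "\<lambda>_. 0" and h = "\<lambda>m. C * Lp_norm p (\<lambda>x. F m x - f x)"])
      have "(\<lambda>m. C * Lp_norm p (\<lambda>x. F m x - f x)) \<longlonglongrightarrow> C * 0" using F by (intro tendsto_mult tendsto_const) auto
      then show "(\<lambda>m. C * Lp_norm p (\<lambda>x. F m x - f x)) \<longlonglongrightarrow> 0" by simp
      show "\<forall>\<^sub>F m in sequentially. 0 \<le> Lp_norm r (\<lambda>x. ?K (F m) x - ?K f x)"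
        by (simp add: Lp_norm_def)
      show "\<forall>\<^sub>F m in sequentially. Lp_norm r (\<lambda>x. ?K (F m) x - ?K f x) \<le> C * Lp_norm p (\<lambda>x. F m x - f x)"
        using F f by (intro always_eventually allI diff) auto
    qed simp
  qed
qed

lemma schwartz_sequence:
  fixes f :: "'a::euclidean_space \<Rightarrow> complex"
  assumes f: "f \<in> Lp p" and p: "1 \<le> p"
  obtains F where "\<forall>m. F m \<in> schwartz" "\<forall>m. F m \<in> Lp p" "(\<lambda>m::nat. Lp_norm p (\<lambda>x. F m x - f x)) \<longlonglongrightarrow> 0"
proof -
  obtain f' where f': "f' \<in> lpspace lborel p" "AE x in lborel. f x = f' x"
    using Lp_borel_representative[OF f] by metis
  have m: "f' \<in> borel_measurable borel" using lpspaceD(1)[OF f'(1)] by simp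
  have "\<exists>g. g \<in> schwartz \<and> lpint lborel p (\<lambda>x. g x - f' x) < 1 / real (Suc m)" for m
    using schwartz_dense[OF f'(1) p] by (metis of_nat_0_less_iff zero_less_Suc zero_less_divide_1_iff)
  then obtain F where F: "\<And>m. F m \<in> schwartz" "\<And>m. lpint lborel p (\<lambda>x. F m x - f' x) < 1 / real (Suc m)" by metis
  have Fb: "F m \<in> borel_measurable borel" for m by (rule schwartz_borel[OF F(1)])
  have FL: "F m \<in> Lp p" for m
    using Lp_cong_lborel(1)[OF Fb, of "F m" m p] schwartz_lpspace[OF F(1) p] by simp
  have eq: "Lp_norm p (\<lambda>x. F m x - f x) = lpint lborel p (\<lambda>x. F m x - f' x) powr (1 / p)" for m
    using f'(2) Fb m by (intro Lp_cong_lborel(2)) auto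
  have "(\<lambda>m. lpint lborel p (\<lambda>x. F m x - f' x)) \<longlonglongrightarrow> 0"
  proof (rule tendsto_sandwich[where f = "\<lambda>_. 0" and h = "\<lambda>m. 1 / real (Suc m)"])
    show "(\<lambda>m. 1 / real (Suc m)) \<longlonglongrightarrow> 0" using LIMSEQ_inverse_real_of_nat by (simp add: inverse_eq_divide)
    show "\<forall>\<^sub>F m in sequentially. lpint lborel p (\<lambda>x. F m x - f' x) \<le> 1 / real (Suc m)"
      by (intro always_eventually allI less_imp_le F(2))
  qed auto
  then have "(\<lambda>m. Lp_norm p (\<lambda>x. F m x - f x)) \<longlonglongrightarrow> 0"
    unfolding eq using p by (intro tendsto_zero_powrI[where b = "1 / p"]) auto
  then show ?thesis using F(1) FL by (intro that[of F]) auto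
qed

text \<open>The extensions are not assumed linear, so both are compared along one sequence of Schwartz functions.\<close>

lemma Lp_continuous_unique:
  fixes K L :: "('a::euclidean_space \<Rightarrow> complex) \<Rightarrow> 'a \<Rightarrow> complex"
  assumes K: "Lp_continuous p r K" and L: "Lp_continuous p r L"
    and eq: "\<And>f. f \<in> schwartz \<Longrightarrow> AE x in lebesgue. K f x = L f x"
    and pr: "1 \<le> p" "0 < r" and f: "f \<in> Lp p"
  shows "AE x in lebesgue. K f x = L f x"
proof -
  obtain F where F: "\<forall>m. F m \<in> schwartz" "\<forall>m. F m \<in> Lp p" "(\<lambda>m. Lp_norm p (\<lambda>x. F m x - f x)) \<longlonglongrightarrow> 0"
    by (rule schwartz_sequence[OF f pr(1)])
  have r0: "0 \<le> r" using pr by simp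
  have Kl: "K g \<in> lpspace lebesgue r" "L g \<in> lpspace lebesgue r" if "g \<in> Lp p" for g
    using K L that by (auto simp: Lp_continuous_def Lp_eq_lpspace)
  have limK: "(\<lambda>m. lpint lebesgue r (\<lambda>x. K (F m) x - K f x)) \<longlonglongrightarrow> 0"
    using K f F pr(2) unfolding Lp_continuous_def by (intro tendsto_lpint_of_Lp_norm) auto
  have limL: "(\<lambda>m. lpint lebesgue r (\<lambda>x. L (F m) x - L f x)) \<longlonglongrightarrow> 0"
    using L f F pr(2) unfolding Lp_continuous_def by (intro tendsto_lpint_of_Lp_norm) auto
  define M where "M = lpint lebesgue r (\<lambda>x. K f x - L f x)"
  have le: "M \<le> 2 powr r * (lpint lebesgue r (\<lambda>x. L (F m) x - L f x) + lpint lebesgue r (\<lambda>x. K (F m) x - K f x))" for m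
  proof -
    have FL: "F m \<in> Lp p" using F by simp
    note d1 = lpspace_diff(1)[OF Kl(2)[OF FL] Kl(2)[OF f] r0]
    note d2 = lpspace_diff(1)[OF Kl(1)[OF FL] Kl(1)[OF f] r0]
    have ae: "AE x in lebesgue. K f x - L f x = (L (F m) x - L f x) - (K (F m) x - K f x)"
      using eq[OF F(1)[rule_format, of m]] by eventually_elim simp
    have "M = lpint lebesgue r (\<lambda>x. (L (F m) x - L f x) - (K (F m) x - K f x))"
      unfolding M_def
      by (rule lpint_cong_AE[OF lpspaceD(1)[OF lpspace_diff(1)[OF Kl[OF f] r0]] lpspaceD(1)[OF lpspace_diff(1)[OF d1 d2 r0]] ae])
    also have "\<dots> \<le> 2 powr r * (lpint lebesgue r (\<lambda>x. L (F m) x - L f x) + lpint lebesgue r (\<lambda>x. K (F m) x - K f x))"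
      by (rule lpspace_diff(2)[OF d1 d2 r0])
    finally show ?thesis .
  qed
  have "(\<lambda>m. 2 powr r * (lpint lebesgue r (\<lambda>x. L (F m) x - L f x) + lpint lebesgue r (\<lambda>x. K (F m) x - K f x))) \<longlonglongrightarrow> 2 powr r * (0 + 0)"
    by (intro tendsto_intros limK limL)
  then have "M \<le> 2 powr r * (0 + 0)"
    by (rule tendsto_lowerbound) (use le in \<open>auto intro: always_eventually\<close>)
  moreover have "0 \<le> M" by (simp add: M_def)
  ultimately have "M = 0" by simp
  then have "AE x in lebesgue. K f x - L f x = 0"
    unfolding M_def using lpint_eq_0_iff[OF lpspace_diff(1)[OF Kl[OF f] r0]] by simp
  then show ?thesis by eventually_elim simp
qed

theorem theorem2:
  fixes k :: "real ^ 'n \<Rightarrow> complex" and p q r :: real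
  assumes "1 < p" and "p < r"
    and "1 / p + 1 / q = 1 + 1 / r"
    and "k \<in> weak_L0 q"
  shows "regular_distr k \<in> Cnv p r \<and>
    (\<exists>f. is_maximizer p r (conv_op p r (regular_distr k)) f)"
proof -
  note e = assms(1-3)
  note ee = conv_exponents[OF e]
  have km: "k \<in> borel_measurable lebesgue" using assms(4) by (auto simp: weak_L0_def weak_L_def)
  obtain k' where k': "k' \<in> borel_measurable borel" "AE x in lborel. k x = k' x"
    by (rule lebesgue_borel_representative[OF km])
  have appr: "approximable q k'" using ee(1) by (intro weak_L0_approximable[OF assms(4) _ k']) simp
  then obtain A where A: "0 < A" "weak_bound q A k'" by (auto simp: approximable_def)
  let ?T = "regular_distr k"
  let ?C = "weak_Young_const p q r * A powr (1 / q)"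
  have C: "0 \<le> ?C" using weak_Young_const_pos[OF e] by simp
  note cont = Lp_continuous_conv[OF e k' A(2,1)]
  have schwartz_Lp: "f \<in> Lp p" if "f \<in> schwartz" for f :: "real ^ 'n \<Rightarrow> complex"
    using Lp_cong_lborel(1)[OF schwartz_borel[OF that], of f p] schwartz_lpspace[OF that] e by simp
  have "?T \<in> Cnv p r"
    unfolding Cnv_def
  proof (intro CollectI conjI exI[of _ ?C] ballI)
    show "tempered ?T" by (rule tempered_regular_distr[OF k' A(2,1) ee(1)])
    fix f :: "real ^ 'n \<Rightarrow> complex" assume "f \<in> schwartz"
    then have f: "f \<in> Lp p" by (rule schwartz_Lp)
    show "conv ?T f \<in> Lp r" using cont(1) f by (simp add: Lp_continuous_def)
    show "Lp_norm r (conv ?T f) \<le> ?C * Lp_norm p f" by (rule cont(2)[OF f])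
  qed
  moreover have "\<exists>f. is_maximizer p r (conv_op p r ?T) f"
  proof -
    define K where "K = conv_op p r ?T"
    have "\<exists>K. Lp_continuous p r K \<and> (\<forall>f\<in>schwartz. AE x in lebesgue. K f x = conv ?T f x)"
      using cont(1) by (intro exI[of _ "conv ?T"]) simp
    from someI_ex[OF this] have K: "Lp_continuous p r K" "\<And>f. f \<in> schwartz \<Longrightarrow> AE x in lebesgue. K f x = conv ?T f x"
      unfolding K_def conv_op_def by auto
    have K_eq: "Lp_norm r (K f) = Lp_norm r (conv ?T f)" if f: "f \<in> Lp p" for f
    proof -
      have "AE x in lebesgue. K f x = conv ?T f x"
        using e by (intro Lp_continuous_unique[OF K(1) cont(1) K(2) _ _ f]) auto
      then show ?thesis
        unfolding Lp_norm_eq_lpint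
        using K(1) cont(1) f
        by (intro arg_cong[where f = "\<lambda>t. t powr (1 / r)"] lpint_cong_AE) (auto simp: Lp_continuous_def Lp_def)
    qed
    obtain F where F: "F \<in> lpspace lborel p" "lpint lborel p F = 1"
      "\<And>f. f \<in> lpspace lborel p \<Longrightarrow> lpint lborel p f \<le> 1 \<Longrightarrow> lpint lborel r (convolve k' f) \<le> lpint lborel r (convolve k' F)"
      using convolve_has_maximizer[OF e appr] by blast
    have Fm: "F \<in> borel_measurable borel" using lpspaceD(1)[OF F(1)] by simp
    have FL: "F \<in> Lp p" "Lp_norm p F = 1"
      using Lp_cong_lborel[OF Fm, of F p] F by simp_all
    have cvK: "Lp_norm r (conv ?T f) = lpint lborel r (convolve k' f') powr (1 / r)"
      if "f' \<in> borel_measurable borel" "AE x in lborel. f x = f' x" for f f'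
    proof -
      have "conv ?T f = convolve k' f'" by (rule ext) (rule conv_regular_distr_eq_convolve[OF k' that])
      moreover have "convolve k' f' \<in> borel_measurable borel" using k'(1) that(1) by measurable
      ultimately show ?thesis using Lp_cong_lborel(2)[of "convolve k' f'" "convolve k' f'"] by simp
    qed
    have max: "Lp_norm r (K f) \<le> Lp_norm r (K F)" if f: "f \<in> Lp p" "Lp_norm p f \<le> 1" for f
    proof -
      obtain f' where f': "f' \<in> lpspace lborel p" "AE x in lborel. f x = f' x" "Lp_norm p f = lpint lborel p f' powr (1 / p)"
        by (rule Lp_borel_representative[OF f(1)])
      have m: "f' \<in> borel_measurable borel" using lpspaceD(1)[OF f'(1)] by simp
      have "(lpint lborel p f' powr (1 / p)) powr p \<le> 1 powr p"
        using f(2) f'(3) e by (intro powr_mono2) auto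
      then have "lpint lborel p f' \<le> 1" using e by (simp add: powr_powr)
      then have "lpint lborel r (convolve k' f') \<le> lpint lborel r (convolve k' F)" by (rule F(3)[OF f'(1)])
      then show ?thesis
        unfolding K_eq[OF f(1)] K_eq[OF FL(1)] cvK[OF m f'(2)] cvK[OF Fm, of F, simplified]
        using e by (intro powr_mono2) auto
    qed
    have "op_norm p r K = Lp_norm r (K F)"
      unfolding op_norm_def
    proof (rule antisym)
      show "(SUP f\<in>{f \<in> Lp p. Lp_norm p f \<le> 1}. Lp_norm r (K f)) \<le> Lp_norm r (K F)"
        by (rule cSUP_least) (use FL max in auto)
      show "Lp_norm r (K F) \<le> (SUP f\<in>{f \<in> Lp p. Lp_norm p f \<le> 1}. Lp_norm r (K f))"
        by (rule cSUP_upper) (use FL max in \<open>auto intro!: bdd_aboveI[of _ "Lp_norm r (K F)"]\<close>)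
    qed
    then have "is_maximizer p r K F" using FL by (simp add: is_maximizer_def)
    then show ?thesis unfolding K_def by blast
  qed
  ultimately show ?thesis by blast
qed

end
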